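(* Suppose that $p \in P_{4,4}$ and $p \notin \Sigma_{4,4}$. Then there exist three real quadrics $q_1,q_2,q_3 \in H_{4,2}$ intersecting in $8$ (possibly complex) projective points $\gamma_1,\ldots,\gamma_8 \in \mathbb{CP}^3$ such that the values of $p$ on the $\gamma_i$ certify that $p$ is not a sum of squares. More precisely, let $z_1,\ldots,z_8 \in \mathbb{C}^4$ be affine representatives of $\gamma_1,\ldots,\gamma_8$. Then there exists a real (i.e. real-valued) linear functional $\ell: H_{4,4} \rightarrow \mathbb{R}$ given by $$\ell(f)=\sum_{i=1}^8 \mu_i f(z_i)$$ for some $\mu_i \in \mathbb{C}$, such that $\ell(r) \geq 0$ for all $r \in \Sigma_{4,4}$ and $\ell(p)<0$. Furthermore, at most $2$ of the points $\gamma_i$ are complex (i.e. non-real).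
   Context: $H_{n,d}$ is the real vector space of real forms (homogeneous polynomials) of degree $d$ in $n$ variables. $P_{n,2d}=\{p\in H_{n,2d} : p(x)\ge 0 \text{ for all } x\in\mathbb{R}^n\}$, and $\Sigma_{n,2d}=\{p\in H_{n,2d} : p=\sum_i q_i^2 \text{ (finite sum) for some } q_i\in H_{n,d}\}$. "Intersecting in $8$ projective points" means that the common zero set of $q_1,q_2,q_3$ in $\mathbb{CP}^3$ consists of $8$ distinct points. An affine representative of a projective point $\gamma$ is a nonzero vector $z\in\mathbb{C}^n$ spanning the line $\gamma$. A projective point is real if it has a representative in $\mathbb{R}^n$. *)

theory Defs
  imports "HOL-Analysis.Analysis" "HOL-Library.Poly_Mapping"
begin

text \<open>
  The variables of a polynomial are indexed by a finite type \<open>'n\<close>, as are the coordinates of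
  the vectors it is evaluated at. A monomial is its exponent vector, of type \<open>'n \<Rightarrow>\<^sub>0 nat\<close>, and
  multiplication of polynomials is the convolution product of \<^theory>\<open>HOL-Library.Poly_Mapping\<close>.
\<close>

type_synonym 'n real_mpoly = "('n \<Rightarrow>\<^sub>0 nat) \<Rightarrow>\<^sub>0 real"

definition monom_degree :: "('n::finite \<Rightarrow>\<^sub>0 nat) \<Rightarrow> nat" where
  "monom_degree m = (\<Sum>i\<in>UNIV. Poly_Mapping.lookup m i)"

text \<open>Used below for both \<open>'a = real\<close> and \<open>'a = complex\<close>.\<close>

definition eval_at :: "'n::finite real_mpoly \<Rightarrow> 'a::real_field ^ 'n \<Rightarrow> 'a" where
  "eval_at f x =
     (\<Sum>m\<in>Poly_Mapping.keys f.
        of_real (Poly_Mapping.lookup f m) * (\<Prod>i\<in>UNIV. (x $ i) ^ Poly_Mapping.lookup m i))"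

text \<open>\<open>H\<^bsub>n,d\<^esub>\<close> for \<open>n = CARD('n)\<close>; the zero polynomial belongs to it for every \<open>d\<close>.\<close>

definition forms :: "nat \<Rightarrow> 'n::finite real_mpoly set" where
  "forms d = {f. \<forall>m\<in>Poly_Mapping.keys f. monom_degree m = d}"

text \<open>The next two sets are \<open>P\<^bsub>n,2d\<^esub>\<close> and \<open>\<Sigma>\<^bsub>n,2d\<^esub>\<close>: the argument \<open>d\<close> is half the degree.\<close>

definition psd_forms :: "nat \<Rightarrow> 'n::finite real_mpoly set" where
  "psd_forms d = {p \<in> forms (2 * d). \<forall>x :: real ^ 'n. eval_at p x \<ge> 0}"

definition sos_forms :: "nat \<Rightarrow> 'n::finite real_mpoly set" where
  "sos_forms d =
     {p \<in> forms (2 * d).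
        \<exists>(k::nat) q. (\<forall>i<k. q i \<in> forms d) \<and> p = (\<Sum>i<k. (q i)\<^sup>2)}"

definition linear_functional_on_forms :: "nat \<Rightarrow> ('n::finite real_mpoly \<Rightarrow> real) \<Rightarrow> bool" where
  "linear_functional_on_forms d l \<longleftrightarrow>
     (\<forall>f\<in>forms d. \<forall>g\<in>forms d. l (f + g) = l f + l g) \<and>
     (\<forall>c. \<forall>f\<in>forms d. l (Poly_Mapping.map ((*) c) f) = c * l f)"

text \<open>A point of complex projective space is a line through the origin of \<open>\<complex>\<^sup>n\<close>, as a set of vectors.\<close>

definition affine_rep :: "complex ^ 'n \<Rightarrow> (complex ^ 'n) set \<Rightarrow> bool" where
  "affine_rep z \<gamma> \<longleftrightarrow> z \<noteq> 0 \<and> vec.span {z} = \<gamma>"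

definition complex_proj_space :: "(complex ^ 'n) set set" where
  "complex_proj_space = {\<gamma>. \<exists>z. affine_rep z \<gamma>}"

definition real_proj_point :: "(complex ^ 'n) set \<Rightarrow> bool" where
  "real_proj_point \<gamma> \<longleftrightarrow> (\<exists>x :: real ^ 'n. affine_rep (\<chi> i. complex_of_real (x $ i)) \<gamma>)"

definition proj_zero_set :: "'n::finite real_mpoly set \<Rightarrow> (complex ^ 'n) set set" where
  "proj_zero_set F =
     {\<gamma> \<in> complex_proj_space. \<forall>f\<in>F. \<forall>z. affine_rep z \<gamma> \<longrightarrow> eval_at f z = 0}"

end

theory Submission
  imports Defs "HOL-Computational_Algebra.Fundamental_Theorem_Algebra" "HOL-Real_Asymp.Real_Asymp"
begin

text \<open>
  The proof produces the certificate from the geometry of one well chosen functional.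

  Choosing the functional. The sums of squares of quadrics form a closed convex cone, so some
  functional \<open>l\<close> is nonnegative on squares of quadrics and negative at \<open>p\<close>. Its radical \<open>W\<close>, the
  kernel of the positive semidefinite form \<open>(q, r) \<mapsto> l (q * r)\<close> on quadrics, is taken of the largest
  possible dimension. Then every functional that kills \<open>W\<close> times the quadrics is a multiple of \<open>l\<close> on
  quartics, because otherwise \<open>l\<close> could be moved, with its value at \<open>p\<close> fixed, to a functional with a
  larger radical (\<open>extremal_functional\<close>). If the ideal of \<open>W\<close> missed a quintic, this rigidity would make
  \<open>l\<close> a nonnegative multiple of the evaluation at a real point, which is impossible as \<open>p\<close> is
  nonnegative; so \<open>W\<close> generates an ideal containing all quintics (\<open>radical_primary\<close>).

  Eight points. Among the finite subsets of \<open>W\<close> whose ideal contains a power of every variable, a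
  smallest one is algebraically independent, as a relation would allow one generator to be dropped
  (\<open>minimal_primary_independent\<close>). Comparing the growth of dimensions shows that it has exactly four
  members \<open>q\<^sub>0, \<dots>, q\<^sub>3\<close> and that the polynomial ring has rank \<open>16\<close> over the polynomials in them
  (\<open>generic_basis\<close>). For a generic real vector \<open>y\<close> the Jacobian does not vanish on the fibre of points
  \<open>z \<in> \<complex>\<^sup>4\<close> with \<open>q\<^sub>l z = y\<^sub>l\<close>, and the rank is the number of its points (\<open>card_generic_fibre\<close>). The
  fibre is symmetric about the origin, hence consists of \<open>8\<close> pairs \<open>\<plusminus>z\<close>. These are eight projective
  points, and they are exactly the common zeros of the three-dimensional net of quadrics
  \<open>\<Sum>\<^sub>l b\<^sub>l q\<^sub>l\<close> with \<open>\<Sum>\<^sub>l b\<^sub>l y\<^sub>l = 0\<close>.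

  The relation. The base locus of the net is finite, so no three of the eight points are collinear and
  no five are coplanar. Therefore any point out of seven is separated from the other six by a pair of
  planes (\<open>separating_quadric\<close>). The quadrics vanishing at seven of the points are then just the net,
  which vanishes at the eighth as well; this gives a relation \<open>\<Sum>\<^sub>z u\<^sub>z g z = 0\<close> for the
  values of all quadrics \<open>g\<close>, with all \<open>u\<^sub>z\<close> nonzero, and it is the only restriction on these values
  (\<open>cayley_bacharach\<close>).

  The certificate. As every \<open>q\<^sub>l\<close> is constant on the fibre, the functional \<open>f \<mapsto> \<Sum>\<^sub>z u\<^sub>z f z\<close>
  kills all products of \<open>q\<^sub>l\<close> with quadrics, and so does \<open>l\<close>. Letting \<open>y\<close> vary, the net description shows that
  the \<open>q\<^sub>l\<close> have only the six obvious syzygies with quadratic coefficients, so these products span a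
  space of dimension \<open>4 \<cdot> 10 - 6 = 34\<close> in the quartics, whose dimension is \<open>35\<close>. The two functionals are
  therefore proportional (\<open>functional_unique\<close>), and \<open>l\<close> is a combination of evaluations at the eight
  points.

  Nonreal points. Complex conjugation permutes the points and conjugates their coefficients. With two
  distinct conjugate pairs there would be a real quadric, vanishing at the other four points, whose square has
  negative value under \<open>l\<close>: each pair contributes a negative square, and the relation imposes only one real
  equation (\<open>at_most_two_nonreal\<close>).
\<close>

section \<open>Real polynomials and substitution homomorphisms\<close>

text \<open>
  Scalar multiplication makes the real linear algebra of the libraries (linear maps, spans, dimensions,
  functionals separating a vector from a span) available for polynomials.
\<close>

instantiation poly_mapping :: (type, real_vector) real_vector
begin

lift_definition scaleR_poly_mapping :: "real \<Rightarrow> ('a \<Rightarrow>\<^sub>0 'b) \<Rightarrow> 'a \<Rightarrow>\<^sub>0 'b"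
  is "\<lambda>c f k. c *\<^sub>R f k"
proof -
  fix c :: real and f :: "'a \<Rightarrow> 'b"
  assume "finite {k. f k \<noteq> 0}"
  then show "finite {k. c *\<^sub>R f k \<noteq> 0}" by (rule rev_finite_subset) auto
qed

instance
  by standard (transfer, force simp: algebra_simps scaleR_add_left scaleR_add_right)+

end

lemma lookup_scaleR [simp]: "Poly_Mapping.lookup (c *\<^sub>R f) k = c *\<^sub>R Poly_Mapping.lookup f k"
  by transfer simp

instance poly_mapping :: (comm_monoid_add, "{real_algebra_1, comm_ring_1}") real_algebra_1
proof
  fix a :: real and x y :: "'a \<Rightarrow>\<^sub>0 'b"
  have mon: "a *\<^sub>R f = Poly_Mapping.single 0 (a *\<^sub>R 1) * f" for f :: "'a \<Rightarrow>\<^sub>0 'b"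
  proof -
    have "Poly_Mapping.map ((*) (a *\<^sub>R 1)) f = a *\<^sub>R f"
      by (rule poly_mapping_eqI) (simp add: Poly_Mapping.map.rep_eq when_def)
    then show ?thesis by (simp add: mult_map_scale_conv_mult)
  qed
  show "a *\<^sub>R x * y = a *\<^sub>R (x * y)" by (simp add: mon mult.assoc)
  show "x * a *\<^sub>R y = a *\<^sub>R (x * y)" by (simp add: mon mult.assoc mult.left_commute)
qed

lemma map_times_eq_scaleR: "Poly_Mapping.map ((*) c) f = c *\<^sub>R (f :: 'a \<Rightarrow>\<^sub>0 real)"
  by (rule poly_mapping_eqI) (simp add: Poly_Mapping.map.rep_eq when_def)

text \<open>
  The same number as \<open>monom_degree\<close>, but over variable types that need not be finite: polynomial
  relations between members of a family are polynomials in variables indexed by that family.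
\<close>

definition mdeg :: "('v \<Rightarrow>\<^sub>0 nat) \<Rightarrow> nat" where
  "mdeg m = (\<Sum>i\<in>Poly_Mapping.keys m. Poly_Mapping.lookup m i)"

definition mon :: "('v \<Rightarrow>\<^sub>0 nat) \<Rightarrow> ('v \<Rightarrow>\<^sub>0 nat) \<Rightarrow>\<^sub>0 real" where
  "mon m = Poly_Mapping.single m 1"

definition X :: "'v \<Rightarrow> ('v \<Rightarrow>\<^sub>0 nat) \<Rightarrow>\<^sub>0 real" where
  "X i = mon (Poly_Mapping.single i 1)"

definition mon_value :: "('v \<Rightarrow> 'a::comm_ring_1) \<Rightarrow> ('v \<Rightarrow>\<^sub>0 nat) \<Rightarrow> 'a" where
  "mon_value g m = (\<Prod>i\<in>Poly_Mapping.keys m. g i ^ Poly_Mapping.lookup m i)"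

text \<open>
  The homomorphism of real algebras that sends the variable \<open>X i\<close> to \<open>g i\<close>. It covers evaluation at real
  and at complex points (\<open>g = ($) z\<close>) as well as the substitution of quadrics into a relation.
\<close>

definition psubst :: "('v \<Rightarrow> 'a::{real_algebra_1,comm_ring_1}) \<Rightarrow> (('v \<Rightarrow>\<^sub>0 nat) \<Rightarrow>\<^sub>0 real) \<Rightarrow> 'a" where
  "psubst g f = (\<Sum>m\<in>Poly_Mapping.keys f. Poly_Mapping.lookup f m *\<^sub>R mon_value g m)"

definition pvars :: "'v set \<Rightarrow> (('v \<Rightarrow>\<^sub>0 nat) \<Rightarrow>\<^sub>0 real) set" where
  "pvars V = {f. \<forall>m\<in>Poly_Mapping.keys f. Poly_Mapping.keys m \<subseteq> V}"

lemma mdeg_sum: assumes "finite A" "Poly_Mapping.keys m \<subseteq> A"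
  shows "mdeg m = (\<Sum>i\<in>A. Poly_Mapping.lookup m i)"
  unfolding mdeg_def using assms by (intro sum.mono_neutral_left) (auto simp: in_keys_iff)

lemma keys_plus_nat: "Poly_Mapping.keys (m + n :: 'v \<Rightarrow>\<^sub>0 nat) = Poly_Mapping.keys m \<union> Poly_Mapping.keys n"
  by (auto simp: in_keys_iff lookup_add)

lemma mdeg_add [simp]: "mdeg (m + n) = mdeg m + mdeg n"
proof -
  let ?A = "Poly_Mapping.keys m \<union> Poly_Mapping.keys n"
  have "mdeg (m+n) = (\<Sum>i\<in>?A. Poly_Mapping.lookup (m+n) i)"
    by (rule mdeg_sum) (auto simp: keys_plus_nat)
  moreover have "mdeg m = (\<Sum>i\<in>?A. Poly_Mapping.lookup m i)" "mdeg n = (\<Sum>i\<in>?A. Poly_Mapping.lookup n i)"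
    by (rule mdeg_sum; auto)+
  ultimately show ?thesis by (simp add: lookup_add sum.distrib)
qed

lemma mdeg_0 [simp]: "mdeg 0 = 0" by (simp add: mdeg_def)
lemma mdeg_single [simp]: "mdeg (Poly_Mapping.single i k) = k" by (simp add: mdeg_def)
lemma monom_degree_mdeg: "monom_degree m = mdeg m"
  unfolding monom_degree_def by (rule mdeg_sum[symmetric]) auto

lemma mdeg_eq_0_iff: "mdeg m = 0 \<longleftrightarrow> m = 0"
  by (auto simp: mdeg_def in_keys_iff poly_mapping_eq_iff fun_eq_iff)

lemma mon_value_prod: assumes "finite A" "Poly_Mapping.keys m \<subseteq> A"
  shows "mon_value g m = (\<Prod>i\<in>A. g i ^ Poly_Mapping.lookup m i)"
  unfolding mon_value_def using assms by (intro prod.mono_neutral_left) (auto simp: in_keys_iff)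

lemma mon_value_add [simp]: "mon_value g (m + n) = mon_value g m * mon_value g n"
proof -
  let ?A = "Poly_Mapping.keys m \<union> Poly_Mapping.keys n"
  have "mon_value g (m+n) = (\<Prod>i\<in>?A. g i ^ Poly_Mapping.lookup (m+n) i)"
    by (rule mon_value_prod) (auto simp: keys_plus_nat)
  moreover have "mon_value g m = (\<Prod>i\<in>?A. g i ^ Poly_Mapping.lookup m i)" "mon_value g n = (\<Prod>i\<in>?A. g i ^ Poly_Mapping.lookup n i)"
    by (rule mon_value_prod; auto)+
  ultimately show ?thesis by (simp add: lookup_add prod.distrib power_add)
qed

lemma mon_value_0 [simp]: "mon_value g 0 = 1" by (simp add: mon_value_def)
lemma mon_value_single [simp]: "mon_value g (Poly_Mapping.single i k) = g i ^ k" by (cases "k = 0") (auto simp: mon_value_def)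

lemma mon_mult: "mon m * mon n = mon (m + n)" by (simp add: mon_def mult_single)
lemma mon_0: "mon 0 = 1" by (simp add: mon_def)
lemma keys_mon [simp]: "Poly_Mapping.keys (mon m) = {m}" by (simp add: mon_def)
lemma lookup_mon: "Poly_Mapping.lookup (mon m) k = (if m = k then 1 else 0)"
  by (simp add: mon_def lookup_single when_def)

lemma keys_scaleR: "Poly_Mapping.keys (c *\<^sub>R f :: 'a \<Rightarrow>\<^sub>0 real) = (if c = 0 then {} else Poly_Mapping.keys f)"
  by (auto simp: in_keys_iff)

lemma lookup_sum_mon:
  assumes "finite I"
  shows "Poly_Mapping.lookup (\<Sum>m\<in>I. c m *\<^sub>R mon m) k = (if k \<in> I then c k else 0)"
proof -
  have "Poly_Mapping.lookup (\<Sum>m\<in>I. c m *\<^sub>R mon m) k = (\<Sum>m\<in>I. if m = k then c k else 0)"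
    unfolding lookup_sum by (intro sum.cong) (auto simp: lookup_mon)
  then show ?thesis using assms by simp
qed

lemma mon_expand_gen:
  assumes "finite A" "Poly_Mapping.keys f \<subseteq> A"
  shows "f = (\<Sum>m\<in>A. Poly_Mapping.lookup f m *\<^sub>R mon m)"
  by (rule poly_mapping_eqI) (use assms in \<open>auto simp: lookup_sum_mon in_keys_iff\<close>)

lemmas mon_expand = mon_expand_gen[OF finite_keys order_refl]

lemma mpoly_induct [case_names zero add mon]:
  assumes "P 0" "\<And>f g. P f \<Longrightarrow> P g \<Longrightarrow> P (f + g)" "\<And>c m. P (c *\<^sub>R mon m)"
  shows "P f"
proof -
  have "P (\<Sum>m\<in>A. Poly_Mapping.lookup f m *\<^sub>R mon m)" if "finite A" for A
    using that by induction (auto intro: assms)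
  from this[OF finite_keys] show ?thesis by (subst mon_expand)
qed

lemma psubst_sum: assumes "finite A" "Poly_Mapping.keys f \<subseteq> A"
  shows "psubst g f = (\<Sum>m\<in>A. Poly_Mapping.lookup f m *\<^sub>R mon_value g m)"
  unfolding psubst_def using assms by (intro sum.mono_neutral_left) (auto simp: in_keys_iff)

lemma psubst_add: "psubst g (f + h) = psubst g f + psubst g h"
proof -
  let ?A = "Poly_Mapping.keys f \<union> Poly_Mapping.keys h"
  have "psubst g (f+h) = (\<Sum>m\<in>?A. Poly_Mapping.lookup (f+h) m *\<^sub>R mon_value g m)"
    by (rule psubst_sum) (auto simp: keys_add)
  moreover have "psubst g f = (\<Sum>m\<in>?A. Poly_Mapping.lookup f m *\<^sub>R mon_value g m)" "psubst g h = (\<Sum>m\<in>?A. Poly_Mapping.lookup h m *\<^sub>R mon_value g m)"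
    by (rule psubst_sum; auto)+
  ultimately show ?thesis by (simp add: lookup_add sum.distrib scaleR_add_left)
qed

lemma psubst_0 [simp]: "psubst g 0 = 0" by (simp add: psubst_def)

lemma psubst_scaleR: "psubst g (c *\<^sub>R f) = c *\<^sub>R psubst g f"
  by (auto simp: psubst_def keys_scaleR scaleR_sum_right)

lemma linear_psubst: "linear (psubst g)"
  by (rule linearI) (auto simp: psubst_add psubst_scaleR)

lemma psubst_minus: "psubst g (- f) = - psubst g f"
  using linear_neg[OF linear_psubst] .
lemma psubst_diff: "psubst g (f - h) = psubst g f - psubst g h"
  using linear_diff[OF linear_psubst] .
lemma psubst_sum_distrib: "psubst g (sum f A) = (\<Sum>a\<in>A. psubst g (f a))"
  using linear_sum[OF linear_psubst] .

lemma psubst_mon [simp]: "psubst g (mon m) = mon_value g m"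
  by (simp add: psubst_def lookup_mon)

lemma psubst_mult: "psubst g (f * h) = psubst g f * psubst g h"
proof (induction f rule: mpoly_induct)
  case zero then show ?case by simp
next
  case (add f1 f2) then show ?case by (simp add: psubst_add algebra_simps)
next
  case (mon c m)
  show ?case
  proof (induction h rule: mpoly_induct)
    case zero then show ?case by simp
  next
    case (add f1 f2) then show ?case by (simp add: psubst_add algebra_simps)
  next
    case (mon d n)
    show ?case by (simp add: psubst_scaleR mon_mult)
  qed
qed

lemma psubst_1 [simp]: "psubst g 1 = 1" by (simp flip: mon_0)
lemma psubst_power: "psubst g (f ^ n) = psubst g f ^ n"
  by (induction n) (auto simp: psubst_mult)
lemma psubst_prod: "psubst g (prod f A) = (\<Prod>a\<in>A. psubst g (f a))"
  by (induction A rule: infinite_finite_induct) (auto simp: psubst_mult)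
lemma psubst_X [simp]: "psubst g (X i) = g i" by (simp add: X_def)

lemma eval_at_psubst: "eval_at f x = psubst (\<lambda>i. x $ i) f"
  unfolding eval_at_def psubst_def
  by (intro sum.cong refl) (simp add: mon_value_prod[of UNIV] scaleR_conv_of_real)

lemma X_power: "X i ^ k = mon (Poly_Mapping.single i k)"
  by (induction k) (auto simp: X_def mon_mult mon_0 single_add[symmetric])

lemma mon_eq_mon_value_X: "mon m = mon_value X m"
proof -
  have "mon (\<Sum>i\<in>A. Poly_Mapping.single i (Poly_Mapping.lookup m i)) = (\<Prod>i\<in>A. X i ^ Poly_Mapping.lookup m i)" if "finite A" for A
    using that by induction (auto simp: mon_0 X_power simp flip: mon_mult)
  moreover have "(\<Sum>i\<in>Poly_Mapping.keys m. Poly_Mapping.single i (Poly_Mapping.lookup m i)) = m"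
    by (rule poly_mapping_eqI) (auto simp: lookup_sum lookup_single when_def sum.delta' in_keys_iff)
  ultimately show ?thesis by (metis finite_keys mon_value_def)
qed

lemma psubst_psubst: "psubst g (psubst h f) = psubst (\<lambda>i. psubst g (h i)) f"
proof -
  have "psubst g (mon_value h m) = mon_value (\<lambda>i. psubst g (h i)) m" for m
    by (simp add: mon_value_def psubst_prod psubst_power)
  then show ?thesis
    unfolding psubst_def[of h] psubst_def[of "\<lambda>i. psubst g (h i)"]
    by (simp add: psubst_sum_distrib psubst_scaleR)
qed

text \<open>
  The right induction for properties that are inherited by sums and products, such as being
  differentiable or satisfying Hadamard's lemma.
\<close>

lemma mpoly_mult_induct [case_names const var add mult]:
  assumes "\<And>c. P (c *\<^sub>R 1)" "\<And>i. P (X i)" "\<And>f g. P f \<Longrightarrow> P g \<Longrightarrow> P (f + g)" "\<And>f g. P f \<Longrightarrow> P g \<Longrightarrow> P (f * g)"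
  shows "P f"
proof -
  have pw: "P (X i ^ k)" for i k
    by (induction k) (use assms(1)[of 1] assms(2,4) in auto)
  have "P (\<Prod>i\<in>A. X i ^ Poly_Mapping.lookup m i)" if "finite A" for A m
    using that by induction (use assms(1)[of 1] assms(4) pw in auto)
  then have m: "P (mon m)" for m
    by (simp add: mon_eq_mon_value_X mon_value_def)
  have "P (c *\<^sub>R mon m)" for c m
    using assms(4)[OF assms(1)[of c] m[of m]] by simp
  then show ?thesis
    by (induction f rule: mpoly_induct) (use assms(1)[of 0] assms(3) in auto)
qed

section \<open>Linear systems, monomials and forms\<close>

text \<open>
  Gaussian elimination over an arbitrary field: it serves for counting over both the reals and the
  complex numbers, and for unknowns and equations that come with index sets instead of dimensions.
\<close>

lemma homogeneous_system_nontrivial_solution: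
  fixes M :: "'i \<Rightarrow> 'j \<Rightarrow> 'k::field"
  assumes "finite J" "finite I" "card J < card I"
  shows "\<exists>c. (\<exists>i\<in>I. c i \<noteq> 0) \<and> (\<forall>j\<in>J. (\<Sum>i\<in>I. c i * M i j) = 0)"
  using assms
proof (induction J arbitrary: I M rule: finite_induct)
  case empty
  then have "I \<noteq> {}" by auto
  then show ?case by (intro exI[of _ "\<lambda>_. 1"]) auto
next
  case (insert j J)
  show ?case
  proof (cases "\<forall>i\<in>I. M i j = 0")
    case True
    have "card J < card I" using insert by simp
    from insert.IH[OF insert.prems(1) this, of M] True show ?thesis by auto
  next
    case False
    then obtain i0 where i0: "i0 \<in> I" "M i0 j \<noteq> 0" by auto
    define I' where "I' = I - {i0}"
    have I: "I = insert i0 I'" "i0 \<notin> I'" "finite I'" using i0 insert.prems by (auto simp: I'_def)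
    have "card J < card I'" using insert I by simp
    from insert.IH[OF I(3) this, of "\<lambda>i j'. M i j' - M i j / M i0 j * M i0 j'"]
    obtain c' i1 where c': "i1 \<in> I'" "c' i1 \<noteq> 0"
      and eq: "\<And>j'. j' \<in> J \<Longrightarrow> (\<Sum>i\<in>I'. c' i * (M i j' - M i j / M i0 j * M i0 j')) = 0" by blast
    define s where "s = (\<Sum>i\<in>I'. c' i * M i j) / M i0 j"
    define c where "c = c'(i0 := - s)"
    have sum: "(\<Sum>i\<in>I. c i * M i j') = - s * M i0 j' + (\<Sum>i\<in>I'. c' i * M i j')" for j'
      using I by (auto simp: c_def intro!: sum.cong)
    have "(\<Sum>i\<in>I. c i * M i j') = 0" if "j' \<in> insert j J" for j'
    proof (cases "j' = j")
      case True then show ?thesis using i0 by (simp add: sum s_def)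
    next
      case False
      with that eq have "0 = (\<Sum>i\<in>I'. c' i * (M i j' - M i j / M i0 j * M i0 j'))" by auto
      also have "\<dots> = (\<Sum>i\<in>I'. c' i * M i j') - (\<Sum>i\<in>I'. c' i * M i j) / M i0 j * M i0 j'"
        by (simp add: algebra_simps sum_subtractf sum_distrib_left sum_distrib_right sum_divide_distrib)
      finally show ?thesis by (simp add: sum s_def)
    qed
    moreover have "i1 \<in> I" "c i1 \<noteq> 0" using c' I by (auto simp: c_def)
    ultimately show ?thesis by blast
  qed
qed

definition Mon :: "'v set \<Rightarrow> nat \<Rightarrow> ('v \<Rightarrow>\<^sub>0 nat) set" where
  "Mon V k = {m. Poly_Mapping.keys m \<subseteq> V \<and> mdeg m \<le> k}"

text \<open>
  Splitting off the exponent of one variable reduces the count to a sum of binomial coefficients.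
\<close>

lemma Mon_count:
  assumes "finite V"
  shows "finite (Mon V k) \<and> card (Mon V k) = (k + card V) choose (card V)"
  using assms
proof (induction V arbitrary: k rule: finite_induct)
  case empty
  have "Mon {} k = {0 :: 'a \<Rightarrow>\<^sub>0 nat}" by (auto simp: Mon_def)
  then show ?case by simp
next
  case (insert v V)
  let ?f = "\<lambda>(j, m). Poly_Mapping.single v j + m :: 'a \<Rightarrow>\<^sub>0 nat"
  let ?S = "Sigma {..k} (\<lambda>j. Mon V (k - j))"
  have v0: "Poly_Mapping.lookup m v = 0" if "m \<in> Mon V i" for m i
    using that insert.hyps by (auto simp: Mon_def in_keys_iff)
  have inj: "inj_on ?f ?S"
  proof (rule inj_onI, clarify)
    fix j m j' m'
    assume a: "m \<in> Mon V (k - j)" "m' \<in> Mon V (k - j')"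
      and eq: "Poly_Mapping.single v j + m = Poly_Mapping.single v j' + m'"
    have "j = j'" using arg_cong[OF eq, of "\<lambda>x. Poly_Mapping.lookup x v"] v0[OF a(1)] v0[OF a(2)]
      by (simp add: lookup_add)
    with eq show "j = j' \<and> m = m'" by simp
  qed
  have img: "?f ` ?S = Mon (insert v V) k"
  proof (intro equalityI subsetI)
    fix x assume "x \<in> ?f ` ?S"
    then show "x \<in> Mon (insert v V) k" by (auto simp: Mon_def keys_plus_nat split: if_splits)
  next
    fix m assume m: "m \<in> Mon (insert v V) k"
    define m' where "m' = m - Poly_Mapping.single v (Poly_Mapping.lookup m v)"
    have eq: "m = Poly_Mapping.single v (Poly_Mapping.lookup m v) + m'"
      by (rule poly_mapping_eqI) (auto simp: m'_def lookup_add lookup_minus lookup_single when_def)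
    have k: "Poly_Mapping.keys m' \<subseteq> V"
    proof
      fix x assume "x \<in> Poly_Mapping.keys m'"
      then have l: "Poly_Mapping.lookup m' x \<noteq> 0" by (simp add: in_keys_iff)
      then have "x \<noteq> v" by (auto simp: m'_def lookup_minus)
      moreover have "Poly_Mapping.lookup m x \<noteq> 0"
        using l by (auto simp: m'_def lookup_minus)
      ultimately show "x \<in> V" using m by (auto simp: Mon_def in_keys_iff subset_eq)
    qed
    have "mdeg m = Poly_Mapping.lookup m v + mdeg m'" by (subst eq) simp
    then have "(Poly_Mapping.lookup m v, m') \<in> ?S" using m k by (auto simp: Mon_def)
    then show "m \<in> ?f ` ?S" using eq by (metis (mono_tags, lifting) case_prod_conv image_eqI)
  qed
  have fin: "finite ?S" using insert.IH by auto
  have "card ?S = (\<Sum>j\<le>k. (k - j + card V) choose (card V))"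
    using insert.IH by simp
  also have "\<dots> = (\<Sum>j\<le>k. (card V + j) choose (card V))"
    by (rule sum.reindex_bij_witness[of _ "\<lambda>j. k - j" "\<lambda>j. k - j"]) (auto simp: add.commute)
  also have "\<dots> = (k + card (insert v V)) choose (card (insert v V))"
    using insert.hyps choose_rising_sum(1)[of "card V" k] by (simp add: add.commute)
  finally show ?case using img inj fin by (metis card_image finite_imageI)
qed

lemma finite_Mon [simp]: "finite V \<Longrightarrow> finite (Mon V k)"
  using Mon_count by auto

lemma mon_value_separates:
  assumes "m \<noteq> n"
  shows "\<exists>y :: 'v \<Rightarrow> real. mon_value y m \<noteq> mon_value y n"
proof -
  obtain i where i: "Poly_Mapping.lookup m i \<noteq> Poly_Mapping.lookup n i"
    using assms poly_mapping_eqI[of m n] by metis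
  define y :: "'v \<Rightarrow> real" where "y = (\<lambda>j. if j = i then 2 else 1)"
  have "mon_value y k = 2 ^ Poly_Mapping.lookup k i" for k
  proof -
    have "mon_value y k = (\<Prod>j\<in>insert i (Poly_Mapping.keys k). y j ^ Poly_Mapping.lookup k j)"
      by (rule mon_value_prod) auto
    also have "\<dots> = (\<Prod>j\<in>insert i (Poly_Mapping.keys k). if j = i then 2 ^ Poly_Mapping.lookup k i else 1)"
      by (intro prod.cong) (auto simp: y_def)
    finally show ?thesis by (simp add: prod.delta)
  qed
  then show ?thesis using i by (intro exI[of _ y]) simp
qed

text \<open>
  Dedekind's argument for the independence of characters. A monomial is a multiplicative function of the
  point, so scaling the point by a vector that distinguishes two monomials and subtracting turns a vanishing
  combination of monomials into a shorter one.
\<close>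

lemma nonzero_poly_nonzero_value:
  assumes "f \<noteq> 0"
  shows "\<exists>c :: 'v \<Rightarrow> real. psubst c f \<noteq> 0"
  using assms
proof (induction "card (Poly_Mapping.keys f)" arbitrary: f rule: less_induct)
  case less
  show ?case
  proof (rule ccontr)
    assume "\<not> ?thesis"
    then have z: "psubst c f = 0" for c :: "'v \<Rightarrow> real" by auto
    obtain m where m: "m \<in> Poly_Mapping.keys f" using less.prems by fastforce
    show False
    proof (cases "Poly_Mapping.keys f = {m}")
      case True
      have "Poly_Mapping.lookup f m \<noteq> 0" using m by (simp add: in_keys_iff)
      with True show False using z[of "\<lambda>_. 1"] by (simp add: psubst_def mon_value_def)
    next
      case False
      then obtain n where n: "n \<in> Poly_Mapping.keys f" "n \<noteq> m" using m by auto
      then obtain y :: "'v \<Rightarrow> real" where y: "mon_value y n \<noteq> mon_value y m" using mon_value_separates by blast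
      (* The combination f (y c) - y^m f (c) of values of f, in which the monomial m cancels. *)
      define g where "g = (\<Sum>k\<in>Poly_Mapping.keys f. (Poly_Mapping.lookup f k * (mon_value y k - mon_value y m)) *\<^sub>R mon k)"
      have lg: "Poly_Mapping.lookup g k = Poly_Mapping.lookup f k * (mon_value y k - mon_value y m)" for k
      proof -
        have "Poly_Mapping.lookup g k = (\<Sum>k'\<in>Poly_Mapping.keys f. if k' = k then Poly_Mapping.lookup f k * (mon_value y k - mon_value y m) else 0)"
          unfolding g_def lookup_sum by (intro sum.cong) (auto simp: lookup_mon)
        then show ?thesis by (simp add: sum.delta in_keys_iff)
      qed
      have "Poly_Mapping.keys g \<subset> Poly_Mapping.keys f"
        using m by (auto simp: in_keys_iff lg)
      then have c: "card (Poly_Mapping.keys g) < card (Poly_Mapping.keys f)"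
        by (simp add: psubset_card_mono)
      have "g \<noteq> 0" using lg[of n] n y by (auto simp: in_keys_iff)
      with less.hyps[OF c] obtain c where c: "psubst c g \<noteq> (0::real)" by blast
      have mm: "mon_value (\<lambda>i. c i * y i) k = mon_value c k * mon_value y k" for k
        by (simp add: mon_value_def power_mult_distrib prod.distrib)
      have "psubst c g = (\<Sum>k\<in>Poly_Mapping.keys f. Poly_Mapping.lookup f k *\<^sub>R mon_value (\<lambda>i. c i * y i) k)
          - mon_value y m * (\<Sum>k\<in>Poly_Mapping.keys f. Poly_Mapping.lookup f k *\<^sub>R mon_value c k)"
        unfolding g_def psubst_sum_distrib psubst_scaleR sum_distrib_left sum_subtractf[symmetric]
        by (intro sum.cong refl) (simp add: mm left_diff_distrib right_diff_distrib)
      also have "\<dots> = psubst (\<lambda>i. c i * y i) f - mon_value y m * psubst c f" by (simp add: psubst_def)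
      also have "\<dots> = 0" using z by simp
      finally show False using c by simp
    qed
  qed
qed

lemma forms_iff: "f \<in> forms d \<longleftrightarrow> (\<forall>m\<in>Poly_Mapping.keys f. mdeg m = d)"
  by (auto simp: forms_def monom_degree_mdeg)

lemma forms_0 [simp]: "0 \<in> forms d" by (simp add: forms_iff)
lemma forms_add: "f \<in> forms d \<Longrightarrow> g \<in> forms d \<Longrightarrow> f + g \<in> forms d"
  using keys_add[of f g] by (auto simp: forms_iff)
lemma forms_scaleR: "f \<in> forms d \<Longrightarrow> c *\<^sub>R f \<in> forms d"
  by (auto simp: forms_iff keys_scaleR)
lemma subspace_forms: "subspace (forms d :: 'n::finite real_mpoly set)"
  by (auto simp: subspace_def forms_add forms_scaleR)
lemma forms_diff: "f \<in> forms d \<Longrightarrow> g \<in> forms d \<Longrightarrow> f - g \<in> forms d"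
  by (rule subspace_diff[OF subspace_forms])
lemma forms_sum: "(\<And>a. a \<in> A \<Longrightarrow> f a \<in> forms d) \<Longrightarrow> sum f A \<in> forms d"
  by (rule subspace_sum[OF subspace_forms])
lemma forms_mon: "mon m \<in> forms d \<longleftrightarrow> mdeg m = d" by (simp add: forms_iff)
lemma forms_X [simp]: "X i \<in> forms 1" "X i \<in> forms (Suc 0)" by (simp_all add: X_def forms_mon)
lemma forms_mult: "f \<in> forms d \<Longrightarrow> g \<in> forms e \<Longrightarrow> f * g \<in> forms (d + e)"
  using keys_mult[of f g] by (fastforce simp: forms_iff)
lemma forms_1 [simp]: "1 \<in> forms 0" by (simp add: forms_iff)
lemma forms_power: "f \<in> forms d \<Longrightarrow> f ^ k \<in> forms (d * k)"
  by (induction k) (auto simp: forms_mult)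

lemma psubst_homogeneous:
  assumes "f \<in> forms d"
  shows "psubst (\<lambda>i. c * g i) f = c ^ d * psubst g f"
proof -
  have "mon_value (\<lambda>i. c * g i) m = c ^ mdeg m * mon_value g m" for m
    by (simp add: mon_value_def mdeg_def power_mult_distrib prod.distrib power_sum)
  then show ?thesis using assms
    by (auto simp: psubst_def forms_iff sum_distrib_left intro!: sum.cong)
qed

definition hom_component :: "nat \<Rightarrow> (('v \<Rightarrow>\<^sub>0 nat) \<Rightarrow>\<^sub>0 real) \<Rightarrow> ('v \<Rightarrow>\<^sub>0 nat) \<Rightarrow>\<^sub>0 real" where
  "hom_component d f = (\<Sum>m\<in>{m\<in>Poly_Mapping.keys f. mdeg m = d}. Poly_Mapping.lookup f m *\<^sub>R mon m)"

lemma lookup_hom_component: "Poly_Mapping.lookup (hom_component d f) m = (if mdeg m = d then Poly_Mapping.lookup f m else 0)"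
proof -
  have "Poly_Mapping.lookup (hom_component d f) m = (\<Sum>k\<in>{m\<in>Poly_Mapping.keys f. mdeg m = d}. if k = m then Poly_Mapping.lookup f m else 0)"
    unfolding hom_component_def lookup_sum by (intro sum.cong) (auto simp: lookup_mon)
  then show ?thesis by (auto simp: sum.delta in_keys_iff)
qed

lemma hom_component_add: "hom_component d (f + g) = hom_component d f + hom_component d g"
  by (rule poly_mapping_eqI) (simp add: lookup_hom_component lookup_add)
lemma hom_component_scaleR: "hom_component d (c *\<^sub>R f) = c *\<^sub>R hom_component d f"
  by (rule poly_mapping_eqI) (simp add: lookup_hom_component)
lemma hom_component_0 [simp]: "hom_component d 0 = 0"
  by (rule poly_mapping_eqI) (simp add: lookup_hom_component)
lemma linear_hom_component: "linear (hom_component d)"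
  by (rule linearI) (auto simp: hom_component_add hom_component_scaleR)
lemma hom_component_sum: "hom_component d (sum f A) = (\<Sum>a\<in>A. hom_component d (f a))"
  using linear_sum[OF linear_hom_component] .
lemma hom_component_mon: "hom_component d (mon m) = (if mdeg m = d then mon m else 0)"
  by (rule poly_mapping_eqI) (auto simp: lookup_hom_component lookup_mon)
lemma hom_component_in_forms: "hom_component d f \<in> forms d"
  by (auto simp: forms_iff in_keys_iff lookup_hom_component split: if_splits)
lemma hom_component_forms: "f \<in> forms e \<Longrightarrow> hom_component d f = (if d = e then f else 0)"
  by (rule poly_mapping_eqI) (auto simp: lookup_hom_component forms_iff in_keys_iff)

lemma hom_component_mult:
  assumes "q \<in> forms e"
  shows "hom_component (d + e) (q * h) = q * hom_component d h"
proof (induction h rule: mpoly_induct)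
  case zero then show ?case by simp
next
  case (add f g) then show ?case by (simp add: hom_component_add algebra_simps)
next
  case (mon c m)
  have "q * mon m \<in> forms (e + mdeg m)" using assms by (intro forms_mult) (auto simp: forms_mon)
  then have "hom_component (d + e) (q * mon m) = q * hom_component d (mon m)"
    by (auto simp: hom_component_forms hom_component_mon)
  then show ?case by (simp add: hom_component_scaleR)
qed

lemma hom_component_mult_0:
  assumes "q \<in> forms e" "d < e"
  shows "hom_component d (q * h) = 0"
proof (induction h rule: mpoly_induct)
  case zero then show ?case by simp
next
  case (add f g) then show ?case by (simp add: hom_component_add algebra_simps)
next
  case (mon c m)
  have "q * mon m \<in> forms (e + mdeg m)" using assms by (intro forms_mult) (auto simp: forms_mon)
  then show ?case using assms by (simp add: hom_component_scaleR hom_component_forms)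
qed

lemma mdeg_SucD:
  assumes "mdeg m = Suc d"
  shows "\<exists>i n. m = Poly_Mapping.single i 1 + n \<and> mdeg n = d"
proof -
  have "m \<noteq> 0" using assms by auto
  then obtain i where "i \<in> Poly_Mapping.keys m" by fastforce
  then have i: "Poly_Mapping.lookup m i \<noteq> 0" by (simp add: in_keys_iff)
  define n where "n = m - Poly_Mapping.single i 1"
  have eq: "m = Poly_Mapping.single i 1 + n"
    by (rule poly_mapping_eqI) (use i in \<open>auto simp: n_def lookup_add lookup_minus lookup_single when_def\<close>)
  moreover have "mdeg m = 1 + mdeg n" by (subst eq) simp
  ultimately show ?thesis using assms by auto
qed

lemma forms_Suc_expand:
  fixes f :: "'n::finite real_mpoly"
  assumes "f \<in> forms (Suc d)"
  shows "\<exists>g. (\<forall>i. g i \<in> forms d) \<and> f = (\<Sum>i\<in>UNIV. X i * g i)"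
proof -
  have "\<forall>m\<in>Poly_Mapping.keys f. \<exists>i n. m = Poly_Mapping.single i 1 + n \<and> mdeg n = d"
    using assms mdeg_SucD unfolding forms_iff by blast
  then obtain i n where n: "\<And>m. m \<in> Poly_Mapping.keys f \<Longrightarrow> m = Poly_Mapping.single (i m) 1 + n m \<and> mdeg (n m) = d"
    by metis
  define t where "t m = Poly_Mapping.lookup f m *\<^sub>R mon (n m)" for m
  define g where "g k = (\<Sum>m\<in>Poly_Mapping.keys f. if k = i m then t m else 0)" for k
  have "g k \<in> forms d" for k
    unfolding g_def using n by (intro forms_sum) (simp add: t_def forms_scaleR forms_mon)
  moreover have "f = (\<Sum>k\<in>UNIV. X k * g k)"
  proof -
    have "(\<Sum>k\<in>UNIV. X k * g k) = (\<Sum>k\<in>UNIV. \<Sum>m\<in>Poly_Mapping.keys f. if k = i m then X k * t m else 0)"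
      unfolding g_def sum_distrib_left by (intro sum.cong refl) auto
    also have "\<dots> = (\<Sum>m\<in>Poly_Mapping.keys f. \<Sum>k\<in>UNIV. if k = i m then X k * t m else 0)"
      by (rule sum.swap)
    also have "\<dots> = (\<Sum>m\<in>Poly_Mapping.keys f. X (i m) * t m)" by simp
    also have "\<dots> = (\<Sum>m\<in>Poly_Mapping.keys f. Poly_Mapping.lookup f m *\<^sub>R mon m)"
    proof (rule sum.cong[OF refl])
      fix m assume "m \<in> Poly_Mapping.keys f"
      from n[OF this] have "mon m = X (i m) * mon (n m)" by (metis X_def mon_mult)
      then show "X (i m) * t m = Poly_Mapping.lookup f m *\<^sub>R mon m" by (simp add: t_def)
    qed
    also have "\<dots> = f" by (rule mon_expand[symmetric])
    finally show ?thesis by simp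
  qed
  ultimately show ?thesis by blast
qed

definition quad_form :: "real ^ 'n ^ 'n \<Rightarrow> 'n::finite real_mpoly" where
  "quad_form c = (\<Sum>i\<in>UNIV. \<Sum>j\<in>UNIV. (c $ i $ j) *\<^sub>R (X i * X j))"

lemma quad_form_forms: "quad_form c \<in> forms 2"
proof -
  have "X i * X j \<in> forms 2" for i j :: 'a
    using forms_mult[OF forms_X(1) forms_X(1), of i j] by (simp only: one_add_one)
  then show ?thesis unfolding quad_form_def by (intro forms_sum forms_scaleR)
qed

lemma forms_0_scalar: "f \<in> forms 0 \<Longrightarrow> f = Poly_Mapping.lookup f 0 *\<^sub>R 1"
proof (rule poly_mapping_eqI)
  fix k assume "f \<in> forms 0"
  then show "Poly_Mapping.lookup f k = Poly_Mapping.lookup (Poly_Mapping.lookup f 0 *\<^sub>R 1) k"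
    by (auto simp: forms_iff mdeg_eq_0_iff lookup_one in_keys_iff when_def)
qed

lemma forms_1_expand:
  fixes f :: "'n::finite real_mpoly"
  assumes "f \<in> forms 1"
  shows "\<exists>c. f = (\<Sum>i\<in>UNIV. c i *\<^sub>R X i)"
proof -
  obtain g where g: "\<And>i. g i \<in> forms 0" "f = (\<Sum>i\<in>UNIV. X i * g i)"
    using forms_Suc_expand[of f 0] assms by auto
  have "X i * g i = Poly_Mapping.lookup (g i) 0 *\<^sub>R X i" for i
    by (subst forms_0_scalar[OF g(1)]) simp
  then show ?thesis using g(2) by auto
qed

lemma forms_2_quad_form:
  fixes f :: "'n::finite real_mpoly"
  assumes "f \<in> forms 2"
  shows "\<exists>c. f = quad_form c"
proof -
  obtain g where g: "\<And>i. g i \<in> forms 1" "f = (\<Sum>i\<in>UNIV. X i * g i)"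
    using forms_Suc_expand[of f 1] assms by (auto simp: numeral_2_eq_2)
  have "\<forall>i. \<exists>c. g i = (\<Sum>j\<in>UNIV. c j *\<^sub>R X j)" using forms_1_expand g(1) by auto
  then obtain c where c: "\<And>i. g i = (\<Sum>j\<in>UNIV. c i j *\<^sub>R X j)" by metis
  have "f = quad_form (\<chi> i j. c i j)" by (simp add: g(2) c quad_form_def sum_distrib_left)
  then show ?thesis by blast
qed

lemma linear_quad_form: "linear quad_form"
  unfolding quad_form_def by (rule linearI) (simp_all add: scaleR_add_left sum.distrib scaleR_sum_right)

lemma quad_form_transpose: "quad_form (transpose c) = quad_form c"
  unfolding quad_form_def transpose_def by (subst sum.swap) (simp add: mult.commute)

lemma quad_form_symmetrize: "quad_form c = quad_form ((1/2) *\<^sub>R (c + transpose c))"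
  by (simp add: linear_scale[OF linear_quad_form] linear_add[OF linear_quad_form] quad_form_transpose scaleR_2[symmetric])

section \<open>An extremal separating functional\<close>

text \<open>
  The coefficients of a quartic as a vector of a Euclidean space, where compactness and separating
  hyperplanes are available. A monomial \<open>x\<^sub>i x\<^sub>j x\<^sub>k x\<^sub>l\<close> occurs once for every order of its
  factors; the map is faithful by its injectivity on quartics.
\<close>

definition coeff_tensor :: "'n::finite real_mpoly \<Rightarrow> real ^ ('n \<times> 'n \<times> 'n \<times> 'n)" where
  "coeff_tensor f = (\<chi> t. case t of (i, j, k, l) \<Rightarrow> Poly_Mapping.lookup f
     (Poly_Mapping.single i 1 + (Poly_Mapping.single j 1 + (Poly_Mapping.single k 1 + Poly_Mapping.single l 1))))"

lemma linear_coeff_tensor: "linear coeff_tensor"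
  by (rule linearI) (auto simp: coeff_tensor_def vec_eq_iff lookup_add)

lemma coeff_tensor_eq_0:
  assumes "f \<in> forms 4" "coeff_tensor f = 0"
  shows "f = 0"
proof (rule poly_mapping_eqI)
  fix m
  show "Poly_Mapping.lookup f m = Poly_Mapping.lookup 0 m"
  proof (cases "mdeg m = 4")
    case False
    then show ?thesis using assms(1) by (auto simp: forms_iff in_keys_iff)
  next
    case True
    then obtain i n1 where 1: "m = Poly_Mapping.single i 1 + n1" "mdeg n1 = 3" using mdeg_SucD[of m 3] by auto
    then obtain j n2 where 2: "n1 = Poly_Mapping.single j 1 + n2" "mdeg n2 = 2" using mdeg_SucD[of n1 2] by auto
    then obtain k n3 where 3: "n2 = Poly_Mapping.single k 1 + n3" "mdeg n3 = 1" using mdeg_SucD[of n2 1] by (auto simp: numeral_2_eq_2)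
    then obtain l n4 where 4: "n3 = Poly_Mapping.single l 1 + n4" "mdeg n4 = 0" using mdeg_SucD[of n3 0] by auto
    have "m = Poly_Mapping.single i 1 + (Poly_Mapping.single j 1 + (Poly_Mapping.single k 1 + Poly_Mapping.single l 1))"
      using 1 2 3 4 by (simp add: mdeg_eq_0_iff)
    then have "Poly_Mapping.lookup f m = coeff_tensor f $ (i, j, k, l)" by (simp add: coeff_tensor_def)
    then show ?thesis using assms(2) by simp
  qed
qed

lemma psubst_quad_form: "psubst (\<lambda>i. x $ i) (quad_form c) = (\<Sum>i\<in>UNIV. \<Sum>j\<in>UNIV. c $ i $ j *\<^sub>R (x $ i * x $ j))"
  by (simp add: quad_form_def psubst_sum_distrib psubst_scaleR psubst_mult)

lemma psubst_quad_form_real: "psubst (\<lambda>i. x $ i) (quad_form c) = inner x (c *v x)"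
  by (simp add: psubst_quad_form inner_vec_def matrix_vector_mult_def sum_distrib_left mult_ac)

lemma symmetric_quad_form_eq_0:
  assumes "quad_form c = 0" "transpose c = c"
  shows "c = 0"
proof -
  have z: "inner x (c *v x) = 0" for x by (simp flip: psubst_quad_form_real add: assms)
  have "inner x (c *v y) = 0" for x y
  proof -
    have "inner x (c *v y) = inner y (c *v x)"
      by (metis assms(2) dot_lmul_matrix inner_commute vector_transpose_matrix transpose_matrix_vector)
    then show ?thesis using z[of "x + y"] z[of x] z[of y]
      by (simp add: matrix_vector_mult_add_rdistrib matrix_vector_right_distrib inner_add_left inner_add_right)
  qed
  then have "c *v y = 0" for y by (metis inner_eq_zero_iff)
  then show ?thesis by (simp add: matrix_eq)
qed

lemma forms_2_symmetric_quad_form: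
  fixes f :: "'n::finite real_mpoly"
  assumes "f \<in> forms 2"
  shows "\<exists>c. f = quad_form c \<and> transpose c = c"
proof -
  obtain c where c: "f = quad_form c" using forms_2_quad_form[OF assms] by blast
  have "transpose ((1/2) *\<^sub>R (c + transpose c)) = (1/2) *\<^sub>R (c + transpose c)"
    by (simp add: transpose_def vec_eq_iff add.commute)
  with c quad_form_symmetrize[of c] show ?thesis by metis
qed

lemma psubst_ext:
  fixes f g :: "'n::finite real_mpoly"
  assumes "\<And>x :: real ^ 'n. psubst (\<lambda>i. x $ i) f = psubst (\<lambda>i. x $ i) g"
  shows "f = g"
proof (rule ccontr)
  assume "f \<noteq> g"
  then obtain c :: "'n \<Rightarrow> real" where "psubst c (f - g) \<noteq> 0" using nonzero_poly_nonzero_value[of "f - g"] by auto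
  moreover have "psubst c (f - g) = 0" using assms[of "\<chi> i. c i"] by (simp add: psubst_diff)
  ultimately show False by simp
qed

text \<open>
  The squares of the quadrics with normalised matrix form a compact set, and its convex hull does not
  contain \<open>0\<close> because a sum of squares vanishes only if every summand does. Hence the cone over this hull,
  which is the cone of sums of squares, is closed, and a point outside is cut off by a hyperplane.
\<close>

lemma separating_functional:
  fixes p :: "'n::finite real_mpoly"
  assumes p: "p \<in> forms 4" "p \<notin> sos_forms 2"
  shows "\<exists>l. linear l \<and> (\<forall>q\<in>forms 2. l (q * q) \<ge> 0) \<and> l p < (0::real)"
proof -
  define C where "C = {c :: real^'n^'n. norm c = 1 \<and> transpose c = c}"
  define g where "g c = coeff_tensor (quad_form c * quad_form c)" for c :: "real^'n^'n"
  have Qf: "quad_form c * quad_form c \<in> forms 4" for c :: "real^'n^'n"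
    using forms_mult[OF quad_form_forms quad_form_forms, of c c] by simp
  have tr: "linear (transpose :: real^'n^'n \<Rightarrow> _)"
    by (rule linearI) (auto simp: transpose_def vec_eq_iff)
  have lin2: "bilinear (\<lambda>c d. coeff_tensor (quad_form c * quad_form d))"
    unfolding bilinear_def
    by (auto intro!: linearI simp: linear_add[OF linear_quad_form] linear_scale[OF linear_quad_form] algebra_simps
        linear_add[OF linear_coeff_tensor] linear_scale[OF linear_coeff_tensor])
  then have bb: "bounded_bilinear (\<lambda>c d. coeff_tensor (quad_form c * quad_form d))"
    by (simp add: bilinear_conv_bounded_bilinear)
  have cg: "continuous_on UNIV g"
    unfolding g_def by (intro bounded_bilinear.continuous_on[OF bb] continuous_intros)
  have "closed {c :: real^'n^'n. transpose c = c}"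
    by (intro closed_Collect_eq linear_continuous_on continuous_intros)
       (use tr in \<open>simp add: linear_conv_bounded_linear\<close>)
  moreover have "C = sphere 0 1 \<inter> {c. transpose c = c}" by (auto simp: C_def)
  ultimately have "compact C" by (simp add: compact_Int_closed)
  then have "compact (g ` C)" using cg by (meson compact_continuous_image continuous_on_subset subset_UNIV)
  define S where "S = convex hull (g ` C)"
  have S: "compact S" "convex S" unfolding S_def using \<open>compact (g ` C)\<close> by (auto simp: compact_convex_hull)
  have repr: "\<exists>I u (c :: _ \<Rightarrow> real^'n^'n). finite (I :: (real ^ ('n \<times> 'n \<times> 'n \<times> 'n)) set) \<and> (\<forall>v\<in>I. u v \<ge> 0 \<and> c v \<in> C) \<and> sum u I = 1 \<and>
      x = coeff_tensor (\<Sum>v\<in>I. u v *\<^sub>R (quad_form (c v) * quad_form (c v)))" if "x \<in> S" for x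
  proof -
    from that obtain I u where I: "finite I" "I \<subseteq> g ` C" "\<And>v. v \<in> I \<Longrightarrow> u v \<ge> 0" "sum u I = 1" "x = (\<Sum>v\<in>I. u v *\<^sub>R v)"
      unfolding S_def convex_hull_explicit by auto
    then have "\<forall>v\<in>I. \<exists>c. c \<in> C \<and> v = g c" by auto
    then obtain c where c: "\<And>v. v \<in> I \<Longrightarrow> c v \<in> C \<and> v = g (c v)" by metis
    have "x = (\<Sum>v\<in>I. u v *\<^sub>R g (c v))" using I(5) c by (auto intro!: sum.cong)
    also have "\<dots> = coeff_tensor (\<Sum>v\<in>I. u v *\<^sub>R (quad_form (c v) * quad_form (c v)))"
      by (simp add: g_def linear_sum[OF linear_coeff_tensor] linear_scale[OF linear_coeff_tensor])
    finally show ?thesis using I c by blast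
  qed
  have sosf: "(\<Sum>v\<in>I. u v *\<^sub>R (quad_form (c v) * quad_form (c v))) \<in> forms 4" for I :: "'b set" and u and c :: "'b \<Rightarrow> real^'n^'n"
    by (intro forms_sum forms_scaleR Qf)
  have "0 \<notin> S"
  proof
    assume "0 \<in> S"
    from repr[OF this] obtain I u c where I: "finite (I :: (real ^ ('n \<times> 'n \<times> 'n \<times> 'n)) set)" "\<forall>v\<in>I. u v \<ge> 0 \<and> c v \<in> C"
      "sum u I = 1" "0 = coeff_tensor (\<Sum>v\<in>I. u v *\<^sub>R (quad_form (c v) * quad_form (c v)))" by blast
    have z: "(\<Sum>v\<in>I. u v *\<^sub>R (quad_form (c v) * quad_form (c v))) = 0" using coeff_tensor_eq_0[OF sosf I(4)[symmetric]] .
    obtain v where v: "v \<in> I" "u v \<noteq> 0" using I(3) by (metis sum.neutral zero_neq_one)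
    have "psubst (\<lambda>i. x $ i) (quad_form (c v)) = 0" for x :: "real^'n"
    proof -
      have "(\<Sum>v\<in>I. u v * (psubst (\<lambda>i. x $ i) (quad_form (c v)))\<^sup>2) = psubst (\<lambda>i. x $ i) (\<Sum>v\<in>I. u v *\<^sub>R (quad_form (c v) * quad_form (c v)))"
        by (simp add: psubst_sum_distrib psubst_scaleR psubst_mult power2_eq_square)
      also have "\<dots> = 0" by (simp add: z)
      finally have "\<forall>v\<in>I. u v * (psubst (\<lambda>i. x $ i) (quad_form (c v)))\<^sup>2 = 0"
        using I(1,2) by (subst (asm) sum_nonneg_eq_0_iff) auto
      then show ?thesis using v by auto
    qed
    then have "quad_form (c v) = 0" by (intro psubst_ext) simp
    then have "c v = 0" using bspec[OF I(2) v(1)] symmetric_quad_form_eq_0 by (auto simp: C_def)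
    then show False using bspec[OF I(2) v(1)] by (auto simp: C_def)
  qed
  have nt: "coeff_tensor p \<notin> conic hull S"
  proof
    assume "coeff_tensor p \<in> conic hull S"
    then obtain k x where k: "k \<ge> 0" "x \<in> S" "coeff_tensor p = k *\<^sub>R x" by (auto simp: conic_hull_explicit)
    from repr[OF k(2)] obtain I u c where I: "finite (I :: (real ^ ('n \<times> 'n \<times> 'n \<times> 'n)) set)" "\<forall>v\<in>I. u v \<ge> 0 \<and> c v \<in> C"
      "x = coeff_tensor (\<Sum>v\<in>I. u v *\<^sub>R (quad_form (c v) * quad_form (c v)))" by blast
    define r where "r v = sqrt (k * u v) *\<^sub>R quad_form (c v)" for v
    have "coeff_tensor (p - (\<Sum>v\<in>I. (r v)\<^sup>2)) = 0"
    proof -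
      have "(\<Sum>v\<in>I. (r v)\<^sup>2) = k *\<^sub>R (\<Sum>v\<in>I. u v *\<^sub>R (quad_form (c v) * quad_form (c v)))"
        unfolding scaleR_sum_right
      proof (rule sum.cong[OF refl])
        fix v assume "v \<in> I"
        then have "k * u v \<ge> 0" using I k by simp
        then have "sqrt (k * u v) * sqrt (k * u v) = k * u v" by simp
        then show "(r v)\<^sup>2 = k *\<^sub>R u v *\<^sub>R (quad_form (c v) * quad_form (c v))"
          by (simp add: r_def power2_eq_square)
      qed
      then show ?thesis using k I by (simp add: linear_diff[OF linear_coeff_tensor] linear_scale[OF linear_coeff_tensor])
    qed
    moreover have rf: "r v \<in> forms 2" for v by (simp add: r_def forms_scaleR quad_form_forms)
    then have "(\<Sum>v\<in>I. (r v)\<^sup>2) \<in> forms 4" using forms_power[of _ 2 2] by (intro forms_sum) auto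
    ultimately have pe: "p = (\<Sum>v\<in>I. (r v)\<^sup>2)" using coeff_tensor_eq_0[of "p - (\<Sum>v\<in>I. (r v)\<^sup>2)"] p(1) by (auto simp: forms_diff)
    obtain h where h: "bij_betw h {..<card I} I" using ex_bij_betw_nat_finite[OF I(1)] by (auto simp: atLeast0LessThan)
    have "p = (\<Sum>i<card I. (r (h i))\<^sup>2)" using sum.reindex_bij_betw[OF h, of "\<lambda>v. (r v)\<^sup>2"] pe by simp
    then have "p \<in> sos_forms 2" using p(1) rf unfolding sos_forms_def by (auto intro!: exI[of _ "card I"] exI[of _ "\<lambda>i. r (h i)"])
    with p(2) show False by simp
  qed
  have "closed (conic hull S)" using \<open>0 \<notin> S\<close> S by (intro closed_conic_hull) auto
  moreover have "convex (conic hull S)" using S by (simp add: convex_conic_hull)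
  ultimately obtain a b where ab: "inner a (coeff_tensor p) < b" "\<And>x. x \<in> conic hull S \<Longrightarrow> b < inner a x"
    using separating_hyperplane_closed_point[OF _ _ nt] by blast
  have pos: "inner a (g c) \<ge> 0" if "c \<in> C" for c
  proof (rule ccontr)
    assume n: "\<not> ?thesis"
    have gS: "g c \<in> S" unfolding S_def using that by (simp add: hull_inc)
    (* Far enough on the ray through g c the linear form would fall below the bound b. *)
    define k where "k = \<bar>b\<bar> / - inner a (g c)"
    have "k \<ge> 0" unfolding k_def by (intro divide_nonneg_pos) (use n in auto)
    then have "k *\<^sub>R g c \<in> conic hull S" using gS by (auto simp: conic_hull_explicit)
    then have "b < k * inner a (g c)" using ab(2) by fastforce
    moreover have "k * inner a (g c) = - \<bar>b\<bar>" using n by (simp add: k_def)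
    ultimately show False by simp
  qed
  have C0: "\<exists>c. c \<in> C"
  proof -
    let ?c = "mat 1 :: real^'n^'n"
    have "?c \<noteq> 0" by (metis matrix_vector_mul_lid matrix_vector_mult_0 zero_neq_one axis_eq_0_iff)
    then have "(1 / norm ?c) *\<^sub>R ?c \<in> C" by (simp add: C_def linear_scale[OF tr] transpose_mat)
    then show ?thesis by blast
  qed
  have "b < 0"
  proof -
    from C0 obtain c where "c \<in> C" by blast
    then have "g c \<in> S" unfolding S_def by (simp add: hull_inc)
    then have "0 *\<^sub>R g c \<in> conic hull S" unfolding conic_hull_explicit by blast
    then show ?thesis using ab(2)[of 0] by simp
  qed
  define l where "l f = inner a (coeff_tensor f)" for f
  have "linear l" unfolding l_def
    by (rule linearI) (simp_all add: linear_add[OF linear_coeff_tensor] linear_scale[OF linear_coeff_tensor] inner_add_right)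
  moreover have "l (q * q) \<ge> 0" if q: "q \<in> forms 2" for q
  proof -
    obtain c where c: "q = quad_form c" "transpose c = c" using forms_2_symmetric_quad_form[OF q] by blast
    show ?thesis
    proof (cases "c = 0")
      case True then show ?thesis using c \<open>linear l\<close> by (simp add: linear_0[OF linear_quad_form] linear_0)
    next
      case False
      let ?d = "(1 / norm c) *\<^sub>R c"
      have "?d \<in> C" using False c by (simp add: C_def linear_scale[OF tr])
      moreover have "q = norm c *\<^sub>R quad_form ?d" using False c by (simp add: linear_scale[OF linear_quad_form])
      then have "l (q * q) = (norm c)\<^sup>2 * inner a (g ?d)"
        by (simp add: l_def g_def linear_scale[OF linear_coeff_tensor] power2_eq_square)
      ultimately show ?thesis using pos by simp
    qed
  qed
  moreover have "l p < 0" using ab \<open>b < 0\<close> by (simp add: l_def)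
  ultimately show ?thesis by blast
qed

text \<open>
  Otherwise the form would take a negative value at some \<open>t c + d\<close>, where it is affine in \<open>t\<close>.
\<close>

lemma psd_form_null_vector:
  fixes B :: "'e::real_vector \<Rightarrow> 'e \<Rightarrow> real"
  assumes B: "bilinear B" "\<And>c d. B c d = B d c" "\<And>c. B c c \<ge> 0" and c: "B c c = 0"
  shows "B c d = 0"
proof (rule ccontr)
  assume n: "B c d \<noteq> 0"
  define t where "t = - (B d d + 1) / (2 * B c d)"
  have "B (t *\<^sub>R c + d) (t *\<^sub>R c + d) = 2 * t * B c d + B d d"
    using B(1) B(2)[of d c] c by (simp add: bilinear_ladd bilinear_radd bilinear_lmul bilinear_rmul)
  moreover have "2 * t * B c d = - (B d d + 1)" using n by (simp add: t_def field_simps)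
  ultimately have "B (t *\<^sub>R c + d) (t *\<^sub>R c + d) = -1" by simp
  then show False using B(3)[of "t *\<^sub>R c + d"] by simp
qed

text \<open>
  Modulo the radical of \<open>B\<close> the form \<open>B\<close> is positive definite, and there \<open>B + t G\<close> becomes degenerate for the
  first time at \<open>t = - 1 / \<rho>\<close>, where \<open>\<rho> < 0\<close> is the minimum of \<open>G / B\<close> on the unit sphere of a complement.
\<close>

lemma psd_perturbation:
  fixes B G :: "'e::euclidean_space \<Rightarrow> 'e \<Rightarrow> real"
  assumes B: "bilinear B" "\<And>c d. B c d = B d c" "\<And>c. B c c \<ge> 0"
    and G: "bilinear G" "\<And>c d. G c d = G d c" "\<And>c d. (\<forall>d. B c d = 0) \<Longrightarrow> G c d = 0"
    and neg: "G c0 c0 < 0"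
  shows "\<exists>t>0. (\<forall>c. B c c + t * G c c \<ge> 0) \<and> (\<exists>c. B c c > 0 \<and> B c c + t * G c c = 0)"
proof -
  define V where "V = {c. \<forall>d. B c d = 0}"
  have V: "subspace V"
    unfolding V_def subspace_def
    using B(1) by (auto simp: bilinear_lzero bilinear_ladd bilinear_lmul)
  have decomp: "\<exists>v w. v \<in> V \<and> (\<forall>u\<in>V. orthogonal w u) \<and> c = v + w" for c
  proof -
    obtain y z where "y \<in> span V" "\<And>w. w \<in> span V \<Longrightarrow> orthogonal z w" "c = y + z"
      using orthogonal_subspace_decomp_exists[of V c] by metis
    then show ?thesis using V by (metis span_eq_iff)
  qed
  have dropB: "B (v + w) (v + w) = B w w" if "v \<in> V" for v w
  proof -
    have 1: "B v d = 0" for d using that by (simp add: V_def)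
    then have "B d v = 0" for d using B(2)[of d v] by simp
    with 1 show ?thesis using B(1) by (simp add: bilinear_ladd bilinear_radd)
  qed
  have dropG: "G (v + w) (v + w) = G w w" if "v \<in> V" for v w
    using that G(3)[of v] G(1) G(2)[of w v] by (simp add: V_def bilinear_ladd bilinear_radd)
  have CS: "c \<in> V" if "B c c = 0" for c
    using psd_form_null_vector[OF B that] by (simp add: V_def)
  define K where "K = sphere (0::'e) 1 \<inter> {w. \<forall>u\<in>V. orthogonal w u}"
  have "closed {w. \<forall>u\<in>V. orthogonal w u}"
  proof -
    have "{w. \<forall>u\<in>V. orthogonal w u} = (\<Inter>u\<in>V. {w. inner w u = 0})" by (auto simp: orthogonal_def)
    then show ?thesis by (auto intro!: closed_INT closed_Collect_eq continuous_intros)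
  qed
  then have K: "compact K" unfolding K_def by (intro compact_Int_closed) auto
  have posK: "B w w > 0" if "w \<in> K" for w
  proof -
    have "w \<notin> V"
    proof
      assume "w \<in> V"
      then have "orthogonal w w" using that by (auto simp: K_def)
      then show False using that by (auto simp: K_def orthogonal_self)
    qed
    then show ?thesis using CS[of w] B(3)[of w] by fastforce
  qed
  have scale: "\<exists>w\<in>K. \<exists>r>0. B c c = r * B w w \<and> G c c = r * G w w" if "B c c \<noteq> 0 \<or> G c c \<noteq> 0" for c
  proof -
    obtain v w where vw: "v \<in> V" "\<forall>u\<in>V. orthogonal w u" "c = v + w" using decomp by blast
    have eq: "B c c = B w w" "G c c = G w w" using vw dropB dropG by auto
    have w0: "w \<noteq> 0" using that eq B(1) G(1) by (auto simp: bilinear_lzero)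
    let ?w = "(1 / norm w) *\<^sub>R w"
    have "?w \<in> K" using w0 vw by (auto simp: K_def orthogonal_def)
    moreover have "B w w = (norm w)\<^sup>2 * B ?w ?w" "G w w = (norm w)\<^sup>2 * G ?w ?w"
      using w0 B(1) G(1) by (simp_all add: bilinear_lmul bilinear_rmul power2_eq_square)
    ultimately show ?thesis using eq w0 by (intro bexI[of _ ?w] exI[of _ "(norm w)\<^sup>2"]) auto
  qed
  obtain w0 where w0: "w0 \<in> K" "G w0 w0 < 0"
  proof -
    have "B c0 c0 \<noteq> 0 \<or> G c0 c0 \<noteq> 0" using neg by simp
    from scale[OF this] obtain w r where "w \<in> K" "r > 0" "G c0 c0 = r * G w w" by blast
    then have "G w w < 0" using neg by (simp add: mult_less_0_iff)
    with \<open>w \<in> K\<close> show ?thesis by (rule that)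
  qed
  have cont: "continuous_on K (\<lambda>w. G w w / B w w)"
  proof (intro continuous_on_divide)
    have bb: "bounded_bilinear B" "bounded_bilinear G" using B(1) G(1) by (simp_all add: bilinear_conv_bounded_bilinear)
    show "continuous_on K (\<lambda>w. G w w)"
      by (rule bounded_bilinear.continuous_on[OF bb(2)]; rule continuous_on_id)
    show "continuous_on K (\<lambda>w. B w w)"
      by (rule bounded_bilinear.continuous_on[OF bb(1)]; rule continuous_on_id)
    show "\<forall>w\<in>K. B w w \<noteq> 0" using posK by fastforce
  qed
  obtain w1 where w1: "w1 \<in> K" "\<And>w. w \<in> K \<Longrightarrow> G w1 w1 / B w1 w1 \<le> G w w / B w w"
    using continuous_attains_inf[OF K _ cont] w0 by auto
  define \<rho> where "\<rho> = G w1 w1 / B w1 w1"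
  have \<rho>: "\<rho> < 0" using w1(2)[OF w0(1)] divide_neg_pos[OF w0(2) posK[OF w0(1)]]
    by (simp add: \<rho>_def)
  define t where "t = - 1 / \<rho>"
  have t: "t > 0" using \<rho> by (simp add: t_def)
  have Kpos: "B w w + t * G w w \<ge> 0" if "w \<in> K" for w
  proof -
    have "\<rho> * B w w \<le> G w w" using w1(2)[OF that] posK[OF that] by (simp add: \<rho>_def pos_le_divide_eq)
    then have "t * (\<rho> * B w w) \<le> t * G w w" using t by (simp add: mult_left_mono)
    then show ?thesis using \<rho> by (simp add: t_def)
  qed
  have "B c c + t * G c c \<ge> 0" for c
  proof (cases "B c c \<noteq> 0 \<or> G c c \<noteq> 0")
    case True
    from scale[OF this] obtain w r where w: "w \<in> K" "r > 0" "B c c = r * B w w" "G c c = r * G w w" by blast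
    then have "B c c + t * G c c = r * (B w w + t * G w w)" by (simp add: algebra_simps)
    then show ?thesis using w Kpos[OF w(1)] by simp
  qed auto
  moreover have "B w1 w1 + t * G w1 w1 = 0"
  proof -
    have "G w1 w1 = \<rho> * B w1 w1" using posK[OF w1(1)] by (simp add: \<rho>_def)
    then show ?thesis using \<rho> by (simp add: t_def)
  qed
  ultimately show ?thesis using t posK[OF w1(1)] by blast
qed

definition psd_on_squares :: "('n::finite real_mpoly \<Rightarrow> real) \<Rightarrow> bool" where
  "psd_on_squares l \<longleftrightarrow> linear l \<and> (\<forall>q\<in>forms 2. l (q * q) \<ge> 0)"

text \<open>
  The kernel of the bilinear form \<open>(q, r) \<mapsto> l (q * r)\<close> on quadrics.
\<close>

definition radical :: "('n::finite real_mpoly \<Rightarrow> real) \<Rightarrow> 'n real_mpoly set" where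
  "radical l = {q \<in> forms 2. \<forall>r\<in>forms 2. l (q * r) = 0}"

lemma vanishes_on_forms_4: 
  fixes l :: "'n::finite real_mpoly \<Rightarrow> real"
  assumes l: "linear l" and z: "\<And>q r. q \<in> forms 2 \<Longrightarrow> r \<in> forms 2 \<Longrightarrow> l (q * r) = 0" and f: "f \<in> forms 4"
  shows "l f = 0"
proof -
  obtain g where g: "\<And>i. g i \<in> forms 3" "f = (\<Sum>i\<in>UNIV. X i * g i)"
    using forms_Suc_expand[of f 3] f by auto
  have "l (X i * g i) = 0" for i
  proof -
    obtain h where h: "\<And>j. h j \<in> forms 2" "g i = (\<Sum>j\<in>UNIV. X j * h j)"
      using forms_Suc_expand[of "g i" 2] g(1) by auto
    have "l (X i * g i) = (\<Sum>j\<in>UNIV. l ((X i * X j) * h j))"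
      by (simp add: h(2) sum_distrib_left linear_sum[OF l] mult.assoc)
    also have "\<dots> = 0" 
      using z h(1) forms_mult[OF forms_X(1) forms_X(1)] by (intro sum.neutral) (simp only: one_add_one, blast)
    finally show ?thesis .
  qed
  then show ?thesis by (simp add: g(2) linear_sum[OF l])
qed

text \<open>
  Let the radical of \<open>l\<close> have the largest possible dimension. Subtracting a multiple of \<open>l\<close> from \<open>h\<close> gives a
  functional \<open>g\<close> with \<open>g p = 0\<close> that still kills the radical times the quadrics. If \<open>g\<close> is nonzero on some
  square, then \<open>l\<close> moved in the direction \<open>\<plusminus>g\<close> up to the boundary of the positive semidefinite forms keeps its
  value at \<open>p\<close> and its radical, and acquires a new null vector: a contradiction. By polarisation \<open>g\<close> then
  vanishes on all quartics.
\<close>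

lemma extremal_functional:
  fixes p :: "'n::finite real_mpoly"
  assumes p: "p \<in> forms 4" "p \<notin> sos_forms 2"
  shows "\<exists>l. psd_on_squares l \<and> l p < 0 \<and>
    (\<forall>h. linear h \<longrightarrow> (\<forall>q\<in>radical l. \<forall>r\<in>forms 2. h (q * r) = 0) \<longrightarrow>
       (\<exists>k. \<forall>f\<in>forms 4. h f = k * l f))"
proof -
  let ?P = "\<lambda>l. psd_on_squares l \<and> l p < 0"
  define V where "V l = {c :: real^'n^'n. \<forall>d. l (quad_form c * quad_form d) = 0}" for l :: "'n real_mpoly \<Rightarrow> real"
  have bil: "bilinear (\<lambda>c d. l (quad_form c * quad_form d))" if "linear l" for l :: "'n real_mpoly \<Rightarrow> real"
    unfolding bilinear_def
    by (auto intro!: linearI simp: linear_add[OF linear_quad_form] linear_scale[OF linear_quad_form] algebra_simps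
        linear_add[OF that] linear_scale[OF that])
  have subV: "subspace (V l)" if "linear l" for l
    unfolding V_def subspace_def
    by (auto simp: linear_add[OF linear_quad_form] linear_scale[OF linear_quad_form] linear_0[OF linear_quad_form] algebra_simps
        linear_add[OF that] linear_scale[OF that] linear_0[OF that])
  have "\<exists>l. ?P l" using separating_functional[OF p] by (auto simp: psd_on_squares_def)
  moreover have "dim (V l) < Suc (DIM(real^'n^'n))" for l
    using dim_subset_UNIV[of "V l"] by simp
  ultimately obtain l where l: "?P l" "\<And>l'. ?P l' \<Longrightarrow> dim (V l') \<le> dim (V l)"
    using ex_has_greatest_nat[of ?P _ "\<lambda>l. dim (V l)"] by blast
  have lin: "linear l" using l(1) by (simp add: psd_on_squares_def)
  have Vrad: "quad_form c \<in> radical l \<longleftrightarrow> c \<in> V l" for c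
  proof
    assume "quad_form c \<in> radical l" then show "c \<in> V l" by (auto simp: radical_def V_def quad_form_forms)
  next
    assume "c \<in> V l" then show "quad_form c \<in> radical l" using forms_2_quad_form by (fastforce simp: radical_def V_def quad_form_forms)
  qed
  have "\<exists>k. \<forall>f\<in>forms 4. h f = k * l f"
    if h: "linear h" and hz: "\<forall>q\<in>radical l. \<forall>r\<in>forms 2. h (q * r) = 0" for h
  proof -
    define g where "g f = h f - h p / l p * l f" for f
    have gl: "linear g" unfolding g_def
      by (rule linearI) (simp_all add: linear_add[OF h] linear_scale[OF h] linear_add[OF lin] linear_scale[OF lin] algebra_simps add_divide_distrib)
    have gp: "g p = 0" using l(1) by (simp add: g_def)
    have gV: "g (quad_form c * quad_form d) = 0" if "c \<in> V l" for c d
    proof -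
      have "h (quad_form c * quad_form d) = 0" using that Vrad hz quad_form_forms by blast
      moreover have "l (quad_form c * quad_form d) = 0" using that by (simp add: V_def)
      ultimately show ?thesis by (simp add: g_def)
    qed
    have sq0: "g (quad_form c * quad_form c) = 0" for c
    proof (rule ccontr)
      assume n: "g (quad_form c * quad_form c) \<noteq> 0"
      (* The sign makes the direction negative somewhere, so that the perturbation meets the boundary. *)
      define s where "s = - sgn (g (quad_form c * quad_form c))"
      define G where "G f = s * g f" for f
      have Gl: "linear G" unfolding G_def
        by (rule linearI) (simp_all add: linear_add[OF gl] linear_scale[OF gl] algebra_simps)
      have "G (quad_form c * quad_form c) < 0" using n by (simp add: G_def s_def sgn_if)
      moreover have "G (quad_form c * quad_form d) = 0" if "\<forall>d. l (quad_form c * quad_form d) = 0" for c d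
        using gV[of c d] that by (simp add: G_def V_def)
      moreover have "l (quad_form c * quad_form c) \<ge> 0" for c using l(1) quad_form_forms by (auto simp: psd_on_squares_def)
      ultimately obtain t c1 where t: "t > 0" "\<And>c. l (quad_form c * quad_form c) + t * G (quad_form c * quad_form c) \<ge> 0"
        "l (quad_form c1 * quad_form c1) > 0" "l (quad_form c1 * quad_form c1) + t * G (quad_form c1 * quad_form c1) = 0"
        using psd_perturbation[OF bil[OF lin] _ _ bil[OF Gl], of c] by (auto simp: mult.commute)
      define l' where "l' f = l f + t * G f" for f
      have l'l: "linear l'" unfolding l'_def
        by (rule linearI) (simp_all add: linear_add[OF Gl] linear_scale[OF Gl] linear_add[OF lin] linear_scale[OF lin] algebra_simps)
      have "?P l'"
        using l'l t(2) forms_2_quad_form l(1) gp by (fastforce simp: psd_on_squares_def l'_def G_def)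
      then have le: "dim (V l') \<le> dim (V l)" by (rule l(2))
      have "V l \<subseteq> V l'" using gV by (auto simp: V_def l'_def G_def)
      moreover have "c1 \<in> V l'"
      proof -
        have "l' (quad_form c1 * quad_form d) = 0" for d
          by (rule psd_form_null_vector[OF bil[OF l'l]]) (use t(2,4) in \<open>auto simp: l'_def mult.commute\<close>)
        then show ?thesis by (simp add: V_def)
      qed
      moreover have "c1 \<notin> V l" using t(3) unfolding V_def by fastforce
      ultimately have "V l \<subset> V l'" by blast
      then have "dim (V l) < dim (V l')"
        using subV[OF lin] subV[OF l'l] by (intro dim_psubset) (simp add: span_eq_iff[THEN iffD2])
      with le show False by simp
    qed
    have "g (quad_form c * quad_form d) = 0" for c d
    proof -
      have "g (quad_form (c + d) * quad_form (c + d)) = g (quad_form c * quad_form c) + 2 * g (quad_form c * quad_form d) + g (quad_form d * quad_form d)"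
        using arg_cong[OF mult.commute[of "quad_form d" "quad_form c"], of g]
        by (simp add: bilinear_ladd[OF bil[OF gl]] bilinear_radd[OF bil[OF gl]])
      then show ?thesis by (simp add: sq0)
    qed
    then have "g (q * r) = 0" if "q \<in> forms 2" "r \<in> forms 2" for q r
      using that forms_2_quad_form by metis
    then have "g f = 0" if "f \<in> forms 4" for f
      using vanishes_on_forms_4[OF gl _ that] by blast
    then show ?thesis by (intro exI[of _ "h p / l p"]) (auto simp: g_def)
  qed
  then show ?thesis using l(1) by blast
qed

section \<open>The radical generates an ideal containing all quintics\<close>

text \<open>
  Ideals are the submodules of a ring regarded as a module over itself, so \<open>ideal.span B\<close> is the ideal
  generated by \<open>B\<close>.
\<close>

interpretation ideal: module "(*) :: 'a::comm_ring_1 \<Rightarrow> 'a \<Rightarrow> 'a"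
  by standard (simp_all add: algebra_simps)

text \<open>
  For multiplication as scaling this simplification rule is associativity read from right to left, so it loops
  with \<open>mult.assoc\<close>.
\<close>

declare ideal.scale_scale [simp del]

lemma ideal_mult_left: "x \<in> ideal.span B \<Longrightarrow> c * x \<in> ideal.span B"
  by (rule ideal.span_scale)
lemma ideal_mult_right: "x \<in> ideal.span B \<Longrightarrow> x * c \<in> ideal.span B"
  using ideal.span_scale[of x B c] by (simp add: mult.commute)

lemma subspace_ideal: "subspace (ideal.span (B :: 'a::{real_algebra_1,comm_ring_1} set))"
  unfolding subspace_def
proof (intro conjI ballI allI)
  fix c :: real and x assume "x \<in> ideal.span B"
  then have "(c *\<^sub>R 1) * x \<in> ideal.span B" by (rule ideal.span_scale)
  then show "c *\<^sub>R x \<in> ideal.span B" by simp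
qed (auto intro: ideal.span_add ideal.span_zero)

lemma ideal_power_cong: "x - y \<in> ideal.span B \<Longrightarrow> x ^ j - y ^ j \<in> ideal.span B"
proof (induction j)
  case (Suc j)
  have "x ^ Suc j - y ^ Suc j = x * (x ^ j - y ^ j) + (x - y) * y ^ j" by (simp add: algebra_simps)
  then show ?case using Suc by (simp add: ideal.span_add ideal_mult_left ideal_mult_right)
qed (simp add: ideal.span_zero)

lemma ideal_finite_subset:
  assumes "x \<in> ideal.span B"
  shows "\<exists>B0. finite B0 \<and> B0 \<subseteq> B \<and> x \<in> ideal.span B0"
proof -
  obtain t r where t: "finite t" "t \<subseteq> B" "x = (\<Sum>a\<in>t. r a * a)"
    using assms unfolding ideal.span_explicit by blast
  then have "x \<in> ideal.span t" by (auto intro!: ideal.span_sum ideal.span_scale intro: ideal.span_base)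
  with t show ?thesis by blast
qed

lemma ideal_psubst_cong:
  fixes q q' :: "'v \<Rightarrow> 'a::{real_algebra_1,comm_ring_1}"
  assumes "P \<in> pvars V" "\<And>i. i \<in> V \<Longrightarrow> q i - q' i \<in> ideal.span B"
  shows "psubst q P - psubst q' P \<in> ideal.span B"
proof -
  have mult: "a * b - a' * b' \<in> ideal.span B" if "a - a' \<in> ideal.span B" "b - b' \<in> ideal.span B" for a b a' b'
  proof -
    have "a * b - a' * b' = a * (b - b') + (a - a') * b'" by (simp add: algebra_simps)
    then show ?thesis using that by (simp add: ideal.span_add ideal_mult_left ideal_mult_right)
  qed
  have pr: "(\<Prod>i\<in>A. q i ^ Poly_Mapping.lookup m i) - (\<Prod>i\<in>A. q' i ^ Poly_Mapping.lookup m i) \<in> ideal.span B"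
    if "finite A" "A \<subseteq> V" for A m
    using that
  proof (induction A)
    case empty show ?case by (simp add: ideal.span_zero)
  next
    case (insert i A)
    then show ?case by (auto intro!: mult ideal_power_cong assms(2))
  qed
  have "mon_value q m - mon_value q' m \<in> ideal.span B" if "m \<in> Poly_Mapping.keys P" for m
    unfolding mon_value_def using that assms(1) by (intro pr) (auto simp: pvars_def)
  then have "(\<Sum>m\<in>Poly_Mapping.keys P. Poly_Mapping.lookup P m *\<^sub>R (mon_value q m - mon_value q' m)) \<in> ideal.span B"
    by (intro subspace_sum[OF subspace_ideal] subspace_scale[OF subspace_ideal])
  then show ?thesis by (simp add: psubst_def sum_subtractf scaleR_diff_right)
qed

text \<open>
  Quadrics generate a homogeneous ideal.
\<close>

lemma hom_component_ideal:
  assumes "f \<in> ideal.span B" "B \<subseteq> forms 2"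
  shows "hom_component d f \<in> ideal.span B"
  using assms(1)
proof (induction rule: ideal.span_induct_alt)
  case base then show ?case by (simp add: ideal.span_zero)
next
  case (step c x y)
  have x: "x \<in> forms 2" using step assms(2) by auto
  have "hom_component d (x * c) \<in> ideal.span B"
  proof (cases "d < 2")
    case True then show ?thesis using hom_component_mult_0[OF x] by (simp add: ideal.span_zero)
  next
    case False
    then have "hom_component d (x * c) = x * hom_component (d - 2) c" using hom_component_mult[OF x, of "d - 2" c] by (simp del: add_2_eq_Suc')
    then show ?thesis using step(1) by (simp add: ideal_mult_right ideal.span_base)
  qed
  then show ?case using step by (simp add: hom_component_add mult.commute ideal.span_add)
qed

text \<open>
  For forms this says that the origin of \<open>\<complex>\<^sup>n\<close> is the only common zero. The algebraic version
  allows all arguments to stay within real polynomials.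
\<close>

definition primary_to_origin :: "'n::finite real_mpoly set \<Rightarrow> bool" where
  "primary_to_origin B \<longleftrightarrow> (\<forall>i. \<exists>D. X i ^ D \<in> ideal.span B)"

lemma functional_separating_from_span:
  fixes f :: "'a::real_vector"
  assumes "f \<notin> span L"
  shows "\<exists>\<phi>::'a \<Rightarrow> real. linear \<phi> \<and> (\<forall>x\<in>L. \<phi> x = 0) \<and> \<phi> f = 1"
proof -
  obtain B where B: "B \<subseteq> L" "independent B" "L \<subseteq> span B" using maximal_independent_subset[of L] by blast
  have fB: "f \<notin> span B" using assms B(1) span_mono by blast
  then have "independent (insert f B)" using B(2) by (simp add: independent_insertI)
  then obtain \<phi> :: "'a \<Rightarrow> real" where \<phi>: "linear \<phi>" "\<forall>x\<in>insert f B. \<phi> x = (if x = f then 1 else 0)"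
    using linear_independent_extend[of "insert f B" "\<lambda>x. if x = f then 1 else 0"] by blast
  have "\<phi> x = 0" if "x \<in> B" for x using \<phi>(2) that fB span_base by fastforce
  then have "\<phi> x = 0" if "x \<in> L" for x
    using linear_eq_0_on_span[OF \<phi>(1)] B(3) that by blast
  then show ?thesis using \<phi> by auto
qed

lemma linear_expand:
  fixes l :: "_ \<Rightarrow> real"
  assumes "linear l"
  shows "l f = (\<Sum>m\<in>Poly_Mapping.keys f. Poly_Mapping.lookup f m * l (mon m))"
  by (subst mon_expand) (simp add: linear_sum[OF assms] linear_scale[OF assms])

text \<open>
  A functional \<open>\<phi>\<close> on quintics that kills the radical times the cubics gives functionals \<open>f \<mapsto> \<phi> (x\<^sub>i f)\<close>
  that kill the radical times the quadrics, so they are multiples \<open>c\<^sub>i l\<close> of \<open>l\<close>. Comparing the values at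
  \<open>x\<^sub>i x\<^sub>j g\<close> gives \<open>c\<^sub>i l (x\<^sub>j g) = c\<^sub>j l (x\<^sub>i g)\<close> for all cubics \<open>g\<close>, and this makes \<open>l\<close> the evaluation at the
  point \<open>v = c / c\<^sub>k\<close> times \<open>l (x\<^sub>k\<^sup>4) \<ge> 0\<close>, contrary to \<open>p v \<ge> 0\<close> and \<open>l p < 0\<close>.
\<close>

lemma radical_primary:
  fixes p :: "'n::finite real_mpoly"
  assumes p: "p \<in> psd_forms 2" and l: "psd_on_squares l" "l p < 0"
    and U: "\<And>h. linear h \<Longrightarrow> (\<forall>q\<in>radical l. \<forall>r\<in>forms 2. h (q * r) = 0) \<Longrightarrow> \<exists>k. \<forall>f\<in>forms 4. h f = k * l f"
  shows "forms 5 \<subseteq> ideal.span (radical l)"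
proof
  fix f :: "'n real_mpoly" assume f: "f \<in> forms 5"
  define L where "L = {q * h | q h. q \<in> radical l \<and> h \<in> forms 3}"
  have lin: "linear l" using l(1) by (simp add: psd_on_squares_def)
  have "f \<in> span L"
  proof (rule ccontr)
    assume "f \<notin> span L"
    then obtain \<phi> :: "_ \<Rightarrow> real" where \<phi>: "linear \<phi>" "\<And>x. x \<in> L \<Longrightarrow> \<phi> x = 0" "\<phi> f = 1"
      using functional_separating_from_span by metis
    have "\<exists>k. \<forall>f\<in>forms 4. \<phi> (X i * f) = k * l f" for i
    proof (rule U)
      show "linear (\<lambda>f. \<phi> (X i * f))"
        by (rule linearI) (simp_all add: algebra_simps linear_add[OF \<phi>(1)] linear_scale[OF \<phi>(1)])
      show "\<forall>q\<in>radical l. \<forall>r\<in>forms 2. \<phi> (X i * (q * r)) = 0"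
      proof (intro ballI)
        fix q r assume qr: "q \<in> radical l" "(r :: 'n real_mpoly) \<in> forms 2"
        have "X i * r \<in> forms 3" using forms_mult[OF forms_X(1) qr(2), of i] by (simp add: eval_nat_numeral)
        then have "q * (X i * r) \<in> L" using qr by (auto simp: L_def)
        then show "\<phi> (X i * (q * r)) = 0" using \<phi>(2) by (simp add: mult.left_commute)
      qed
    qed
    then obtain c where c: "\<And>i f. f \<in> forms 4 \<Longrightarrow> \<phi> (X i * f) = c i * l f" by metis
    have "\<exists>k. c k \<noteq> 0"
    proof (rule ccontr)
      assume "\<not> ?thesis"
      then have c0: "c i = 0" for i by auto
      obtain g where g: "\<And>i. g i \<in> forms 4" "f = (\<Sum>i\<in>UNIV. X i * g i)"
        using forms_Suc_expand[of f 4] f by auto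
      have "\<phi> f = 0" using c[OF g(1)] by (simp add: g(2) linear_sum[OF \<phi>(1)] c0)
      then show False using \<phi>(3) by simp
    qed
    then obtain k where k: "c k \<noteq> 0" by blast
    define v where "v i = c i / c k" for i
    have step: "l (X j * g) = v j * l (X k * g)" if g: "g \<in> forms 3" for j g
    proof -
      have Xg: "X i * g \<in> forms 4" for i using forms_mult[OF forms_X(1) g] by simp
      have "c k * l (X j * g) = \<phi> (X k * (X j * g))" using c[OF Xg] by simp
      also have "\<dots> = \<phi> (X j * (X k * g))" by (simp add: mult.left_commute)
      also have "\<dots> = c j * l (X k * g)" using c[OF Xg] by simp
      finally show ?thesis using k by (simp add: v_def field_simps)
    qed
    have mon: "l (mon m * X k ^ (4 - e)) = mon_value v m * l (X k ^ 4)" if "mdeg m = e" "e \<le> 4" for m e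
      using that
    proof (induction e arbitrary: m)
      case 0 then show ?case by (simp add: mdeg_eq_0_iff mon_0)
    next
      case (Suc e)
      then obtain i n where n: "m = Poly_Mapping.single i 1 + n" "mdeg n = e" using mdeg_SucD by blast
      let ?g = "mon n * X k ^ (3 - e)"
      have "?g \<in> forms (e + 1 * (3 - e))" using n by (intro forms_mult forms_power forms_X) (simp add: forms_mon)
      then have g: "?g \<in> forms 3" using Suc.prems by simp
      have e: "4 - e = Suc (3 - e)" using Suc.prems by simp
      have "mon m * X k ^ (4 - Suc e) = X i * ?g" by (simp add: n X_def mon_mult[symmetric] mult.assoc)
      then have "l (mon m * X k ^ (4 - Suc e)) = v i * l (X k * ?g)" using step[OF g, of i] by metis
      also have "X k * ?g = mon n * X k ^ (4 - e)" unfolding e by (simp add: mult_ac)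
      also have "l (mon n * X k ^ (4 - e)) = mon_value v n * l (X k ^ 4)" using Suc n by auto
      finally show ?case by (simp add: n)
    qed
    have pf: "p \<in> forms 4" "\<And>x :: real ^ 'n. psubst (\<lambda>i. x $ i) p \<ge> 0"
      using p by (auto simp: psd_forms_def eval_at_psubst)
    have "l p = (\<Sum>m\<in>Poly_Mapping.keys p. Poly_Mapping.lookup p m * (mon_value v m * l (X k ^ 4)))"
      using pf(1) mon[of _ 4] by (subst linear_expand[OF lin]) (auto intro!: sum.cong simp: forms_iff)
    also have "\<dots> = psubst (\<lambda>i. (\<chi> i. v i) $ i) p * l (X k ^ 4)"
      by (simp add: psubst_def sum_distrib_right mult.assoc)
    also have "\<dots> \<ge> 0"
    proof (intro mult_nonneg_nonneg pf)
      have "X k ^ 2 \<in> forms 2" using forms_power[OF forms_X(1), of k 2] by simp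
      then have "l (X k ^ 2 * X k ^ 2) \<ge> 0" using l(1) by (auto simp: psd_on_squares_def)
      then show "l (X k ^ 4) \<ge> 0" by (simp flip: power_add)
    qed
    finally show False using l(2) by simp
  qed
  moreover have "L \<subseteq> ideal.span (radical l)" by (auto simp: L_def intro!: ideal_mult_right intro: ideal.span_base)
  then have "span L \<subseteq> ideal.span (radical l)" using subspace_ideal by (rule span_minimal)
  ultimately show "f \<in> ideal.span (radical l)" by blast
qed

lemma scaleR_pow: "(a *\<^sub>R x) ^ n = a ^ n *\<^sub>R (x :: 'a::real_algebra_1) ^ n"
  by (induction n) auto

text \<open>
  Take a point \<open>c\<close> with \<open>P c \<noteq> 0\<close> and \<open>c\<^sub>i\<^sub>0 \<noteq> 0\<close>, and let \<open>a = c / c\<^sub>i\<^sub>0\<close>. Modulo the forms \<open>q\<^sub>i - a\<^sub>i q\<^sub>i\<^sub>0\<close>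
  every \<open>q\<^sub>i\<close> is the multiple \<open>a\<^sub>i\<close> of \<open>q\<^sub>i\<^sub>0\<close>, so the relation becomes a polynomial in \<open>q\<^sub>i\<^sub>0\<close> alone, each of
  whose homogeneous components lies in the ideal. Not all of its coefficients \<open>b\<^sub>j\<close> vanish, since
  \<open>P c\<close> is the sum of the \<open>b\<^sub>j c\<^sub>i\<^sub>0\<^sup>j\<close>.
\<close>

lemma algebraic_relation_drops_generator:
  fixes q :: "'v::linorder \<Rightarrow> 'n::finite real_mpoly"
  assumes q: "\<And>i. i \<in> V \<Longrightarrow> q i \<in> forms 2" and P: "P \<in> pvars V" "P \<noteq> 0" "psubst q P = 0" and i0: "i0 \<in> V"
  shows "\<exists>a j. q i0 ^ j \<in> ideal.span ((\<lambda>i. q i - a i *\<^sub>R q i0) ` (V - {i0}))"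
proof -
  have "P * X i0 \<noteq> 0" using P(2) by (metis mult_eq_0_iff X_def keys_mon keys_zero insert_not_empty)
  then obtain c :: "'v \<Rightarrow> real" where "psubst c (P * X i0) \<noteq> 0" using nonzero_poly_nonzero_value by blast
  then have c: "psubst c P \<noteq> 0" "c i0 \<noteq> 0" by (auto simp: psubst_mult)
  define a where "a i = c i / c i0" for i
  let ?B = "(\<lambda>i. q i - a i *\<^sub>R q i0) ` (V - {i0})"
  let ?I = "ideal.span ?B"
  have "psubst q P - psubst (\<lambda>i. a i *\<^sub>R q i0) P \<in> ?I"
  proof (rule ideal_psubst_cong[OF P(1)])
    fix i assume "i \<in> V"
    show "q i - a i *\<^sub>R q i0 \<in> ?I"
    proof (cases "i = i0")
      case True then show ?thesis using c by (simp add: a_def ideal.span_zero)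
    next
      case False then show ?thesis using \<open>i \<in> V\<close> by (intro ideal.span_base) auto
    qed
  qed
  then have R: "psubst (\<lambda>i. a i *\<^sub>R q i0) P \<in> ?I" using P(3) ideal.span_neg by fastforce
  have mv: "mon_value (\<lambda>i. a i *\<^sub>R q i0) m = mon_value a m *\<^sub>R q i0 ^ mdeg m" for m
  proof -
    have "(\<Prod>i\<in>A. (a i *\<^sub>R q i0) ^ Poly_Mapping.lookup m i) = (\<Prod>i\<in>A. a i ^ Poly_Mapping.lookup m i) *\<^sub>R q i0 ^ (\<Sum>i\<in>A. Poly_Mapping.lookup m i)"
      if "finite A" for A using that by induction (auto simp: scaleR_pow power_add)
    then show ?thesis by (simp add: mon_value_def mdeg_def)
  qed
  define b where "b j = (\<Sum>m\<in>{m\<in>Poly_Mapping.keys P. mdeg m = j}. Poly_Mapping.lookup P m * mon_value a m)" for j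
  have BI: "?B \<subseteq> forms 2" using q i0 by (auto intro!: forms_diff forms_scaleR)
  have bI: "b j *\<^sub>R q i0 ^ j \<in> ?I" for j
  proof -
    have qj: "q i0 ^ k \<in> forms (2 * k)" for k using forms_power[OF q[OF i0]] .
    have "hom_component (2 * j) (psubst (\<lambda>i. a i *\<^sub>R q i0) P) =
      (\<Sum>m\<in>Poly_Mapping.keys P. if mdeg m = j then (Poly_Mapping.lookup P m * mon_value a m) *\<^sub>R q i0 ^ j else 0)"
      unfolding psubst_def mv hom_component_sum hom_component_scaleR by (intro sum.cong refl) (auto simp: hom_component_forms[OF qj])
    also have "\<dots> = b j *\<^sub>R q i0 ^ j" 
      unfolding b_def scaleR_sum_left by (rule sum.inter_filter[symmetric]) simp
    finally show ?thesis using hom_component_ideal[OF R BI, of "2 * j"] by simp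
  qed
  have "\<exists>j. b j \<noteq> 0"
  proof (rule ccontr)
    assume "\<not> ?thesis"
    then have b0: "b j = 0" for j by auto
    have mc: "mon_value c m = mon_value a m * c i0 ^ mdeg m" for m
    proof -
      have "c = (\<lambda>i. a i * c i0)" using c by (auto simp: a_def)
      from arg_cong[OF this, of "\<lambda>z. mon_value z m"] show ?thesis
        by (simp add: mon_value_def mdeg_def power_mult_distrib prod.distrib power_sum)
    qed
    have "psubst c P = (\<Sum>m\<in>Poly_Mapping.keys P. Poly_Mapping.lookup P m * mon_value c m)" by (simp add: psubst_def)
    also have "\<dots> = (\<Sum>j\<in>mdeg ` Poly_Mapping.keys P. \<Sum>m\<in>{m\<in>Poly_Mapping.keys P. mdeg m = j}. Poly_Mapping.lookup P m * mon_value c m)"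
      by (rule sum.image_gen) simp
    also have "\<dots> = (\<Sum>j\<in>mdeg ` Poly_Mapping.keys P. b j * c i0 ^ j)"
      unfolding b_def sum_distrib_right by (intro sum.cong refl) (auto simp: mc)
    also have "\<dots> = 0" by (simp add: b0)
    finally show False using c by simp
  qed
  then obtain j where "b j \<noteq> 0" by blast
  then have "(1 / b j) *\<^sub>R (b j *\<^sub>R q i0 ^ j) = q i0 ^ j" by simp
  moreover have "(1 / b j) *\<^sub>R (b j *\<^sub>R q i0 ^ j) \<in> ?I" using bI subspace_scale[OF subspace_ideal] by blast
  ultimately show ?thesis by metis
qed

text \<open>
  Modulo the smaller ideal a power of each variable is a multiple of \<open>q0\<close>, hence nilpotent.
\<close>

lemma primary_drop_nilpotent:
  assumes B: "primary_to_origin B" and q0: "q0 ^ j \<in> ideal.span B'"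
    and sub: "\<And>b. b \<in> B \<Longrightarrow> \<exists>r\<in>ideal.span B'. \<exists>h. b = r + h * q0"
  shows "primary_to_origin B'"
proof -
  have dec: "\<exists>r\<in>ideal.span B'. \<exists>h. x = r + h * q0" if "x \<in> ideal.span B" for x
    using that
  proof (induction x rule: ideal.span_induct_alt)
    case base then show ?case by (intro bexI[of _ 0] exI[of _ 0]) (auto simp: ideal.span_zero)
  next
    case (step c x y)
    obtain r h where 1: "r \<in> ideal.span B'" "x = r + h * q0" using sub[OF step(1)] by blast
    obtain r' h' where 2: "r' \<in> ideal.span B'" "y = r' + h' * q0" using step(2) by blast
    have "c * x + y = (c * r + r') + (c * h + h') * q0" by (simp add: 1 2 algebra_simps)
    moreover have "c * r + r' \<in> ideal.span B'" using 1 2 by (intro ideal.span_add ideal_mult_left)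
    ultimately show ?case by blast
  qed
  show ?thesis
    unfolding primary_to_origin_def
  proof
    fix i
    obtain D where "X i ^ D \<in> ideal.span B" using B by (auto simp: primary_to_origin_def)
    from dec[OF this] obtain r h where r: "r \<in> ideal.span B'" "X i ^ D = r + h * q0" by blast
    then have "(X i ^ D) ^ j - (h * q0) ^ j \<in> ideal.span B'" by (intro ideal_power_cong) simp
    moreover have "(h * q0) ^ j \<in> ideal.span B'" using q0 by (simp add: power_mult_distrib ideal_mult_left)
    ultimately have "(X i ^ D) ^ j \<in> ideal.span B'" using ideal.span_add by fastforce
    then show "\<exists>D. X i ^ D \<in> ideal.span B'" by (metis power_mult)
  qed
qed

definition minimal_primary_quadrics :: "'n::finite real_mpoly set \<Rightarrow> 'n real_mpoly set \<Rightarrow> bool" where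
  "minimal_primary_quadrics W B \<longleftrightarrow> finite B \<and> B \<subseteq> W \<and> primary_to_origin B \<and>
     (\<forall>B'. finite B' \<and> B' \<subseteq> W \<and> primary_to_origin B' \<longrightarrow> card B \<le> card B')"

lemma minimal_primary_exists:
  fixes W :: "'n::finite real_mpoly set"
  assumes "forms 5 \<subseteq> ideal.span W"
  shows "\<exists>B. minimal_primary_quadrics W B"
proof -
  have "\<exists>B0. finite B0 \<and> B0 \<subseteq> W \<and> X i ^ 5 \<in> ideal.span B0" for i
    using ideal_finite_subset[of "X i ^ 5" W] forms_power[OF forms_X(1), of i 5] assms by auto
  then obtain B0 where B0: "\<And>i. finite (B0 i) \<and> B0 i \<subseteq> W \<and> X i ^ 5 \<in> ideal.span (B0 i)" by metis
  define B where "B = (\<Union>i. B0 i)"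
  have "finite B" "B \<subseteq> W" using B0 by (auto simp: B_def)
  moreover have "X i ^ 5 \<in> ideal.span B" for i
    using B0[of i] ideal.span_mono[of "B0 i" B] by (auto simp: B_def)
  ultimately have "finite B \<and> B \<subseteq> W \<and> primary_to_origin B" by (auto simp: primary_to_origin_def)
  from ex_has_least_nat[of "\<lambda>B. finite B \<and> B \<subseteq> W \<and> primary_to_origin B", OF this, of card]
  show ?thesis by (auto simp: minimal_primary_quadrics_def)
qed

text \<open>
  An algebraic relation would let one generator be eliminated, after replacing the other ones
  by their differences with multiples of it, which again lie in the subspace \<open>W\<close>.
\<close>

lemma minimal_primary_independent:
  fixes q :: "'v::linorder \<Rightarrow> 'n::finite real_mpoly"
  assumes min: "minimal_primary_quadrics W B" and W: "subspace W" "W \<subseteq> forms 2"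
    and q: "inj_on q V" "q ` V \<subseteq> B" "P \<in> pvars V" "psubst q P = 0"
  shows "P = 0"
proof (rule ccontr)
  assume P: "P \<noteq> 0"
  have B: "finite B" "B \<subseteq> W" "primary_to_origin B" 
    and least: "\<And>B'. finite B' \<Longrightarrow> B' \<subseteq> W \<Longrightarrow> primary_to_origin B' \<Longrightarrow> card B \<le> card B'"
    using min by (auto simp: minimal_primary_quadrics_def)
  show False
  proof (cases "V = {}")
    case True
    then have "Poly_Mapping.keys P \<subseteq> {0}" using q(3) by (auto simp: pvars_def)
    then have "P = (\<Sum>m\<in>{0}. Poly_Mapping.lookup P m *\<^sub>R mon m)" by (intro mon_expand_gen) auto
    then obtain r where r: "P = r *\<^sub>R 1" by (auto simp: mon_0)
    then have "r *\<^sub>R (1 :: 'n real_mpoly) = 0" using q(4) by (simp add: psubst_scaleR)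
    then have "r = 0" by simp
    then show False using r P by simp
  next
    case False
    then obtain i0 where i0: "i0 \<in> V" by blast
    have q2: "q i \<in> forms 2" if "i \<in> V" for i using that q(2) B W by auto
    obtain a j where aj: "q i0 ^ j \<in> ideal.span ((\<lambda>i. q i - a i *\<^sub>R q i0) ` (V - {i0}))"
      using algebraic_relation_drops_generator[OF q2 q(3) P q(4) i0] by blast
    define B' where "B' = (\<lambda>i. q i - a i *\<^sub>R q i0) ` (V - {i0}) \<union> (B - q ` V)"
    have finV: "finite V" using q B by (meson finite_imageD finite_subset)
    have "q i0 ^ j \<in> ideal.span B'" using aj ideal.span_mono[of "(\<lambda>i. q i - a i *\<^sub>R q i0) ` (V - {i0})" B'] by (auto simp: B'_def)
    then have "primary_to_origin B'"
    proof (rule primary_drop_nilpotent[OF B(3)])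
      fix b assume b: "b \<in> B"
      show "\<exists>r\<in>ideal.span B'. \<exists>h. b = r + h * q i0"
      proof (cases "b \<in> q ` V")
        case False
        then have "b \<in> ideal.span B'" using b by (intro ideal.span_base) (auto simp: B'_def)
        then show ?thesis by (intro bexI[of _ b] exI[of _ 0]) auto
      next
        case True
        then obtain i where i: "i \<in> V" "b = q i" by blast
        show ?thesis
        proof (cases "i = i0")
          case True then show ?thesis using i by (intro bexI[of _ 0] exI[of _ 1]) (auto simp: ideal.span_zero)
        next
          case False
          have "q i - a i *\<^sub>R q i0 \<in> ideal.span B'" using i False by (intro ideal.span_base) (auto simp: B'_def)
          then show ?thesis using i by (intro bexI[of _ "q i - a i *\<^sub>R q i0"] exI[of _ "a i *\<^sub>R 1"]) auto
        qed
      qed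
    qed
    moreover have "finite B'" using finV B by (auto simp: B'_def)
    moreover have "B' \<subseteq> W" using q(2) B(2) i0 W(1) unfolding B'_def
      by (auto intro!: subspace_diff subspace_scale)
    ultimately have "card B \<le> card B'" by (rule least[rotated 2])
    also have "card B' \<le> card (V - {i0}) + card (B - q ` V)"
      unfolding B'_def using finV by (intro card_Un_le[THEN order_trans] add_mono card_image_le) auto
    also have "card (V - {i0}) < card V" by (rule card_Diff1_less[OF finV i0])
    also have "card V + card (B - q ` V) = card B"
    proof -
      have "card (B - q ` V) = card B - card (q ` V)" using finV q(2) by (intro card_Diff_subset) auto
      moreover have "card (q ` V) = card V" by (rule card_image[OF q(1)])
      moreover have "card (q ` V) \<le> card B" by (rule card_mono[OF B(1) q(2)])
      ultimately show ?thesis by simp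
    qed
    finally show False by simp
  qed
qed

section \<open>Dimension counts: four independent quadrics\<close>

lemma scaleR_span_dependent:
  fixes v :: "'i \<Rightarrow> 'a::real_vector"
  assumes "finite T" "finite I" "card T < card I" "\<And>i. i \<in> I \<Longrightarrow> v i \<in> span T"
  shows "\<exists>c. (\<exists>i\<in>I. c i \<noteq> 0) \<and> (\<Sum>i\<in>I. c i *\<^sub>R v i) = 0"
proof -
  have "\<forall>i\<in>I. \<exists>M. v i = (\<Sum>t\<in>T. M t *\<^sub>R t)" using assms(4) span_finite[OF assms(1)] by auto
  then obtain M where M: "\<And>i. i \<in> I \<Longrightarrow> v i = (\<Sum>t\<in>T. M i t *\<^sub>R t)" by metis
  obtain c where c: "\<exists>i\<in>I. c i \<noteq> 0" "\<And>t. t \<in> T \<Longrightarrow> (\<Sum>i\<in>I. c i * M i t) = 0"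
    using homogeneous_system_nontrivial_solution[OF assms(1-3), of M] by blast
  have "(\<Sum>i\<in>I. c i *\<^sub>R v i) = (\<Sum>i\<in>I. \<Sum>t\<in>T. (c i * M i t) *\<^sub>R t)"
    by (intro sum.cong refl) (simp add: M scaleR_sum_right)
  also have "\<dots> = (\<Sum>t\<in>T. (\<Sum>i\<in>I. c i * M i t) *\<^sub>R t)" by (subst sum.swap) (simp add: scaleR_sum_left)
  also have "\<dots> = 0" using c(2) by simp
  finally show ?thesis using c(1) by blast
qed

definition pdeg_le :: "nat \<Rightarrow> 'n::finite real_mpoly set" where
  "pdeg_le k = {f. Poly_Mapping.keys f \<subseteq> Mon UNIV k}"

lemma subspace_pdeg_le: "subspace (pdeg_le k)"
  unfolding subspace_def pdeg_le_def
proof (intro conjI ballI allI)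
  fix x y :: "'a real_mpoly" assume "x \<in> {f. Poly_Mapping.keys f \<subseteq> Mon UNIV k}" "y \<in> {f. Poly_Mapping.keys f \<subseteq> Mon UNIV k}"
  then show "x + y \<in> {f. Poly_Mapping.keys f \<subseteq> Mon UNIV k}" using keys_add[of x y] by auto
qed (auto simp: keys_scaleR)

lemma pdeg_le_span: "pdeg_le k = (span (mon ` Mon UNIV k) :: 'n::finite real_mpoly set)"
proof
  show "pdeg_le k \<subseteq> (span (mon ` Mon UNIV k) :: 'n real_mpoly set)"
  proof
    fix f :: "'n real_mpoly" assume "f \<in> pdeg_le k"
    then have "f = (\<Sum>m\<in>Mon UNIV k. Poly_Mapping.lookup f m *\<^sub>R mon m)"
      by (intro mon_expand_gen) (auto simp: pdeg_le_def)
    moreover have "(\<Sum>m\<in>Mon UNIV k. Poly_Mapping.lookup f m *\<^sub>R mon m) \<in> span (mon ` Mon UNIV k)"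
      by (intro span_sum span_scale span_base) auto
    ultimately show "f \<in> span (mon ` Mon UNIV k)" by simp
  qed
  show "(span (mon ` Mon UNIV k) :: 'n real_mpoly set) \<subseteq> pdeg_le k"
    by (intro span_minimal subspace_pdeg_le) (auto simp: pdeg_le_def)
qed

lemma pdeg_le_mult: "f \<in> pdeg_le k \<Longrightarrow> g \<in> pdeg_le l \<Longrightarrow> f * g \<in> pdeg_le (k + l)"
  using keys_mult[of f g] by (fastforce simp: pdeg_le_def Mon_def)
lemma pdeg_le_mono: "k \<le> l \<Longrightarrow> pdeg_le k \<subseteq> pdeg_le l"
  by (fastforce simp: pdeg_le_def Mon_def)
lemma forms_pdeg_le: "f \<in> forms d \<Longrightarrow> f \<in> pdeg_le d"
  by (auto simp: pdeg_le_def Mon_def forms_iff)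
lemma pdeg_le_exists: "\<exists>k. f \<in> pdeg_le k"
proof -
  have "Poly_Mapping.keys f \<subseteq> Mon UNIV (\<Sum>m\<in>Poly_Mapping.keys f. mdeg m)"
    by (auto simp: Mon_def intro: member_le_sum)
  then show ?thesis by (auto simp: pdeg_le_def)
qed

lemma mon_value_forms: 
  assumes "\<And>i. i \<in> V \<Longrightarrow> q i \<in> forms 2" "Poly_Mapping.keys a \<subseteq> V"
  shows "mon_value q a \<in> forms (2 * mdeg a)"
proof -
  have "(\<Prod>i\<in>A. q i ^ Poly_Mapping.lookup a i) \<in> forms (2 * (\<Sum>i\<in>A. Poly_Mapping.lookup a i))"
    if "finite A" "A \<subseteq> V" for A
    using that
  proof (induction A)
    case (insert i A)
    then have "q i ^ Poly_Mapping.lookup a i \<in> forms (2 * Poly_Mapping.lookup a i)" using assms(1) by (intro forms_power) auto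
    then show ?case using insert by (simp add: forms_mult distrib_left)
  qed simp
  then show ?thesis using assms(2) by (simp add: mon_value_def mdeg_def)
qed

lemma choose_step: "(k + 1) * ((n + (k + 1)) choose (k + 1)) = (n + (k + 1)) * ((n + k) choose k)"
  using Suc_times_binomial[of k "n + k"] by simp

lemma choose_4: "24 * ((n + 4) choose 4) = (n + 1) * (n + 2) * (n + 3) * (n + 4)"
proof -
  have 4: "4 * ((n + 4) choose 4) = (n + 4) * ((n + 3) choose 3)" using choose_step[of 3 n] by simp
  have 3: "3 * ((n + 3) choose 3) = (n + 3) * ((n + 2) choose 2)" using choose_step[of 2 n] by simp
  have 2: "2 * ((n + 2) choose 2) = (n + 2) * (n + 1)" 
    using choose_step[of 1 n] unfolding one_add_one choose_one .
  have "24 * ((n + 4) choose 4) = 6 * (4 * ((n + 4) choose 4))" by simp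
  also have "\<dots> = 2 * (n + 4) * (3 * ((n + 3) choose 3))" unfolding 4 by simp
  also have "\<dots> = (n + 4) * (n + 3) * (2 * ((n + 2) choose 2))" unfolding 3 by simp
  also have "\<dots> = (n + 1) * (n + 2) * (n + 3) * (n + 4)" unfolding 2 by (simp only: mult_ac)
  finally show ?thesis .
qed

lemma choose_5: "120 * ((n + 5) choose 5) = (n + 1) * (n + 2) * (n + 3) * (n + 4) * (n + 5)"
proof -
  have 5: "5 * ((n + 5) choose 5) = (n + 5) * ((n + 4) choose 4)" using choose_step[of 4 n] by simp
  have "120 * ((n + 5) choose 5) = 24 * (5 * ((n + 5) choose 5))" by simp
  also have "\<dots> = (n + 5) * (24 * ((n + 4) choose 4))" unfolding 5 by simp
  also have "\<dots> = (n + 1) * (n + 2) * (n + 3) * (n + 4) * (n + 5)" unfolding choose_4 by (simp only: mult_ac)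
  finally show ?thesis .
qed

lemma choose_4_real: "24 * real ((n + 4) choose 4) = (real n + 1) * (real n + 2) * (real n + 3) * (real n + 4)"
  using arg_cong[OF choose_4[of n], of real] by (simp add: algebra_simps)
lemma choose_5_real: "120 * real ((n + 5) choose 5) = (real n + 1) * (real n + 2) * (real n + 3) * (real n + 4) * (real n + 5)"
  using arg_cong[OF choose_5[of n], of real] by (simp add: algebra_simps)

text \<open>
  The next four inequalities compare the leading terms of binomial coefficients as polynomials in \<open>k\<close>:
  degree \<open>5\<close> against degree \<open>4\<close>, degree at most \<open>3\<close> against degree \<open>4\<close>, and twice
  the leading coefficient \<open>2\<^sup>4 / 4! = 16 / 4!\<close> against \<open>17 / 4!\<close> and \<open>15 / 4!\<close>.
\<close>

lemma growth_5_4: "\<exists>k. (2 * k + 4) choose 4 < (k + 5) choose 5"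
proof -
  have "eventually (\<lambda>k::nat. 5 * ((2 * real k + 1) * (2 * real k + 2) * (2 * real k + 3) * (2 * real k + 4))
     < (real k + 1) * (real k + 2) * (real k + 3) * (real k + 4) * (real k + 5)) at_top"
    by real_asymp
  then obtain k :: nat where "5 * ((2 * real k + 1) * (2 * real k + 2) * (2 * real k + 3) * (2 * real k + 4))
     < (real k + 1) * (real k + 2) * (real k + 3) * (real k + 4) * (real k + 5)"
    using eventually_happens' sequentially_bot by blast
  then have "5 * (24 * real ((2 * k + 4) choose 4)) < 120 * real ((k + 5) choose 5)"
    by (simp only: choose_4_real choose_5_real of_nat_mult of_nat_numeral)
  then show ?thesis by (intro exI[of _ k]) simp
qed

lemma growth_3_4: "r \<le> 3 \<Longrightarrow> \<exists>k. ((k + r) choose r) * D < (2 * k + 4) choose 4"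
proof -
  assume r: "r \<le> 3"
  have "eventually (\<lambda>k::nat. 24 * (real D * (real k + 3) ^ 3)
     < (2 * real k + 1) * (2 * real k + 2) * (2 * real k + 3) * (2 * real k + 4)) at_top"
    by real_asymp
  then obtain k :: nat where k: "24 * (real D * (real k + 3) ^ 3) < (2 * real k + 1) * (2 * real k + 2) * (2 * real k + 3) * (2 * real k + 4)"
    using eventually_happens' sequentially_bot by blast
  have "(k + r) choose r \<le> (k + r) ^ r" by (intro binomial_le_pow) simp
  also have "\<dots> \<le> (k + 3) ^ r" using r by (intro power_mono) auto
  also have "\<dots> \<le> (k + 3) ^ 3" using r by (intro power_increasing) auto
  finally have "real ((k + r) choose r) \<le> (real k + 3) ^ 3" by (metis of_nat_add of_nat_le_iff of_nat_numeral of_nat_power)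
  then have "real D * real ((k + r) choose r) \<le> real D * (real k + 3) ^ 3" by (intro mult_left_mono) auto
  moreover have "24 * real ((2 * k + 4) choose 4) = (2 * real k + 1) * (2 * real k + 2) * (2 * real k + 3) * (2 * real k + 4)"
    by (simp add: choose_4_real)
  ultimately have "real D * real ((k + r) choose r) < real ((2 * k + 4) choose 4)" using k by linarith
  then have "real (((k + r) choose r) * D) < real ((2 * k + 4) choose 4)" by (simp add: mult.commute)
  then show ?thesis by (intro exI[of _ k]) (simp only: of_nat_less_iff)
qed

lemma growth_17: "\<exists>k. (2 * k + c + 4) choose 4 < 17 * ((k + 4) choose 4)"
proof -
  have "eventually (\<lambda>k::nat. (2 * real k + real c + 1) * (2 * real k + real c + 2) * (2 * real k + real c + 3) * (2 * real k + real c + 4)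
     < 17 * ((real k + 1) * (real k + 2) * (real k + 3) * (real k + 4))) at_top"
    by real_asymp
  then obtain k :: nat where k: "(2 * real k + real c + 1) * (2 * real k + real c + 2) * (2 * real k + real c + 3) * (2 * real k + real c + 4)
     < 17 * ((real k + 1) * (real k + 2) * (real k + 3) * (real k + 4))"
    using eventually_happens' sequentially_bot by blast
  moreover have "24 * real ((2 * k + c + 4) choose 4) = (2 * real k + real c + 1) * (2 * real k + real c + 2) * (2 * real k + real c + 3) * (2 * real k + real c + 4)"
    using choose_4_real[of "2 * k + c"] by simp
  ultimately have "24 * real ((2 * k + c + 4) choose 4) < 17 * (24 * real ((k + 4) choose 4))" by (simp only: choose_4_real)
  then show ?thesis by (intro exI[of _ k]) simp
qed

lemma growth_15: "\<exists>k. 15 * ((k + c + 4) choose 4) < (2 * k + 4) choose 4"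
proof -
  have "eventually (\<lambda>k::nat. 15 * ((real k + real c + 1) * (real k + real c + 2) * (real k + real c + 3) * (real k + real c + 4))
     < (2 * real k + 1) * (2 * real k + 2) * (2 * real k + 3) * (2 * real k + 4)) at_top"
    by real_asymp
  then obtain k :: nat where k: "15 * ((real k + real c + 1) * (real k + real c + 2) * (real k + real c + 3) * (real k + real c + 4))
     < (2 * real k + 1) * (2 * real k + 2) * (2 * real k + 3) * (2 * real k + 4)"
    using eventually_happens' sequentially_bot by blast
  moreover have "24 * real ((k + c + 4) choose 4) = (real k + real c + 1) * (real k + real c + 2) * (real k + real c + 3) * (real k + real c + 4)"
    using choose_4_real[of "k + c"] by simp
  moreover have "24 * real ((2 * k + 4) choose 4) = (2 * real k + 1) * (2 * real k + 2) * (2 * real k + 3) * (2 * real k + 4)"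
    by (simp add: choose_4_real)
  ultimately have "15 * (24 * real ((k + c + 4) choose 4)) < 24 * real ((2 * k + 4) choose 4)" by (simp only:)
  then show ?thesis by (intro exI[of _ k]) simp
qed

text \<open>
  Modulo the quadrics a monomial with a large exponent can be written in lower degree, with quadrics as
  coefficients. So the monomials with all exponents below \<open>D\<close> generate the polynomial ring over the
  polynomials in the quadrics; homogeneity controls the degrees of the coefficients, as required for
  counting dimensions.
\<close>

lemma finitely_generated_over_quadrics:
  fixes q :: "'v \<Rightarrow> 'n::finite real_mpoly"
  assumes q: "finite V" "\<And>i. i \<in> V \<Longrightarrow> q i \<in> forms 2" and prim: "primary_to_origin (q ` V)"
  shows "\<exists>G. finite G \<and> (\<forall>k. pdeg_le k \<subseteq> span {mon_value q a * g | a g. a \<in> Mon V (k div 2) \<and> g \<in> G})"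
proof -
  obtain D0 where D0: "\<And>i. X i ^ D0 i \<in> ideal.span (q ` V)" using prim unfolding primary_to_origin_def by metis
  (* One exponent for all variables; adding 2 leaves room for splitting off a quadric. *)
  define D where "D = (\<Sum>i\<in>UNIV. D0 i) + 2"
  have D2: "D \<ge> 2" by (simp add: D_def)
  have XD: "X i ^ D \<in> ideal.span (q ` V)" for i
  proof -
    have "D0 i \<le> (\<Sum>i\<in>UNIV. D0 i)" by (rule member_le_sum) auto
    then have "D = D0 i + (D - D0 i)" by (simp add: D_def)
    then have "X i ^ D = X i ^ D0 i * X i ^ (D - D0 i)" by (metis power_add)
    then show ?thesis using D0 by (simp add: ideal_mult_right)
  qed
  define G0 where "G0 = {m :: 'n \<Rightarrow>\<^sub>0 nat. \<forall>i. Poly_Mapping.lookup m i < D}"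
  define G where "G = mon ` G0"
  have "G0 \<subseteq> Mon UNIV (CARD('n) * D)"
  proof
    fix m assume "m \<in> G0"
    then have "mdeg m \<le> (\<Sum>i\<in>(UNIV::'n set). D)" unfolding mdeg_sum[OF finite subset_UNIV]
      by (intro sum_mono) (auto simp: G0_def less_imp_le)
    then show "m \<in> Mon UNIV (CARD('n) * D)" by (simp add: Mon_def)
  qed
  then have G: "finite G" unfolding G_def by (meson finite_Mon finite finite_imageI finite_subset)
  define S where "S k = span {mon_value q a * g | a g. a \<in> Mon V (k div 2) \<and> g \<in> G}" for k
  have Smono: "S k \<subseteq> S l" if "k \<le> l" for k l
  proof -
    have "k div 2 \<le> l div 2" using that by (rule div_le_mono)
    then show ?thesis unfolding S_def by (intro span_mono) (force simp: Mon_def)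
  qed
  have Smult: "q v * f \<in> S (k + 2)" if "v \<in> V" "f \<in> S k" for v f k
    using that(2) unfolding S_def
  proof (induction f rule: span_induct_alt)
    case base then show ?case by (simp add: span_zero)
  next
    case (step c x y)
    then obtain a g where ag: "a \<in> Mon V (k div 2)" "g \<in> G" "x = mon_value q a * g" by blast
    have "q v * x = mon_value q (Poly_Mapping.single v 1 + a) * g" by (simp add: ag mult.assoc)
    moreover have "Poly_Mapping.single v 1 + a \<in> Mon V ((k + 2) div 2)"
      using ag that(1) by (auto simp: Mon_def keys_plus_nat)
    ultimately have "q v * x \<in> span {mon_value q a * g | a g. a \<in> Mon V ((k + 2) div 2) \<and> g \<in> G}"
      using ag(2) by (intro span_base) blast
    then show ?case using step by (simp add: algebra_simps span_add span_scale)
  qed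
  have mS: "mon m \<in> S (mdeg m)" for m
  proof (induction "mdeg m" arbitrary: m rule: less_induct)
    case less
    show ?case
    proof (cases "m \<in> G0")
      case True
      then have "mon_value q 0 * mon m \<in> S (mdeg m)" unfolding S_def
        using G_def by (intro span_base CollectI exI[of _ "0 :: 'v \<Rightarrow>\<^sub>0 nat"] exI[of _ "mon m"]) (simp add: Mon_def)
      then show ?thesis by simp
    next
      case False
      then obtain i where i: "Poly_Mapping.lookup m i \<ge> D" by (auto simp: G0_def not_less)
      define n where "n = m - Poly_Mapping.single i D"
      have m: "m = Poly_Mapping.single i D + n"
        by (rule poly_mapping_eqI) (use i in \<open>auto simp: n_def lookup_add lookup_minus lookup_single when_def\<close>)
      have deg: "mdeg m = D + mdeg n" by (subst m) simp
      obtain r where r: "X i ^ D = (\<Sum>b\<in>q ` V. r b * b)"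
        using XD[of i] ideal.span_finite[of "q ` V"] q(1) by auto
      have "X i ^ D = hom_component D (X i ^ D)" using forms_power[OF forms_X(1), of i D] by (simp add: hom_component_forms)
      also have "\<dots> = (\<Sum>b\<in>q ` V. hom_component ((D - 2) + 2) (b * r b))" using D2 by (simp add: r hom_component_sum mult.commute del: add_2_eq_Suc')
      also have "\<dots> = (\<Sum>b\<in>q ` V. b * hom_component (D - 2) (r b))" using q(2) by (intro sum.cong refl hom_component_mult) auto
      finally have "mon m = (\<Sum>b\<in>q ` V. b * (hom_component (D - 2) (r b) * mon n))"
        by (subst m) (simp add: mon_mult[symmetric] X_power[symmetric] sum_distrib_right mult.assoc)
      also have "\<dots> \<in> S (mdeg m)"
        unfolding S_def
      proof (rule span_sum, fold S_def)
        fix b assume "b \<in> q ` V"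
        then obtain v where v: "v \<in> V" "b = q v" by blast
        let ?h = "hom_component (D - 2) (r b) * mon n"
        have h: "?h \<in> forms (D - 2 + mdeg n)" by (intro forms_mult hom_component_in_forms) (simp add: forms_mon)
        have "?h \<in> S (D - 2 + mdeg n)"
        proof -
          have "(\<Sum>k\<in>Poly_Mapping.keys ?h. Poly_Mapping.lookup ?h k *\<^sub>R mon k) \<in> S (D - 2 + mdeg n)"
            unfolding S_def
          proof (intro span_sum span_scale, fold S_def)
            fix k assume "k \<in> Poly_Mapping.keys ?h"
            then have "mdeg k = D - 2 + mdeg n" using h by (auto simp: forms_iff)
            then show "mon k \<in> S (D - 2 + mdeg n)" using less[of k] deg D2 by simp
          qed
          then show ?thesis by (simp only: mon_expand[symmetric])
        qed
        moreover have "D - 2 + mdeg n + 2 = mdeg m" using deg D2 by simp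
        ultimately show "b * ?h \<in> S (mdeg m)" using Smult[OF v(1), of ?h "D - 2 + mdeg n"] v(2) by (simp del: add_2_eq_Suc')
      qed
      finally show ?thesis .
    qed
  qed
  have "pdeg_le k \<subseteq> S k" for k
    unfolding pdeg_le_span
  proof (rule span_minimal)
    show "mon ` Mon UNIV k \<subseteq> S k" using mS Smono by (auto simp: Mon_def)
    show "subspace (S k)" unfolding S_def by (rule subspace_span)
  qed
  then show ?thesis using G unfolding S_def by blast
qed

lemma mon_independent:
  assumes "finite I" "(\<Sum>m\<in>I. c m *\<^sub>R mon m) = 0" "m \<in> I"
  shows "c m = 0"
  using lookup_sum_mon[OF assms(1), of c m] assms(2,3) by simp

text \<open>
  With at most three quadrics the finite generation gives the polynomials of degree \<open>2 k\<close> a dimension that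
  grows at most like \<open>k\<^sup>3\<close>, whereas it grows like \<open>k\<^sup>4\<close>.
\<close>

lemma primary_quadrics_card_ge_4:
  fixes B :: "4 real_mpoly set"
  assumes B: "finite B" "B \<subseteq> forms 2" "primary_to_origin B"
  shows "card B \<ge> 4"
proof (rule ccontr)
  assume "\<not> ?thesis"
  then have r: "card B \<le> 3" by simp
  have "primary_to_origin ((\<lambda>x. x) ` B)" using B by simp
  then obtain G where G: "finite G" "\<And>k. pdeg_le k \<subseteq> span {mon_value (\<lambda>x. x) a * g | a g. a \<in> Mon B (k div 2) \<and> g \<in> G}"
    using finitely_generated_over_quadrics[of B "\<lambda>x. x"] B by blast
  obtain k where k: "((k + card B) choose (card B)) * card G < (2 * k + 4) choose 4"
    using growth_3_4[OF r] by blast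
  let ?T = "{mon_value (\<lambda>x. x) a * g | a g. a \<in> Mon B k \<and> g \<in> G}"
  have Ti: "?T = (\<lambda>(a, g). mon_value (\<lambda>x. x) a * g) ` (Mon B k \<times> G)" by auto
  have fT: "finite ?T" unfolding Ti using B G by (intro finite_imageI finite_cartesian_product) auto
  have "card ?T \<le> card (Mon B k \<times> G)" unfolding Ti using B G by (intro card_image_le finite_cartesian_product) auto
  also have "\<dots> = ((k + card B) choose (card B)) * card G" using Mon_count[OF B(1)] by (simp add: card_cartesian_product)
  also have "\<dots> < card (Mon (UNIV :: 4 set) (2 * k))" using k Mon_count[of "UNIV :: 4 set" "2 * k"] by simp
  finally have c: "card ?T < card (Mon (UNIV :: 4 set) (2 * k))" .
  have "\<exists>c. (\<exists>i\<in>Mon (UNIV :: 4 set) (2 * k). c i \<noteq> 0) \<and> (\<Sum>i\<in>Mon UNIV (2 * k). c i *\<^sub>R mon i) = 0"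
  proof (rule scaleR_span_dependent[OF fT _ c])
    fix m assume "m \<in> Mon (UNIV :: 4 set) (2 * k)"
    then have "mon m \<in> pdeg_le (2 * k)" by (auto simp: pdeg_le_def)
    then show "mon m \<in> span ?T" using G(2)[of "2 * k"] by auto
  qed simp
  then show False using mon_independent finite_Mon[OF finite] by metis
qed

text \<open>
  The products of the given polynomials with the monomials of degree at most \<open>k\<close> in the quadrics have
  degree at most \<open>2 k + c\<close>, and by \<open>k\<close> there are more of them than monomials of that degree.
\<close>

lemma dependent_over_quadrics:
  fixes q :: "'v \<Rightarrow> 4 real_mpoly" and f :: "'j \<Rightarrow> 4 real_mpoly"
  assumes V: "finite V" "\<And>i. i \<in> V \<Longrightarrow> q i \<in> forms 2"
    and J: "finite J" and c: "\<And>j. j \<in> J \<Longrightarrow> f j \<in> pdeg_le c"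
    and k: "(2 * k + c + 4) choose 4 < card J * ((k + card V) choose card V)"
  shows "\<exists>A. (\<forall>j. A j \<in> pvars V) \<and> (\<exists>j\<in>J. A j \<noteq> 0) \<and> (\<Sum>j\<in>J. psubst q (A j) * f j) = 0"
proof -
  let ?M = "Mon V k"
  have fM: "finite ?M" "card ?M = (k + card V) choose card V" using Mon_count[OF V(1)] by auto
  let ?T = "mon ` Mon (UNIV :: 4 set) (2 * k + c)"
  have "card ?T \<le> (2 * k + c + 4) choose 4"
    using card_image_le[of "Mon (UNIV :: 4 set) (2 * k + c)" mon] Mon_count[of "UNIV :: 4 set" "2 * k + c"] by simp
  also have "\<dots> < card (J \<times> ?M)" using k fM by (simp add: card_cartesian_product)
  finally have cT: "card ?T < card (J \<times> ?M)" .
  have "\<exists>d. (\<exists>i\<in>J \<times> ?M. d i \<noteq> 0) \<and> (\<Sum>i\<in>J \<times> ?M. d i *\<^sub>R (mon_value q (snd i) * f (fst i))) = 0"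
  proof (rule scaleR_span_dependent[OF _ _ cT])
    fix i assume i: "i \<in> J \<times> ?M"
    have "mon_value q (snd i) \<in> forms (2 * mdeg (snd i))"
      using i by (intro mon_value_forms[where V = V] V(2)) (auto simp: Mon_def)
    then have "mon_value q (snd i) \<in> pdeg_le (2 * mdeg (snd i))" by (rule forms_pdeg_le)
    moreover have "mdeg (snd i) \<le> k" using i by (auto simp: Mon_def)
    ultimately have "mon_value q (snd i) \<in> pdeg_le (2 * k)"
      using pdeg_le_mono[of "2 * mdeg (snd i)" "2 * k"] by auto
    moreover have "f (fst i) \<in> pdeg_le c" using c i by auto
    ultimately show "mon_value q (snd i) * f (fst i) \<in> span ?T"
      unfolding pdeg_le_span[symmetric] by (rule pdeg_le_mult)
  qed (use J fM in auto)
  then obtain d j0 a0 where d: "j0 \<in> J" "a0 \<in> ?M" "d (j0, a0) \<noteq> 0"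
    "(\<Sum>i\<in>J \<times> ?M. d i *\<^sub>R (mon_value q (snd i) * f (fst i))) = 0" by auto
  define A where "A j = (\<Sum>a\<in>?M. d (j, a) *\<^sub>R mon a)" for j
  have "Poly_Mapping.keys (A j) \<subseteq> ?M" for j
    by (auto simp: A_def in_keys_iff lookup_sum_mon[OF fM(1)] split: if_splits)
  then have "A j \<in> pvars V" for j
    by (fastforce simp: pvars_def Mon_def)
  moreover have "A j0 \<noteq> 0"
    using lookup_sum_mon[OF fM(1), of "\<lambda>a. d (j0, a)" a0] d by (auto simp: A_def)
  moreover have "(\<Sum>j\<in>J. psubst q (A j) * f j) = (\<Sum>i\<in>J \<times> ?M. d i *\<^sub>R (mon_value q (snd i) * f (fst i)))"
    by (simp add: A_def psubst_sum_distrib psubst_scaleR sum_distrib_right sum.cartesian_product case_prod_beta)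
  ultimately show ?thesis using d(1,4) by (intro exI[of _ A] conjI) auto
qed

text \<open>
  Five quadrics in four variables would be algebraically dependent.
\<close>

lemma minimal_primary_card:
  fixes W :: "4 real_mpoly set"
  assumes min: "minimal_primary_quadrics W B" and W: "subspace W" "W \<subseteq> forms 2"
  shows "card B = 4"
proof -
  have B: "finite B" "B \<subseteq> forms 2" "primary_to_origin B"
    using min W by (auto simp: minimal_primary_quadrics_def)
  have "card B < 5"
  proof (rule ccontr)
    assume "\<not> ?thesis"
    then have "5 \<le> card B" by simp
    then obtain B0 where B0: "B0 \<subseteq> B" "card B0 = 5" "finite B0" by (rule obtain_subset_with_card_n)
    then obtain q where q: "bij_betw q {..<5::nat} B0" using ex_bij_betw_nat_finite[of B0] B0 by (auto simp: atLeast0LessThan)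
    obtain k where k: "(2 * k + 4) choose 4 < (k + 5) choose 5" using growth_5_4 by blast
    have q2: "q i \<in> forms 2" if "i \<in> {..<5}" for i using q B B0 that by (auto simp: bij_betw_def)
    have "(2 * k + 0 + 4) choose 4 < card {()} * ((k + card {..<5::nat}) choose card {..<5::nat})"
      using k by simp
    from dependent_over_quadrics[where q = q and J = "{()}" and f = "\<lambda>_. 1", OF finite_lessThan q2 finite forms_pdeg_le[OF forms_1] this]
    obtain A :: "unit \<Rightarrow> _" where "\<forall>j. A j \<in> pvars {..<5::nat}" "\<exists>j\<in>{()}. A j \<noteq> 0" "(\<Sum>j\<in>{()}. psubst q (A j) * 1) = 0"
      by blast
    then have P: "A () \<in> pvars {..<5::nat}" "A () \<noteq> 0" "psubst q (A ()) = 0" by simp_all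
    have "A () = 0" using q B0 P by (intro minimal_primary_independent[OF min W, of q "{..<5}"]) (auto simp: bij_betw_def)
    with P show False by simp
  qed
  with primary_quadrics_card_ge_4[OF B] show ?thesis by simp
qed

section \<open>Rank sixteen over four quadrics\<close>

text \<open>
  Linear independence over the polynomials in the \<open>q i\<close>.
\<close>

definition poly_indep :: "('v \<Rightarrow> 'a::{real_algebra_1,comm_ring_1}) \<Rightarrow> 'a set \<Rightarrow> bool" where
  "poly_indep q E \<longleftrightarrow> (\<forall>A. (\<Sum>e\<in>E. psubst q (A e) * e) = 0 \<longrightarrow> (\<forall>e\<in>E. A e = 0))"

text \<open>
  \<open>E\<close> is a maximal independent subset of a finite generating set and \<open>s\<close> a common denominator: over the
  field of fractions of the polynomials in the quadrics, \<open>E\<close> is a basis of the polynomials in four variables.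
  Its size \<open>16 = 2\<^sup>4\<close> comes from comparing dimensions in degree \<open>2 k\<close>: with at most \<open>15\<close> elements
  \<open>E\<close> would generate too little, and \<open>17\<close> polynomials are always dependent.
\<close>

lemma generic_basis:
  fixes q :: "4 \<Rightarrow> 4 real_mpoly"
  assumes q: "\<And>i. q i \<in> forms 2" and prim: "primary_to_origin (range q)"
    and indep: "\<And>P :: 4 real_mpoly. psubst q P = 0 \<Longrightarrow> P = 0"
  shows "\<exists>E s. finite E \<and> card E = 16 \<and> poly_indep q E \<and> s \<noteq> 0 \<and>
     (\<forall>f. \<exists>A. psubst q s * f = (\<Sum>e\<in>E. psubst q (A e) * e))"
proof -
  from finitely_generated_over_quadrics[of UNIV q, OF finite q prim]
  obtain G where G': "finite G \<and> (\<forall>k. pdeg_le k \<subseteq> span {mon_value q a * g | a g. a \<in> Mon UNIV (k div 2) \<and> g \<in> G})"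
    by (elim exE)
  have G: "finite G" "\<And>k. pdeg_le k \<subseteq> span {mon_value q a * g | a g. a \<in> Mon UNIV (k div 2) \<and> g \<in> G}"
    using G' by simp_all
  have "poly_indep q {}" by (simp add: poly_indep_def)
  then have "\<exists>E. E \<subseteq> G \<and> poly_indep q E" by blast
  moreover have "card E < Suc (card G)" if "E \<subseteq> G \<and> poly_indep q E" for E
    using card_mono[OF G(1)] that by (simp add: le_imp_less_Suc)
  ultimately have "\<exists>E. (E \<subseteq> G \<and> poly_indep q E) \<and> (\<forall>E'. E' \<subseteq> G \<and> poly_indep q E' \<longrightarrow> card E' \<le> card E)"
    by (elim exE) (rule ex_has_greatest_nat, assumption, blast)
  then obtain E where E: "E \<subseteq> G" "poly_indep q E" and max: "\<And>E'. E' \<subseteq> G \<Longrightarrow> poly_indep q E' \<Longrightarrow> card E' \<le> card E"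
    by auto
  have fE: "finite E" using E G finite_subset by blast
  define M where "M = range (\<lambda>A. \<Sum>e\<in>E. psubst q (A e) * e)"
  have M_I: "x \<in> M" if "x = (\<Sum>e\<in>E. psubst q (A e) * e)" for x A
    unfolding M_def by (rule range_eqI[where x = A]) (rule that)
  have M_add: "x + y \<in> M" if "x \<in> M" "y \<in> M" for x y
  proof -
    obtain A A' where "x = (\<Sum>e\<in>E. psubst q (A e) * e)" "y = (\<Sum>e\<in>E. psubst q (A' e) * e)" using \<open>x \<in> M\<close> \<open>y \<in> M\<close> by (auto simp: M_def)
    then have "x + y = (\<Sum>e\<in>E. psubst q (A e + A' e) * e)" by (simp add: psubst_add algebra_simps sum.distrib)
    then show ?thesis by (rule M_I)
  qed
  have M_mult: "psubst q P * x \<in> M" if "x \<in> M" for P x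
  proof -
    obtain A where "x = (\<Sum>e\<in>E. psubst q (A e) * e)" using \<open>x \<in> M\<close> by (auto simp: M_def)
    then have "psubst q P * x = (\<Sum>e\<in>E. psubst q (P * A e) * e)" by (simp add: psubst_mult sum_distrib_left mult.assoc)
    then show ?thesis by (rule M_I)
  qed
  have M_base: "e \<in> M" if "e \<in> E" for e
  proof -
    have "(\<Sum>e'\<in>E. psubst q (if e' = e then 1 else 0) * e') = (\<Sum>e'\<in>E. if e' = e then e else 0)"
      by (intro sum.cong) auto
    also have "\<dots> = e" using fE that by simp
    finally show ?thesis by (intro M_I[where A = "\<lambda>e'. if e' = e then 1 else 0"]) simp
  qed
  have "\<exists>t. t \<noteq> 0 \<and> psubst q t * g \<in> M" if g: "g \<in> G" for g
  proof (cases "g \<in> E")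
    case True then show ?thesis using M_base by (intro exI[of _ 1]) auto
  next
    case False
    have "\<not> poly_indep q (insert g E)"
    proof
      assume "poly_indep q (insert g E)"
      then have "card (insert g E) \<le> card E" using g E by (intro max) auto
      then show False using False fE by simp
    qed
    then obtain A where A: "(\<Sum>e\<in>insert g E. psubst q (A e) * e) = 0" "\<exists>e\<in>insert g E. A e \<noteq> 0"
      by (auto simp: poly_indep_def)
    have sum: "psubst q (A g) * g + (\<Sum>e\<in>E. psubst q (A e) * e) = 0" using A(1) False fE by simp
    have "A g \<noteq> 0"
    proof
      assume "A g = 0"
      then have "(\<Sum>e\<in>E. psubst q (A e) * e) = 0" using sum by simp
      then show False using E(2) A(2) \<open>A g = 0\<close> by (auto simp: poly_indep_def)
    qed
    moreover have "psubst q (A g) * g = (\<Sum>e\<in>E. psubst q (- A e) * e)"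
      using sum by (simp add: psubst_minus sum_negf eq_neg_iff_add_eq_0)
    then have "psubst q (A g) * g \<in> M" by (rule M_I)
    ultimately show ?thesis by blast
  qed
  then obtain t where t: "\<And>g. g \<in> G \<Longrightarrow> t g \<noteq> 0 \<and> psubst q (t g) * g \<in> M" by metis
  define s where "s = (\<Prod>g\<in>G. t g)"
  have s0: "s \<noteq> 0" using t G by (simp add: s_def)
  have sG: "psubst q s * g \<in> M" if g: "g \<in> G" for g
  proof -
    have "s = (\<Prod>g\<in>G - {g}. t g) * t g" using G g by (simp add: s_def prod.remove[of G g] mult.commute)
    then have "psubst q s * g = psubst q (\<Prod>g\<in>G - {g}. t g) * (psubst q (t g) * g)" by (simp add: psubst_mult mult.assoc)
    then show ?thesis using M_mult t g by metis
  qed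
  obtain A where A: "\<And>g. g \<in> G \<Longrightarrow> psubst q s * g = (\<Sum>e\<in>E. psubst q (A g e) * e)"
  proof -
    have "\<forall>g\<in>G. \<exists>A. psubst q s * g = (\<Sum>e\<in>E. psubst q (A e) * e)" using sG by (auto simp: M_def)
    from bchoice[OF this] show ?thesis using that by blast
  qed
  obtain dg where dg: "\<And>P :: 4 real_mpoly. P \<in> pdeg_le (dg P)" using pdeg_le_exists by metis
  (* A bound for the degrees of all coefficients in the expansions of the generators. *)
  define c where "c = (\<Sum>g\<in>G. \<Sum>e\<in>E. dg (A g e))"
  have Ac: "A g e \<in> pdeg_le c" if "g \<in> G" "e \<in> E" for g e
  proof -
    have "dg (A g e) \<le> (\<Sum>e\<in>E. dg (A g e))" using that fE by (intro member_le_sum) auto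
    also have "\<dots> \<le> c" unfolding c_def using that G by (intro member_le_sum) auto
    finally show ?thesis using dg pdeg_le_mono by blast
  qed
  have sM: "\<exists>A. psubst q s * f = (\<Sum>e\<in>E. psubst q (A e) * e)" for f
  proof -
    obtain k where k: "f \<in> pdeg_le k" using pdeg_le_exists by blast
    have "f \<in> span {mon_value q a * g | a g. a \<in> Mon UNIV (k div 2) \<and> g \<in> G}" using G(2) k by blast
    then have "psubst q s * f \<in> M"
    proof (induction f rule: span_induct_alt)
      case base
      show ?case by (rule M_I[where A = "\<lambda>_. 0"]) simp
    next
      case (step d x y)
      then obtain a g where ag: "g \<in> G" "x = mon_value q a * g" by blast
      have "psubst q s * (d *\<^sub>R x + y) = psubst q (d *\<^sub>R mon a) * (psubst q s * g) + psubst q s * y"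
        by (simp add: ag psubst_scaleR algebra_simps)
      then show ?case using M_add M_mult sG ag step by simp
    qed
    then show ?thesis by (auto simp: M_def)
  qed
  have ge: "card E \<ge> 16"
  proof (rule ccontr)
    assume "\<not> ?thesis"
    then have c15: "card E \<le> 15" by simp
    obtain k where k: "15 * ((k + c + 4) choose 4) < (2 * k + 4) choose 4" using growth_15 by blast
    define T where "T = (\<lambda>(b, e). mon_value q b * e) ` (Mon (UNIV :: 4 set) (k + c) \<times> E)"
    have fT: "finite T" unfolding T_def using fE by (intro finite_imageI finite_cartesian_product) auto
    have "card T \<le> card (Mon (UNIV :: 4 set) (k + c) \<times> E)" unfolding T_def using fE by (intro card_image_le finite_cartesian_product) auto
    also have "\<dots> = ((k + c + 4) choose 4) * card E" using Mon_count[of "UNIV :: 4 set" "k + c"] by (simp add: card_cartesian_product)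
    also have "\<dots> \<le> 15 * ((k + c + 4) choose 4)" using c15 by simp
    also have "\<dots> < card (Mon (UNIV :: 4 set) (2 * k))" using k Mon_count[of "UNIV :: 4 set" "2 * k"] by simp
    finally have cT: "card T < card (Mon (UNIV :: 4 set) (2 * k))" .
    have inT: "psubst q P * e \<in> span T" if "P \<in> pdeg_le (k + c)" "e \<in> E" for P e
    proof -
      have "psubst q P * e = (\<Sum>m\<in>Poly_Mapping.keys P. Poly_Mapping.lookup P m *\<^sub>R (mon_value q m * e))"
        by (simp add: psubst_def sum_distrib_right)
      also have "\<dots> \<in> span T"
        using that by (intro span_sum span_scale span_base) (auto simp: T_def pdeg_le_def)
      finally show ?thesis .
    qed
    have sT: "psubst q s * f \<in> span T" if f: "f \<in> pdeg_le (2 * k)" for f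
    proof -
      have "f \<in> span {mon_value q a * g | a g. a \<in> Mon UNIV k \<and> g \<in> G}" using G(2)[of "2 * k"] f by auto
      then show ?thesis
      proof (induction f rule: span_induct_alt)
        case base then show ?case by (simp add: span_zero)
      next
        case (step d x y)
        then obtain a g where ag: "a \<in> Mon UNIV k" "g \<in> G" "x = mon_value q a * g" by blast
        have "psubst q s * x = mon_value q a * (psubst q s * g)" by (simp add: ag mult_ac)
        also have "\<dots> = (\<Sum>e\<in>E. psubst q (mon a * A g e) * e)" by (simp add: A[OF ag(2)] sum_distrib_left psubst_mult mult.assoc)
        also have "\<dots> \<in> span T"
        proof (intro span_sum inT)
          fix e assume "e \<in> E"
          then show "mon a * A g e \<in> pdeg_le (k + c)"
            using Ac[OF ag(2)] ag(1) by (intro pdeg_le_mult) (auto simp: pdeg_le_def)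
        qed
        finally show ?case using step by (simp add: algebra_simps span_add span_scale)
      qed
    qed
    have "\<exists>d. (\<exists>m\<in>Mon (UNIV :: 4 set) (2 * k). d m \<noteq> 0) \<and> (\<Sum>m\<in>Mon UNIV (2 * k). d m *\<^sub>R (psubst q s * mon m)) = 0"
      by (rule scaleR_span_dependent[OF fT _ cT]) (auto intro!: sT simp: pdeg_le_def)
    then obtain d m where d: "m \<in> Mon (UNIV :: 4 set) (2 * k)" "d m \<noteq> 0" "(\<Sum>m\<in>Mon UNIV (2 * k). d m *\<^sub>R (psubst q s * mon m)) = 0" by blast
    have "psubst q s * (\<Sum>m\<in>Mon UNIV (2 * k). d m *\<^sub>R mon m) = 0" using d(3) by (simp add: sum_distrib_left)
    moreover have "psubst q s \<noteq> 0" using indep s0 by blast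
    ultimately have "(\<Sum>m\<in>Mon UNIV (2 * k). d m *\<^sub>R mon m) = 0" by simp
    then show False using mon_independent[OF finite_Mon[OF finite]] d by blast
  qed
  have le: "card E \<le> 16"
  proof (rule ccontr)
    assume "\<not> ?thesis"
    then have c17: "17 \<le> card E" by simp
    define c where "c = (\<Sum>e\<in>E. dg e)"
    have ec: "e \<in> pdeg_le c" if "e \<in> E" for e
    proof -
      have "dg e \<le> c" unfolding c_def using that fE by (intro member_le_sum) auto
      then show ?thesis using dg pdeg_le_mono by blast
    qed
    obtain k where k: "(2 * k + c + 4) choose 4 < 17 * ((k + 4) choose 4)" using growth_17 by blast
    also have "\<dots> \<le> card E * ((k + 4) choose 4)" using c17 by simp
    finally have "(2 * k + c + 4) choose 4 < card E * ((k + card (UNIV :: 4 set)) choose card (UNIV :: 4 set))" by simp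
    from dependent_over_quadrics[of UNIV q E "\<lambda>e. e", OF finite q fE ec this]
    obtain A where "\<exists>e\<in>E. A e \<noteq> 0" "(\<Sum>e\<in>E. psubst q (A e) * e) = 0" by blast
    then show False using E(2) by (auto simp: poly_indep_def)
  qed
  show ?thesis using fE ge le E(2) s0 sM by (intro exI[of _ E] exI[of _ s]) auto
qed

text \<open>
  The seventeen powers \<open>u\<^sup>0, \<dots>, u\<^sup>1\<^sup>6\<close> are dependent.
\<close>

lemma algebraic_over_quadrics:
  fixes q :: "4 \<Rightarrow> 4 real_mpoly"
  assumes q: "\<And>i. q i \<in> forms 2"
  shows "\<exists>\<Phi> :: 4 real_mpoly poly. \<Phi> \<noteq> 0 \<and> (\<Sum>j\<le>degree \<Phi>. psubst q (coeff \<Phi> j) * u ^ j) = 0"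
proof -
  obtain d where d: "u \<in> pdeg_le d" using pdeg_le_exists by blast
  have uj: "u ^ j \<in> pdeg_le (d * j)" for j
  proof (induction j)
    case 0 then show ?case using forms_pdeg_le[OF forms_1] by simp
  next
    case (Suc j) then show ?case using pdeg_le_mult[OF d Suc] by (simp add: algebra_simps)
  qed
  have c: "u ^ j \<in> pdeg_le (d * 16)" if "j \<in> {..<17}" for j
    using uj[of j] pdeg_le_mono[of "d * j" "d * 16"] that by auto
  obtain k where k: "(2 * k + d * 16 + 4) choose 4 < 17 * ((k + 4) choose 4)" using growth_17 by blast
  then have "(2 * k + d * 16 + 4) choose 4 < card {..<17::nat} * ((k + card (UNIV :: 4 set)) choose card (UNIV :: 4 set))" by simp
  from dependent_over_quadrics[of UNIV q "{..<17}" "\<lambda>j. u ^ j", OF finite q _ c this]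
  obtain A j where A: "j < 17" "A j \<noteq> 0" "(\<Sum>j<17. psubst q (A j) * u ^ j) = 0" by auto
  define \<Phi> where "\<Phi> = (\<Sum>j<17. monom (A j) j)"
  have co: "coeff \<Phi> j = (if j < 17 then A j else 0)" for j
    by (simp add: \<Phi>_def coeff_sum)
  have "\<Phi> \<noteq> 0" using co[of j] A by auto
  moreover have "(\<Sum>j\<le>degree \<Phi>. psubst q (coeff \<Phi> j) * u ^ j) = (\<Sum>j<17. psubst q (coeff \<Phi> j) * u ^ j)"
  proof (rule sum.mono_neutral_left)
    show "{..degree \<Phi>} \<subseteq> {..<17}"
    proof
      fix i assume "i \<in> {..degree \<Phi>}"
      moreover have "degree \<Phi> \<le> 16" by (rule degree_le) (simp add: co)
      ultimately show "i \<in> {..<17}" by simp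
    qed
  qed (auto simp: coeff_eq_0)
  ultimately show ?thesis using A(3) by (auto simp: co)
qed

section \<open>The Jacobian and the branch locus\<close>

lemma psubst_of_real: "psubst (\<lambda>i. of_real (y i)) f = (of_real (psubst y f) :: 'a::{real_algebra_1,comm_ring_1})"
proof -
  have "mon_value (\<lambda>i. of_real (y i) :: 'a) m = of_real (mon_value y m)" for m
    by (simp add: mon_value_def)
  then show ?thesis by (simp add: psubst_def scaleR_conv_of_real)
qed

lemma psubst_scalars: "psubst (\<lambda>i. y i *\<^sub>R 1) f = (psubst y f *\<^sub>R 1 :: 'a::{real_algebra_1,comm_ring_1})"
  using psubst_of_real[of y f] by (simp add: of_real_def)

text \<open>
  The Jacobian determinant of the quadrics with matrices \<open>M l\<close>, up to the factor \<open>2\<^sup>n\<close>.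
\<close>

definition jacobian_form :: "('n \<Rightarrow> real^'n^'n) \<Rightarrow> 'n::finite real_mpoly" where
  "jacobian_form M = det (\<chi> l i. \<Sum>j\<in>UNIV. (M l $ i $ j) *\<^sub>R X j)"

lemma psubst_det:
  fixes g :: "'v \<Rightarrow> 'a::{real_algebra_1,comm_ring_1}" and A :: "(('v \<Rightarrow>\<^sub>0 nat) \<Rightarrow>\<^sub>0 real) ^ 'n ^ 'n"
  shows "psubst g (det A) = det (\<chi> i j. psubst g (A $ i $ j))"
proof -
  have "psubst g (of_int (sign p)) = (of_int (sign p) :: 'a)" for p :: "'n \<Rightarrow> 'n"
    by (cases rule: sign_cases[of p]) (auto simp: psubst_minus)
  then show ?thesis by (simp add: det_def psubst_sum_distrib psubst_mult psubst_prod)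
qed

lemma psubst_jacobian_form: "psubst g (jacobian_form M) = det (\<chi> l i. \<Sum>j\<in>UNIV. (M l $ i $ j) *\<^sub>R g j)"
  by (simp add: jacobian_form_def psubst_det psubst_sum_distrib psubst_scaleR)

text \<open>
  The value at \<open>u\<close> of the polynomial in one variable obtained from \<open>\<Phi>\<close> by substituting \<open>q\<close> into its coefficients.
\<close>

definition rel_value :: "('v \<Rightarrow> 'a::{real_algebra_1,comm_ring_1}) \<Rightarrow> (('v \<Rightarrow>\<^sub>0 nat) \<Rightarrow>\<^sub>0 real) poly \<Rightarrow> 'a \<Rightarrow> 'a" where
  "rel_value q \<Phi> u = (\<Sum>j\<le>degree \<Phi>. psubst q (coeff \<Phi> j) * u ^ j)"

lemma rel_value_bound: "degree \<Phi> \<le> N \<Longrightarrow> rel_value q \<Phi> u = (\<Sum>j\<le>N. psubst q (coeff \<Phi> j) * u ^ j)"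
  unfolding rel_value_def by (intro sum.mono_neutral_left) (auto simp: coeff_eq_0)

definition dir_deriv :: "('n \<Rightarrow> real) \<Rightarrow> ('n \<Rightarrow> real) \<Rightarrow> 'n::finite real_mpoly \<Rightarrow> real" where
  "dir_deriv x w f = deriv (\<lambda>t. psubst (\<lambda>i. x i + t * w i) f) 0"

lemma dir_deriv: "((\<lambda>t. psubst (\<lambda>i. x i + t * w i) f) has_real_derivative dir_deriv x w f) (at 0)"
proof -
  have "(\<lambda>t. psubst (\<lambda>i. x i + t * w i) f) differentiable (at 0)"
    by (induction f rule: mpoly_mult_induct) (auto simp: psubst_scaleR psubst_add psubst_mult)
  then show ?thesis unfolding dir_deriv_def by (simp add: DERIV_deriv_iff_real_differentiable)
qed

lemma dir_deriv_eqI: "((\<lambda>t. psubst (\<lambda>i. x i + t * w i) f) has_real_derivative d) (at 0) \<Longrightarrow> dir_deriv x w f = d"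
  unfolding dir_deriv_def by (rule DERIV_imp_deriv)

lemma dir_deriv_X: "dir_deriv x w (X i) = w i"
  by (rule dir_deriv_eqI) (auto intro!: derivative_eq_intros)
lemma dir_deriv_add: "dir_deriv x w (f + g) = dir_deriv x w f + dir_deriv x w g"
  by (rule dir_deriv_eqI) (unfold psubst_add, intro DERIV_add dir_deriv)
lemma dir_deriv_const: "dir_deriv x w (c *\<^sub>R 1) = 0"
  by (rule dir_deriv_eqI) (auto simp: psubst_scaleR)
lemma dir_deriv_mult: "dir_deriv x w (f * g) = dir_deriv x w f * psubst x g + psubst x f * dir_deriv x w g"
  by (rule dir_deriv_eqI) (use DERIV_mult[OF dir_deriv[of x w f] dir_deriv[of x w g]] in \<open>simp add: psubst_mult mult.commute\<close>)
lemma dir_deriv_scaleR: "dir_deriv x w (c *\<^sub>R f) = c * dir_deriv x w f"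
  using dir_deriv_mult[of x w "c *\<^sub>R 1" f] by (simp add: dir_deriv_const psubst_scaleR)
lemma dir_deriv_sum: "dir_deriv x w (sum f A) = (\<Sum>a\<in>A. dir_deriv x w (f a))"
  using dir_deriv_const[of x w 0] by (induction A rule: infinite_finite_induct) (auto simp: dir_deriv_add)
lemma dir_deriv_power: "dir_deriv x w (f ^ j) = of_nat j * psubst x f ^ (j - 1) * dir_deriv x w f"
proof (induction j)
  case 0 then show ?case using dir_deriv_const[of x w 1] by simp
next
  case (Suc j)
  then show ?case by (cases j) (simp_all add: dir_deriv_mult psubst_mult psubst_power algebra_simps)
qed

lemma dir_deriv_psubst_0:
  assumes "\<And>l. dir_deriv x w (q l) = 0"
  shows "dir_deriv x w (psubst q P) = 0"
  by (induction P rule: mpoly_mult_induct)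
    (simp_all add: assms psubst_scaleR psubst_add psubst_mult dir_deriv_add dir_deriv_mult dir_deriv_const)

lemma rel_value_pderiv:
  fixes q :: "'v::linorder \<Rightarrow> 'a::{real_algebra_1,comm_ring_1}"
  shows "rel_value q (pderiv \<Phi>) u = (\<Sum>j\<le>degree \<Phi>. psubst q (coeff \<Phi> j) * (of_nat j * u ^ (j - 1)))"
proof (cases "degree \<Phi>")
  case 0
  then obtain c where "\<Phi> = [:c:]" using degree_eq_zeroE by blast
  then show ?thesis by (simp add: rel_value_def pderiv_pCons)
next
  case (Suc n)
  have nat: "psubst q (of_nat j) = of_nat j" for j by (induction j) (auto simp: psubst_add)
  have "degree (pderiv \<Phi>) \<le> n" by (rule degree_le) (auto simp: coeff_pderiv coeff_eq_0 Suc)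
  then have "rel_value q (pderiv \<Phi>) u = (\<Sum>j\<le>n. psubst q (coeff (pderiv \<Phi>) j) * u ^ j)" by (rule rel_value_bound)
  also have "\<dots> = (\<Sum>j\<le>n. psubst q (coeff \<Phi> (Suc j)) * (of_nat (Suc j) * u ^ j))"
    by (intro sum.cong refl) (simp only: coeff_pderiv psubst_mult nat mult_ac)
  also have "\<dots> = (\<Sum>j\<le>Suc n. psubst q (coeff \<Phi> j) * (of_nat j * u ^ (j - 1)))"
    by (subst sum.atMost_Suc_shift) simp
  finally show ?thesis by (simp add: Suc)
qed

text \<open>
  Suppose that the Jacobian vanishes identically. Then at every point \<open>x\<close> there is a direction \<open>w \<noteq> 0\<close> in
  which all \<open>q\<^sub>l\<close>, and hence all polynomials in them, have derivative zero. Differentiating a relation of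
  minimal degree for \<open>x\<^sub>i\<close> over the quadrics gives \<open>\<Psi>\<^sub>i x \<cdot> w\<^sub>i = 0\<close>, where \<open>\<Psi>\<^sub>i\<close> is the value of its derivative at \<open>x\<^sub>i\<close>.
  So the product of the \<open>\<Psi>\<^sub>i\<close> vanishes at every point, although no factor is zero, by minimality.
\<close>

lemma jacobian_form_nonzero:
  fixes q :: "4 \<Rightarrow> 4 real_mpoly"
  assumes q: "\<And>l. q l = quad_form (M l)" "\<And>l. transpose (M l) = M l"
    and indep: "\<And>P :: 4 real_mpoly. psubst q P = 0 \<Longrightarrow> P = 0"
  shows "jacobian_form M \<noteq> 0"
proof
  assume J0: "jacobian_form M = 0"
  have "\<exists>\<Phi>. (\<Phi> \<noteq> 0 \<and> rel_value q \<Phi> (X i) = 0) \<and> (\<forall>\<Psi>. \<Psi> \<noteq> 0 \<and> rel_value q \<Psi> (X i) = 0 \<longrightarrow> degree \<Phi> \<le> degree \<Psi>)" for i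
  proof -
    have "q l \<in> forms 2" for l by (simp add: q(1) quad_form_forms)
    from algebraic_over_quadrics[of q "X i", OF this]
    obtain \<Phi> where "\<Phi> \<noteq> 0 \<and> rel_value q \<Phi> (X i) = 0" unfolding rel_value_def by blast
    then show ?thesis by (rule ex_has_least_nat)
  qed
  then obtain \<Phi> where \<Phi>: "\<And>i. \<Phi> i \<noteq> 0" "\<And>i. rel_value q (\<Phi> i) (X i) = 0"
    and least: "\<And>i \<Psi>. \<Psi> \<noteq> 0 \<Longrightarrow> rel_value q \<Psi> (X i) = 0 \<Longrightarrow> degree (\<Phi> i) \<le> degree \<Psi>" by metis
  define \<Psi> where "\<Psi> i = rel_value q (pderiv (\<Phi> i)) (X i)" for i
  have \<Psi>0: "\<Psi> i \<noteq> 0" for i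
  proof
    assume z: "\<Psi> i = 0"
    have "degree (\<Phi> i) \<noteq> 0"
    proof
      assume d: "degree (\<Phi> i) = 0"
      then have "psubst q (coeff (\<Phi> i) 0) = 0" using \<Phi>(2)[of i] by (simp add: rel_value_def)
      then have "lead_coeff (\<Phi> i) = 0" using indep d by simp
      then show False using \<Phi>(1) by simp
    qed
    then obtain n where n: "degree (\<Phi> i) = Suc n" using not0_implies_Suc by blast
    have "degree (pderiv (\<Phi> i)) \<le> n" by (rule degree_le) (auto simp: coeff_pderiv coeff_eq_0 n)
    moreover have "coeff (pderiv (\<Phi> i)) n \<noteq> 0"
    proof -
      have "coeff (\<Phi> i) (Suc n) \<noteq> 0" using \<Phi>(1)[of i] n by (metis leading_coeff_0_iff)
      then show ?thesis unfolding coeff_pderiv by (simp del: of_nat_Suc)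
    qed
    then have "pderiv (\<Phi> i) \<noteq> 0" by auto
    ultimately show False using least[of "pderiv (\<Phi> i)" i] z n by (simp add: \<Psi>_def)
  qed
  have vanish: "psubst (\<lambda>i. x $ i) (\<Prod>i\<in>UNIV. \<Psi> i) = 0" for x :: "real^4"
  proof -
    define A where "A = (\<chi> l i. \<Sum>j\<in>UNIV. (M l $ i $ j) * x $ j)"
    have "det A = psubst (\<lambda>i. x $ i) (jacobian_form M)" by (simp add: psubst_jacobian_form A_def)
    then have "det A = 0" by (simp add: J0)
    then have "\<not> invertible A" by (simp add: invertible_det_nz)
    then obtain w where w: "A *v w = 0" "w \<noteq> 0"
      using matrix_left_invertible_ker[of A] by (auto simp: invertible_left_inverse)
    have "dir_deriv (($) x) (($) w) (q l) = 0" for l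
    proof -
      have sym: "M l $ i $ j = M l $ j $ i" for i j 
        using arg_cong[OF q(2)[of l], of "\<lambda>A. A $ j $ i"] by (simp add: transpose_def)
      have "dir_deriv (($) x) (($) w) (q l) = (\<Sum>i\<in>UNIV. \<Sum>j\<in>UNIV. M l $ i $ j * (w $ i * x $ j)) + (\<Sum>i\<in>UNIV. \<Sum>j\<in>UNIV. M l $ i $ j * (x $ i * w $ j))"
        by (simp add: q quad_form_def dir_deriv_sum dir_deriv_scaleR dir_deriv_mult dir_deriv_X distrib_left sum.distrib)
      also have "(\<Sum>i\<in>UNIV. \<Sum>j\<in>UNIV. M l $ i $ j * (x $ i * w $ j)) = (\<Sum>i\<in>UNIV. \<Sum>j\<in>UNIV. M l $ i $ j * (w $ i * x $ j))"
        by (subst sum.swap) (intro sum.cong refl, subst sym, simp)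
      also have "(\<Sum>i\<in>UNIV. \<Sum>j\<in>UNIV. M l $ i $ j * (w $ i * x $ j)) = (A *v w) $ l"
        by (simp add: A_def matrix_vector_mult_def sum_distrib_left sum_distrib_right mult_ac)
      finally show ?thesis using w by simp
    qed
    note q0 = dir_deriv_psubst_0[OF this]
    obtain i where i: "w $ i \<noteq> 0" using w(2) by (auto simp: vec_eq_iff)
    have "0 = dir_deriv (($) x) (($) w) (rel_value q (\<Phi> i) (X i))" using dir_deriv_const[of _ _ 0] by (simp add: \<Phi>)
    also have "\<dots> = (\<Sum>j\<le>degree (\<Phi> i). psubst (($) x) (psubst q (coeff (\<Phi> i) j)) * (of_nat j * x $ i ^ (j - 1) * w $ i))"
      by (simp add: rel_value_def dir_deriv_sum dir_deriv_mult q0 dir_deriv_power dir_deriv_X)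
    also have "\<dots> = psubst (($) x) (\<Psi> i) * w $ i"
    proof -
      have nat: "psubst (($) x) (of_nat j) = of_nat j" for j by (induction j) (auto simp: psubst_add)
      show ?thesis
        by (simp add: \<Psi>_def rel_value_pderiv psubst_sum_distrib psubst_mult psubst_power nat sum_distrib_right mult.assoc)
    qed
    finally have "psubst (($) x) (\<Psi> i) = 0" using i by simp
    then show ?thesis by (auto simp: psubst_prod)
  qed
  have "(\<Prod>i\<in>UNIV. \<Psi> i) = 0" by (rule psubst_ext) (simp add: vanish)
  then show False using \<Psi>0 by simp
qed

text \<open>
  Dividing an algebraic relation for \<open>J\<close> over the quadrics by a power of \<open>J\<close> makes its constant term \<open>P\<close> nonzero.
  Where \<open>J\<close> vanishes, only this term of the relation remains.
\<close>

lemma branch_polynomial: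
  fixes q :: "4 \<Rightarrow> 4 real_mpoly" and J :: "4 real_mpoly"
  assumes q: "\<And>l. q l \<in> forms 2" and J: "J \<noteq> 0"
  shows "\<exists>P :: 4 real_mpoly. P \<noteq> 0 \<and> (\<forall>y (z :: 4 \<Rightarrow> complex). (\<forall>l. psubst z (q l) = of_real (y l)) \<longrightarrow> psubst z J = 0 \<longrightarrow> psubst y P = 0)"
proof -
  obtain \<Phi> where \<Phi>: "\<Phi> \<noteq> 0" "rel_value q \<Phi> J = 0"
    using algebraic_over_quadrics[of q J, OF q] unfolding rel_value_def by blast
  define k where "k = (LEAST j. coeff \<Phi> j \<noteq> 0)"
  have "coeff \<Phi> (degree \<Phi>) \<noteq> 0" using \<Phi>(1) by simp
  then have k: "coeff \<Phi> k \<noteq> 0" unfolding k_def by (rule LeastI)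
  have k2: "coeff \<Phi> j = 0" if "j < k" for j using not_less_Least that unfolding k_def by blast
  define R where "R = (\<Sum>j\<le>degree \<Phi>. psubst q (coeff \<Phi> (j + k)) * J ^ j)"
  have "J ^ k * R = (\<Sum>j\<le>degree \<Phi>. psubst q (coeff \<Phi> (j + k)) * J ^ (j + k))"
    by (simp add: R_def sum_distrib_left power_add mult_ac)
  also have "\<dots> = (\<Sum>j\<in>{k..degree \<Phi> + k}. psubst q (coeff \<Phi> j) * J ^ j)"
    by (rule sum.reindex_bij_witness[of _ "\<lambda>j. j - k" "\<lambda>j. j + k"]) auto
  also have "\<dots> = (\<Sum>j\<le>degree \<Phi> + k. psubst q (coeff \<Phi> j) * J ^ j)"
    by (rule sum.mono_neutral_left) (auto simp: k2 not_le)
  also have "\<dots> = 0" using \<Phi>(2) rel_value_bound[of \<Phi> "degree \<Phi> + k" q J] by simp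
  finally have R0: "R = 0" using J by simp
  have "psubst y (coeff \<Phi> k) = 0" if z: "\<And>l. psubst z (q l) = of_real (y l)" "psubst z J = 0" for y and z :: "4 \<Rightarrow> complex"
  proof -
    have "0 = psubst z R" by (simp add: R0)
    also have "\<dots> = (\<Sum>j\<le>degree \<Phi>. psubst z (psubst q (coeff \<Phi> (j + k))) * 0 ^ j)"
      by (simp add: R_def psubst_sum_distrib psubst_mult psubst_power z)
    also have "\<dots> = psubst z (psubst q (coeff \<Phi> k))" by (simp add: power_0_left if_distrib cong: if_cong)
    also have "\<dots> = of_real (psubst y (coeff \<Phi> k))" by (simp add: psubst_psubst z psubst_of_real)
    finally show ?thesis by simp
  qed
  then show ?thesis using k by blast
qed

section \<open>Generic fibres have sixteen points\<close>

text \<open>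
  For a real subspace \<open>I\<close> these are the members of its complexification, regarded as functions on \<open>\<complex>\<^sup>n\<close>; they
  determine their real and imaginary parts (\<open>polyfun_unique\<close>). So ideals and forms with complex
  coefficients can be handled with real polynomials alone.
\<close>

definition polyfun :: "'n::finite real_mpoly set \<Rightarrow> (complex^'n \<Rightarrow> complex) set" where
  "polyfun I = {f. \<exists>u\<in>I. \<exists>v\<in>I. f = (\<lambda>z. psubst (($) z) u + \<i> * psubst (($) z) v)}"

lemma polyfunI: "u \<in> I \<Longrightarrow> v \<in> I \<Longrightarrow> (\<And>z. f z = psubst (($) z) u + \<i> * psubst (($) z) v) \<Longrightarrow> f \<in> polyfun I"
  by (auto simp: polyfun_def)

lemma polyfunE:
  assumes "f \<in> polyfun I"
  obtains u v where "u \<in> I" "v \<in> I" "\<And>z. f z = psubst (($) z) u + \<i> * psubst (($) z) v"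
  using assms by (auto simp: polyfun_def)

lemma polyfun_add:
  assumes "f \<in> polyfun (ideal.span B)" "g \<in> polyfun (ideal.span B)"
  shows "(\<lambda>z. f z + g z) \<in> polyfun (ideal.span B)"
proof -
  obtain u v where f: "u \<in> ideal.span B" "v \<in> ideal.span B" "\<And>z. f z = psubst (($) z) u + \<i> * psubst (($) z) v"
    using assms(1) by (rule polyfunE) blast
  obtain u' v' where g: "u' \<in> ideal.span B" "v' \<in> ideal.span B" "\<And>z. g z = psubst (($) z) u' + \<i> * psubst (($) z) v'"
    using assms(2) by (rule polyfunE) blast
  show ?thesis
    by (rule polyfunI[of "u + u'" _ "v + v'"]) (use f g in \<open>auto simp: ideal.span_add psubst_add algebra_simps\<close>)
qed

lemma polyfun_mult:
  assumes "f \<in> polyfun UNIV" "g \<in> polyfun (ideal.span B)"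
  shows "(\<lambda>z. f z * g z) \<in> polyfun (ideal.span B)"
proof -
  obtain u v where f: "\<And>z. f z = psubst (($) z) u + \<i> * psubst (($) z) v"
    using assms(1) by (rule polyfunE) blast
  obtain u' v' where g: "u' \<in> ideal.span B" "v' \<in> ideal.span B" "\<And>z. g z = psubst (($) z) u' + \<i> * psubst (($) z) v'"
    using assms(2) by (rule polyfunE) blast
  have i: "\<i> * (\<i> * x) = - x" for x :: complex by (simp flip: mult.assoc)
  show ?thesis
    by (rule polyfunI[of "u * u' - v * v'" _ "u * v' + v * u'"])
       (use f g in \<open>auto simp: ideal.span_add ideal.span_diff ideal_mult_left ideal_mult_right psubst_add psubst_diff psubst_mult algebra_simps i\<close>)
qed

lemma ideal_span_1: "ideal.span {1} = UNIV"
  using ideal.span_scale[OF ideal.span_base[of 1 "{1}"]] by (auto simp: set_eq_iff)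

lemma psubst_const: "psubst g (c *\<^sub>R 1) = of_real c"
  by (simp only: psubst_scaleR psubst_1 of_real_def)

lemma polyfun_UNIV_add: "f \<in> polyfun UNIV \<Longrightarrow> g \<in> polyfun UNIV \<Longrightarrow> (\<lambda>z. f z + g z) \<in> polyfun UNIV"
  using polyfun_add[of f "{1}" g] by (simp add: ideal_span_1)
lemma polyfun_UNIV_mult: "f \<in> polyfun UNIV \<Longrightarrow> g \<in> polyfun UNIV \<Longrightarrow> (\<lambda>z. f z * g z) \<in> polyfun UNIV"
  using polyfun_mult[of f g "{1}"] by (simp add: ideal_span_1)
lemma polyfun_real: "u \<in> I \<Longrightarrow> 0 \<in> I \<Longrightarrow> (\<lambda>z. psubst (($) z) u) \<in> polyfun I"
  by (rule polyfunI[of u _ 0]) auto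
lemma polyfun_coord: "(\<lambda>z. z $ i) \<in> polyfun UNIV"
  using polyfun_real[of "X i" UNIV] by simp
lemma polyfun_const: "(\<lambda>z. c) \<in> polyfun UNIV"
  by (rule polyfunI[of "Re c *\<^sub>R 1" _ "Im c *\<^sub>R 1"]) (auto simp: psubst_scaleR complex_eq_iff)
lemma polyfun_zero: "(\<lambda>z. 0) \<in> polyfun (ideal.span B)"
  by (rule polyfunI[of 0 _ 0]) (auto simp: ideal.span_zero)
lemma polyfun_scale: "f \<in> polyfun (ideal.span B) \<Longrightarrow> (\<lambda>z. c * f z) \<in> polyfun (ideal.span B)"
  by (rule polyfun_mult[OF polyfun_const])
lemma polyfun_diff: "f \<in> polyfun (ideal.span B) \<Longrightarrow> g \<in> polyfun (ideal.span B) \<Longrightarrow> (\<lambda>z. f z - g z) \<in> polyfun (ideal.span B)"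
  using polyfun_add[of f B "\<lambda>z. -1 * g z"] polyfun_scale[of g B "-1"] by simp
lemma polyfun_sum:
  assumes "\<And>a. a \<in> A \<Longrightarrow> f a \<in> polyfun (ideal.span B)"
  shows "(\<lambda>z. \<Sum>a\<in>A. f a z) \<in> polyfun (ideal.span B)"
  using assms by (induction A rule: infinite_finite_induct) (auto simp: polyfun_zero polyfun_add)
lemma polyfun_UNIV_sum: "(\<And>a. a \<in> A \<Longrightarrow> f a \<in> polyfun UNIV) \<Longrightarrow> (\<lambda>z. \<Sum>a\<in>A. f a z) \<in> polyfun UNIV"
  using polyfun_sum[of A f "{1}"] by (simp add: ideal_span_1)
lemma polyfun_UNIV_prod: "(\<And>a. a \<in> A \<Longrightarrow> f a \<in> polyfun UNIV) \<Longrightarrow> (\<lambda>z. \<Prod>a\<in>A. f a z) \<in> polyfun UNIV"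
  by (induction A rule: infinite_finite_induct) (auto simp: polyfun_const polyfun_UNIV_mult)
lemma polyfun_UNIV_diff: "f \<in> polyfun UNIV \<Longrightarrow> g \<in> polyfun UNIV \<Longrightarrow> (\<lambda>z. f z - g z) \<in> polyfun UNIV"
  using polyfun_diff[of f "{1}" g] by (simp add: ideal_span_1)
lemma polyfun_poly: "(\<lambda>z. poly \<theta> (z $ i)) \<in> polyfun UNIV"
  by (induction \<theta>) (auto intro!: polyfun_const polyfun_UNIV_add polyfun_UNIV_mult polyfun_coord)

text \<open>
  Hadamard's lemma: for a product use \<open>f h - f a \<cdot> h a = f (h - h a) + h a (f - f a)\<close>.
\<close>

lemma hadamard_polyfun:
  assumes "f \<in> polyfun UNIV"
  shows "\<exists>g. (\<forall>i. g i \<in> polyfun UNIV) \<and> (\<forall>z. f z - f a = (\<Sum>i\<in>UNIV. (z $ i - a $ i) * g i z))"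
proof -
  let ?H = "\<lambda>f. \<exists>g. (\<forall>i. g i \<in> polyfun UNIV) \<and> (\<forall>z. f z - f a = (\<Sum>i\<in>UNIV. (z $ i - a $ i) * g i z))"
  have Hadd: "?H (\<lambda>z. f z + h z)" if "?H f" "?H h" for f h :: "complex^'a \<Rightarrow> complex"
  proof -
    obtain g g' where "\<forall>i. g i \<in> polyfun UNIV" "\<forall>z. f z - f a = (\<Sum>i\<in>UNIV. (z $ i - a $ i) * g i z)"
      "\<forall>i. g' i \<in> polyfun UNIV" "\<forall>z. h z - h a = (\<Sum>i\<in>UNIV. (z $ i - a $ i) * g' i z)" using \<open>?H f\<close> \<open>?H h\<close> by blast
    then have *: "\<forall>i. g i \<in> polyfun UNIV" "\<forall>i. g' i \<in> polyfun UNIV"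
      "\<And>z. f z - f a = (\<Sum>i\<in>UNIV. (z $ i - a $ i) * g i z)" "\<And>z. h z - h a = (\<Sum>i\<in>UNIV. (z $ i - a $ i) * g' i z)"
      by blast+
    show ?thesis
    proof (intro exI conjI allI)
      show "(\<lambda>z. g i z + g' i z) \<in> polyfun UNIV" for i using * polyfun_UNIV_add by blast
      fix z
      have "f z + h z - (f a + h a) = (f z - f a) + (h z - h a)" by simp
      also have "\<dots> = (\<Sum>i\<in>UNIV. (z $ i - a $ i) * (g i z + g' i z))"
        by (simp only: *(3,4) distrib_left sum.distrib)
      finally show "f z + h z - (f a + h a) = (\<Sum>i\<in>UNIV. (z $ i - a $ i) * (g i z + g' i z))" .
    qed
  qed
  have Hmult: "?H (\<lambda>z. f z * h z)" if "?H f" "?H h" "f \<in> polyfun UNIV" for f h :: "complex^'a \<Rightarrow> complex"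
  proof -
    obtain g g' where *: "\<forall>i. g i \<in> polyfun UNIV" "\<And>z. f z - f a = (\<Sum>i\<in>UNIV. (z $ i - a $ i) * g i z)"
      "\<forall>i. g' i \<in> polyfun UNIV" "\<And>z. h z - h a = (\<Sum>i\<in>UNIV. (z $ i - a $ i) * g' i z)" using \<open>?H f\<close> \<open>?H h\<close> by blast
    show ?thesis
    proof (intro exI conjI allI)
      show "(\<lambda>z. f z * g' i z + h a * g i z) \<in> polyfun UNIV" for i
        using * that(3) by (intro polyfun_UNIV_add polyfun_UNIV_mult polyfun_const) auto
      fix z
      have "f z * h z - f a * h a = f z * (h z - h a) + h a * (f z - f a)" by (simp add: algebra_simps)
      also have "\<dots> = (\<Sum>i\<in>UNIV. f z * ((z $ i - a $ i) * g' i z) + h a * ((z $ i - a $ i) * g i z))"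
        by (simp only: *(2,4) sum_distrib_left sum.distrib)
      also have "\<dots> = (\<Sum>i\<in>UNIV. (z $ i - a $ i) * (f z * g' i z + h a * g i z))"
        by (intro sum.cong refl) (simp add: algebra_simps)
      finally show "f z * h z - f a * h a = (\<Sum>i\<in>UNIV. (z $ i - a $ i) * (f z * g' i z + h a * g i z))" .
    qed
  qed
  have Hconst: "?H (\<lambda>z. c)" for c by (intro exI[of _ "\<lambda>i z. 0"]) (simp add: polyfun_const)
  have real: "?H (\<lambda>z. psubst (($) z) u)" for u
  proof (induction u rule: mpoly_mult_induct)
    case (const c) show ?case unfolding psubst_scaleR psubst_1 by (rule Hconst)
  next
    case (var i)
    have "z $ i - a $ i = (\<Sum>k\<in>UNIV. (z $ k - a $ k) * (if k = i then 1 else 0))" for z :: "complex^'a"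
      by (simp add: if_distrib[of "(*) _"] cong: if_cong)
    then show ?case by (intro exI[of _ "\<lambda>k z. if k = i then 1 else 0"]) (simp add: polyfun_const)
  next
    case (add f g) then show ?case using Hadd[of "\<lambda>z. psubst (($) z) f"] by (simp add: psubst_add)
  next
    case (mult f g) then show ?case unfolding psubst_mult by (intro Hmult polyfun_real) auto
  qed
  obtain u v where f: "\<And>z. f z = psubst (($) z) u + \<i> * psubst (($) z) v"
    using assms by (rule polyfunE) blast
  have "f = (\<lambda>z. psubst (($) z) u + \<i> * psubst (($) z) v)" using f by auto
  then show ?thesis using Hadd[OF real[of u] Hmult[OF Hconst[of \<i>] real[of v] polyfun_const]] by simp
qed

text \<open>
  If \<open>\<theta>\<close> annihilates the class of \<open>f\<close> modulo the ideal under multiplication by the coordinate \<open>z\<^sub>i\<close>, then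
  splitting off linear factors of \<open>\<theta>\<close> leads to an eigenvector that is a multiple of \<open>f\<close>.
\<close>

lemma root_extraction:
  fixes \<theta> :: "complex poly"
  assumes "\<theta> \<noteq> 0" "f \<in> polyfun UNIV" "f \<notin> polyfun (ideal.span B)" "(\<lambda>z. poly \<theta> (z $ i) * f z) \<in> polyfun (ideal.span B)"
  shows "\<exists>h\<in>polyfun UNIV. \<exists>a. (\<lambda>z. h z * f z) \<notin> polyfun (ideal.span B) \<and> (\<lambda>z. (z $ i - a) * (h z * f z)) \<in> polyfun (ideal.span B)"
  using assms(1,4)
proof (induction "degree \<theta>" arbitrary: \<theta>)
  case 0
  then obtain c where c: "\<theta> = [:c:]" "c \<noteq> 0" by (metis degree_eq_zeroE pCons_0_0)
  then have "(\<lambda>z. (1/c) * (poly \<theta> (z $ i) * f z)) \<in> polyfun (ideal.span B)" using 0 polyfun_scale by blast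
  then show ?case using c assms(3) by simp
next
  case (Suc n)
  then have "\<not> constant (poly \<theta>)" by (simp add: constant_degree)
  then obtain a where "poly \<theta> a = 0" using fundamental_theorem_of_algebra by blast
  then obtain \<psi> where \<psi>: "\<theta> = [:-a, 1:] * \<psi>" by (auto simp: poly_eq_0_iff_dvd dvd_def)
  have \<psi>0: "\<psi> \<noteq> 0" using \<psi> Suc by auto
  show ?case
  proof (cases "(\<lambda>z. poly \<psi> (z $ i) * f z) \<in> polyfun (ideal.span B)")
    case True
    have "degree \<theta> = Suc (degree \<psi>)" unfolding \<psi> using \<psi>0 by (subst degree_mult_eq) auto
    then show ?thesis using Suc.hyps(1)[of \<psi>] Suc.hyps(2) \<psi>0 True by simp
  next
    case False
    have "(\<lambda>z. (z $ i - a) * (poly \<psi> (z $ i) * f z)) \<in> polyfun (ideal.span B)"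
      using Suc.prems(2) by (simp add: \<psi> algebra_simps)
    then show ?thesis using False by (intro bexI[of _ "\<lambda>z. poly \<psi> (z $ i)"] exI[of _ a] conjI polyfun_poly)
  qed
qed

lemma det_polyfun: "(\<And>i j. A i j \<in> polyfun UNIV) \<Longrightarrow> (\<lambda>z. det (\<chi> i j. A i j z)) \<in> polyfun UNIV"
  unfolding det_def
  by (auto intro!: polyfun_UNIV_sum polyfun_UNIV_mult polyfun_const polyfun_UNIV_prod)

lemma det_column_polyfun:
  assumes A: "\<And>i j. A i j \<in> polyfun UNIV" and k: "\<And>i. A i k \<in> polyfun (ideal.span B)"
  shows "(\<lambda>z. det (\<chi> i j. A i j z)) \<in> polyfun (ideal.span B)"
proof -
  have "(\<lambda>z. of_int (sign p) * (\<Prod>i\<in>UNIV. A i (p i) z)) \<in> polyfun (ideal.span B)" if p: "p permutes UNIV" for p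
  proof -
    obtain i0 where i0: "p i0 = k" using permutes_surj[OF p] by (metis surjD)
    have "(\<Prod>i\<in>UNIV. A i (p i) z) = (\<Prod>i\<in>UNIV - {i0}. A i (p i) z) * A i0 k z" for z
      by (subst prod.remove[of UNIV i0]) (auto simp: i0 mult.commute)
    then show ?thesis
      by (simp only:) (intro polyfun_scale polyfun_mult polyfun_UNIV_prod A k)
  qed
  then show ?thesis unfolding det_def by (auto intro!: polyfun_sum)
qed

text \<open>
  The Nullstellensatz for a fibre with nonvanishing Jacobian, where the ideal is its own radical. If the
  class of \<open>f\<close> modulo \<open>I\<close> were nonzero, then some multiple \<open>F\<close> of \<open>f\<close> would be a common eigenvector of all coordinate
  multiplications, with eigenvalues forming a point \<open>a\<close>. Every polynomial \<open>g\<close> acts on \<open>F\<close> as the constant \<open>g a\<close>; as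
  \<open>q\<^sub>l - y\<^sub>l\<close> acts as \<open>0\<close>, the point \<open>a\<close> belongs to the fibre and \<open>F a = 0\<close>. Writing \<open>q\<^sub>l - y\<^sub>l\<close> as a linear combination
  of the \<open>z\<^sub>i - a\<^sub>i\<close>, Cramer's rule puts the determinant \<open>D\<close> of the coefficients times every \<open>z\<^sub>i - a\<^sub>i\<close>, and hence \<open>D F\<close>,
  into \<open>I\<close>. But \<open>D\<close> acts on \<open>F\<close> as \<open>D a\<close>, which is a nonzero multiple of the Jacobian at \<open>a\<close>.
\<close>

lemma vanishing_on_simple_fibre:
  fixes q :: "'n::finite \<Rightarrow> 'n real_mpoly" and y :: "'n \<Rightarrow> real"
  defines "I \<equiv> ideal.span (range (\<lambda>l. q l - y l *\<^sub>R 1))"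
  assumes q: "\<And>l. q l = quad_form (M l)" "\<And>l. transpose (M l) = M l"
    and \<theta>: "\<And>i. \<theta> i \<noteq> (0 :: complex poly)" "\<And>i. (\<lambda>z. poly (\<theta> i) (z $ i)) \<in> polyfun I"
    and simple: "\<And>z :: complex^'n. (\<And>l. psubst (($) z) (q l) = of_real (y l)) \<Longrightarrow> psubst (($) z) (jacobian_form M) \<noteq> 0"
    and f: "f \<in> polyfun UNIV" "\<And>z. (\<And>l. psubst (($) z) (q l) = of_real (y l)) \<Longrightarrow> f z = 0"
  shows "f \<in> polyfun I"
proof (rule ccontr)
  assume fI: "f \<notin> polyfun I"
  (* The common eigenvector is built one coordinate at a time; later multipliers preserve the
     eigenvector property for the earlier coordinates. *)
  have "\<exists>h\<in>polyfun UNIV. \<exists>a. (\<lambda>z. h z * f z) \<notin> polyfun I \<and> (\<forall>i\<in>S. (\<lambda>z. (z $ i - a i) * (h z * f z)) \<in> polyfun I)" for S :: "'n set"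
  proof (induction S rule: finite_induct[OF finite])
    case 1
    show ?case using fI by (intro bexI[of _ "\<lambda>z. 1"]) (auto simp: polyfun_const)
  next
    case (2 i S)
    then obtain h a where h: "h \<in> polyfun UNIV" "(\<lambda>z. h z * f z) \<notin> polyfun I"
      "\<forall>i\<in>S. (\<lambda>z. (z $ i - a i) * (h z * f z)) \<in> polyfun I" by blast
    have hf: "(\<lambda>z. h z * f z) \<in> polyfun UNIV" using h f polyfun_UNIV_mult by blast
    have "(\<lambda>z. (h z * f z) * poly (\<theta> i) (z $ i)) \<in> polyfun I"
      unfolding I_def by (rule polyfun_mult[OF hf]) (use \<theta>(2) in \<open>simp add: I_def\<close>)
    then have "(\<lambda>z. poly (\<theta> i) (z $ i) * (h z * f z)) \<in> polyfun I" by (simp add: mult.commute)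
    then obtain g b where g: "g \<in> polyfun UNIV" "(\<lambda>z. g z * (h z * f z)) \<notin> polyfun I"
      "(\<lambda>z. (z $ i - b) * (g z * (h z * f z))) \<in> polyfun I"
      using root_extraction[OF \<theta>(1) hf, of "range (\<lambda>l. q l - y l *\<^sub>R 1)" i] h(2) unfolding I_def by blast
    show ?case
    proof (intro bexI[of _ "\<lambda>z. g z * h z"] exI[of _ "a(i := b)"] conjI ballI)
      show "(\<lambda>z. g z * h z * f z) \<notin> polyfun I" using g by (simp add: mult.assoc)
      show "(\<lambda>z. g z * h z) \<in> polyfun UNIV" using g h polyfun_UNIV_mult by blast
      fix j assume j: "j \<in> insert i S"
      show "(\<lambda>z. (z $ j - (a(i := b)) j) * (g z * h z * f z)) \<in> polyfun I"
      proof (cases "j = i")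
        case True then show ?thesis using g by (simp add: mult.assoc)
      next
        case False
        then have "(\<lambda>z. (z $ j - a j) * (h z * f z)) \<in> polyfun I" using j h by auto
        then have "(\<lambda>z. g z * ((z $ j - a j) * (h z * f z))) \<in> polyfun I" unfolding I_def by (rule polyfun_mult[OF g(1)])
        then show ?thesis using False by (simp add: mult_ac)
      qed
    qed
  qed
  from this[of UNIV] obtain h a0 where h: "h \<in> polyfun UNIV" "(\<lambda>z. h z * f z) \<notin> polyfun I"
      "\<And>i. (\<lambda>z. (z $ i - a0 i) * (h z * f z)) \<in> polyfun I" by blast
  (* The common eigenvector and its eigenvalues. *)
  define F where "F z = h z * f z" for z
  define a :: "complex^'n" where "a = (\<chi> i. a0 i)"
  have F: "F \<in> polyfun UNIV" "F \<notin> polyfun I" "\<And>i. (\<lambda>z. (z $ i - a $ i) * F z) \<in> polyfun I"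
    using h f polyfun_UNIV_mult[of h f] by (simp_all add: F_def[abs_def] a_def)
  have eig: "(\<lambda>z. (g z - g a) * F z) \<in> polyfun I" if "g \<in> polyfun UNIV" for g
  proof -
    obtain k where k: "\<And>i. k i \<in> polyfun UNIV" "\<And>z. g z - g a = (\<Sum>i\<in>UNIV. (z $ i - a $ i) * k i z)"
      using hadamard_polyfun[OF \<open>g \<in> polyfun UNIV\<close>, of a] by blast
    have "(\<lambda>z. \<Sum>i\<in>UNIV. k i z * ((z $ i - a $ i) * F z)) \<in> polyfun I"
      unfolding I_def by (rule polyfun_sum) (rule polyfun_mult[OF k(1) F(3)[unfolded I_def]])
    moreover have "(g z - g a) * F z = (\<Sum>i\<in>UNIV. k i z * ((z $ i - a $ i) * F z))" for z
      unfolding k(2) sum_distrib_right by (intro sum.cong refl) (simp add: mult_ac)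
    ultimately show ?thesis by simp
  qed
  have Zero: "psubst (($) a) (q l) = of_real (y l)" for l
  proof (rule ccontr)
    assume n: "psubst (($) a) (q l) \<noteq> of_real (y l)"
    have "q l - y l *\<^sub>R 1 \<in> I" unfolding I_def by (rule ideal.span_base) auto
    then have "(\<lambda>z. psubst (($) z) (q l - y l *\<^sub>R 1)) \<in> polyfun I" by (rule polyfun_real) (simp add: I_def ideal.span_zero)
    then have "(\<lambda>z. F z * psubst (($) z) (q l - y l *\<^sub>R 1)) \<in> polyfun I" using F(1) unfolding I_def by (intro polyfun_mult)
    moreover have "(\<lambda>z. (psubst (($) z) (q l) - psubst (($) a) (q l)) * F z) \<in> polyfun I" by (intro eig polyfun_real) auto
    ultimately have "(\<lambda>z. F z * psubst (($) z) (q l - y l *\<^sub>R 1) - (psubst (($) z) (q l) - psubst (($) a) (q l)) * F z) \<in> polyfun I"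
      unfolding I_def by (rule polyfun_diff)
    then have "(\<lambda>z. (psubst (($) a) (q l) - of_real (y l)) * F z) \<in> polyfun I"
      unfolding psubst_diff psubst_const by (simp add: algebra_simps)
    then have "(\<lambda>z. (1 / (psubst (($) a) (q l) - of_real (y l))) * ((psubst (($) a) (q l) - of_real (y l)) * F z)) \<in> polyfun I"
      unfolding I_def by (rule polyfun_scale)
    then show False using n F(2) by simp
  qed
  define A where "A l i z = (\<Sum>j\<in>UNIV. M l $ i $ j *\<^sub>R (z $ j + a $ j))" for l i and z :: "complex^'n"
  have AP: "A l i \<in> polyfun UNIV" for l i
    unfolding A_def scaleR_conv_of_real by (intro polyfun_UNIV_sum polyfun_UNIV_mult polyfun_UNIV_add polyfun_const polyfun_coord)
  have qA: "psubst (($) z) (q l) - of_real (y l) = (\<Sum>i\<in>UNIV. A l i z * (z $ i - a $ i))" for l z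
  proof -
    have sym: "M l $ i $ j = M l $ j $ i" for i j
      using arg_cong[OF q(2)[of l], of "\<lambda>A. A $ j $ i"] by (simp add: transpose_def)
    have sw: "(\<Sum>i\<in>UNIV. \<Sum>j\<in>UNIV. M l $ i $ j *\<^sub>R (z $ i * a $ j)) = (\<Sum>i\<in>UNIV. \<Sum>j\<in>UNIV. M l $ i $ j *\<^sub>R (a $ i * z $ j))"
      by (subst sum.swap) (intro sum.cong refl, subst sym, simp add: mult.commute)
    have "(\<Sum>i\<in>UNIV. A l i z * (z $ i - a $ i)) = (\<Sum>i\<in>UNIV. \<Sum>j\<in>UNIV. M l $ i $ j *\<^sub>R (z $ i * z $ j)
       + M l $ i $ j *\<^sub>R (z $ i * a $ j) - M l $ i $ j *\<^sub>R (a $ i * z $ j) - M l $ i $ j *\<^sub>R (a $ i * a $ j))"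
      unfolding A_def sum_distrib_right by (intro sum.cong refl) (simp add: scaleR_conv_of_real algebra_simps)
    also have "\<dots> = (\<Sum>i\<in>UNIV. \<Sum>j\<in>UNIV. M l $ i $ j *\<^sub>R (z $ i * z $ j))
       + (\<Sum>i\<in>UNIV. \<Sum>j\<in>UNIV. M l $ i $ j *\<^sub>R (z $ i * a $ j)) - (\<Sum>i\<in>UNIV. \<Sum>j\<in>UNIV. M l $ i $ j *\<^sub>R (a $ i * z $ j))
       - (\<Sum>i\<in>UNIV. \<Sum>j\<in>UNIV. M l $ i $ j *\<^sub>R (a $ i * a $ j))"
      by (simp only: sum.distrib sum_subtractf)
    also have "\<dots> = psubst (($) z) (q l) - psubst (($) a) (q l)" by (simp add: sw q psubst_quad_form)
    finally show ?thesis by (simp add: Zero)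
  qed
  define D where "D z = det (\<chi> l i. A l i z)" for z
  have DP: "D \<in> polyfun UNIV" unfolding D_def by (rule det_polyfun[OF AP])
  have Dk: "(\<lambda>z. D z * (z $ k - a $ k)) \<in> polyfun I" for k
  proof -
    have "z $ k * D z - a $ k * D z = det (\<chi> l i. if i = k then psubst (($) z) (q l) - of_real (y l) else A l i z)" for z
      using cramer_lemma[where A = "\<chi> l i. A l i z" and x = "z - a" and k = k]
      by (simp add: D_def qA matrix_vector_mult_def algebra_simps cong: if_cong)
    then have "(\<lambda>z. D z * (z $ k - a $ k)) = (\<lambda>z. det (\<chi> l i. if i = k then psubst (($) z) (q l) - of_real (y l) else A l i z))"
      by (auto simp: algebra_simps)
    moreover have "(\<lambda>z. det (\<chi> l i. (if i = k then (\<lambda>z. psubst (($) z) (q l) - of_real (y l)) else A l i) z)) \<in> polyfun I"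
      unfolding I_def
    proof (rule det_column_polyfun[where k = k], fold I_def)
      have e: "(\<lambda>z. psubst (($) z) (q l) - of_real (y l)) = (\<lambda>z. psubst (($) z) (q l - y l *\<^sub>R 1))" for l
        unfolding psubst_diff psubst_const ..
      show "(if i = k then (\<lambda>z. psubst (($) z) (q l) - of_real (y l)) else A l i) \<in> polyfun UNIV" for l i
      proof (cases "i = k")
        case True
        then show ?thesis by (simp, unfold e, intro polyfun_real) auto
      qed (simp add: AP)
      show "(if k = k then (\<lambda>z. psubst (($) z) (q l) - of_real (y l)) else A l k) \<in> polyfun I" for l
        unfolding e by (simp, rule polyfun_real) (auto simp: I_def intro: ideal.span_base ideal.span_zero)
    qed
    ultimately show ?thesis by (simp add: if_distribR cong: if_cong)
  qed
  have Fa: "F a = 0" using f(2)[of a] Zero by (simp add: F_def)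
  obtain g where g: "\<And>i. g i \<in> polyfun UNIV" "\<And>z. F z - F a = (\<Sum>i\<in>UNIV. (z $ i - a $ i) * g i z)"
    using hadamard_polyfun[OF F(1), of a] by blast
  have "(\<lambda>z. \<Sum>i\<in>UNIV. g i z * (D z * (z $ i - a $ i))) \<in> polyfun I"
    unfolding I_def by (rule polyfun_sum) (rule polyfun_mult[OF g(1) Dk[unfolded I_def]])
  moreover have "(\<Sum>i\<in>UNIV. g i z * (D z * (z $ i - a $ i))) = D z * F z" for z
    using g(2)[of z] by (simp add: Fa sum_distrib_left mult_ac)
  ultimately have DF: "(\<lambda>z. D z * F z) \<in> polyfun I" by simp
  have "(\<lambda>z. D z * F z - (D z - D a) * F z) \<in> polyfun I"
    using DF eig[OF DP] unfolding I_def by (rule polyfun_diff)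
  then have DaF: "(\<lambda>z. D a * F z) \<in> polyfun I" by (simp add: algebra_simps)
  have "D a \<noteq> 0"
  proof -
    have "A l i a = 2 * (\<Sum>j\<in>UNIV. M l $ i $ j *\<^sub>R a $ j)" for l i
      unfolding A_def sum_distrib_left by (intro sum.cong refl) (simp add: scaleR_conv_of_real)
    then have "D a = det (\<chi> l. 2 *s (\<chi> i. \<Sum>j\<in>UNIV. M l $ i $ j *\<^sub>R a $ j))"
      by (simp add: D_def vector_scalar_mult_def)
    also have "\<dots> = 2 ^ CARD('n) * psubst (($) a) (jacobian_form M)"
      by (simp add: det_rows_mul psubst_jacobian_form vec_lambda_eta)
    finally show ?thesis using simple[OF Zero] by simp
  qed
  then have "(\<lambda>z. (1 / D a) * (D a * F z)) = F" by auto
  then show False using polyfun_scale[OF DaF[unfolded I_def], of "1 / D a"] F(2) by (simp add: I_def)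
qed


lemma polyfun_unique:
  fixes u v u' v' :: "'n::finite real_mpoly"
  assumes "\<And>z. psubst (($) z) u + \<i> * psubst (($) z) v = psubst (($) z) u' + \<i> * psubst (($) z) v'"
  shows "u = u' \<and> v = v'"
proof -
  have "psubst (($) x) u = psubst (($) x) u' \<and> psubst (($) x) v = psubst (($) x) v'" for x :: "real^'n"
  proof -
    have g: "($) (\<chi> i. complex_of_real (x $ i)) = (\<lambda>i. complex_of_real (x $ i))" by auto
    have e: "psubst (($) (\<chi> i. complex_of_real (x $ i))) f = of_real (psubst (($) x) f)" for f :: "'n real_mpoly"
      unfolding g by (rule psubst_of_real)
    show ?thesis using assms[of "\<chi> i. complex_of_real (x $ i)"] unfolding e by (simp add: complex_eq_iff)
  qed
  then show ?thesis by (auto intro: psubst_ext)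
qed

text \<open>
  The complex fibre over a real point of the map defined by the forms \<open>q l\<close>.
\<close>

definition fibre :: "('n::finite \<Rightarrow> 'n real_mpoly) \<Rightarrow> ('n \<Rightarrow> real) \<Rightarrow> (complex^'n) set" where
  "fibre q y = {z. \<forall>l. psubst (($) z) (q l) = of_real (y l)}"

lemma psubst_fibre: "z \<in> fibre q y \<Longrightarrow> psubst (($) z) (psubst q P) = of_real (psubst y P)"
  by (simp add: fibre_def psubst_psubst psubst_of_real)

lemma finite_fibre:
  assumes "\<And>i. \<theta> i \<noteq> (0 :: complex poly)" "\<And>i z. z \<in> fibre q y \<Longrightarrow> poly (\<theta> i) (z $ i) = 0"
  shows "finite (fibre q y)"
proof (rule finite_subset)
  show "fibre q y \<subseteq> vec_lambda ` (PiE UNIV (\<lambda>i. {x. poly (\<theta> i) x = 0}))"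
  proof
    fix z assume "z \<in> fibre q y"
    then have "($) z \<in> PiE UNIV (\<lambda>i. {x. poly (\<theta> i) x = 0})" using assms(2) by auto
    then show "z \<in> vec_lambda ` (PiE UNIV (\<lambda>i. {x. poly (\<theta> i) x = 0}))" by (metis imageI vec_nth_inverse)
  qed
  show "finite (vec_lambda ` (PiE UNIV (\<lambda>i. {x. poly (\<theta> i) x = 0})))"
    using assms(1) poly_roots_finite by (intro finite_imageI finite_PiE) auto
qed

text \<open>
  On the fibre an algebraic relation for \<open>x\<^sub>i\<close> over the quadrics specialises to a polynomial in \<open>x\<^sub>i\<close> with
  constant coefficients.
\<close>

lemma fibre_relation_univariate:
  fixes q :: "4 \<Rightarrow> 4 real_mpoly"
  assumes \<Phi>: "rel_value q \<Phi> (X i) = 0" "psubst y (lead_coeff \<Phi>) \<noteq> 0"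
  shows "\<exists>\<theta> :: complex poly. \<theta> \<noteq> 0 \<and> (\<lambda>z. poly \<theta> (z $ i)) \<in> polyfun (ideal.span (range (\<lambda>l. q l - y l *\<^sub>R 1)))"
proof -
  let ?I = "ideal.span (range (\<lambda>l. q l - y l *\<^sub>R 1))"
  define \<theta> :: "complex poly" where "\<theta> = (\<Sum>j\<le>degree \<Phi>. monom (of_real (psubst y (coeff \<Phi> j))) j)"
  have co: "coeff \<theta> j = (if j \<le> degree \<Phi> then of_real (psubst y (coeff \<Phi> j)) else 0)" for j
    by (simp add: \<theta>_def coeff_sum)
  have "\<theta> \<noteq> 0" using co[of "degree \<Phi>"] \<Phi>(2) by auto
  moreover have "(\<lambda>z. poly \<theta> (z $ i)) \<in> polyfun ?I"
  proof -
    define u where "u = (\<Sum>j\<le>degree \<Phi>. (psubst y (coeff \<Phi> j)) *\<^sub>R X i ^ j)"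
    have c: "psubst q P - psubst y P *\<^sub>R 1 \<in> ?I" for P
      using ideal_psubst_cong[of P UNIV q "\<lambda>l. y l *\<^sub>R 1" "range (\<lambda>l. q l - y l *\<^sub>R 1)"]
      by (auto simp: pvars_def psubst_scalars intro: ideal.span_base)
    have "(\<Sum>j\<le>degree \<Phi>. (psubst q (coeff \<Phi> j) - psubst y (coeff \<Phi> j) *\<^sub>R 1) * X i ^ j) \<in> ?I"
      by (intro ideal.span_sum ideal_mult_right c)
    then have "rel_value q \<Phi> (X i) - u \<in> ?I"
      by (simp add: u_def rel_value_def left_diff_distrib sum_subtractf)
    then have "u \<in> ?I" using \<Phi>(1) ideal.span_neg by fastforce
    then have "(\<lambda>z. psubst (($) z) u) \<in> polyfun ?I" by (intro polyfun_real ideal.span_zero)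
    moreover have "poly \<theta> (z $ i) = psubst (($) z) u" for z :: "complex^4"
      unfolding \<theta>_def u_def psubst_sum_distrib psubst_scaleR
      by (simp add: poly_sum poly_monom psubst_power scaleR_conv_of_real)
    ultimately show ?thesis by simp
  qed
  ultimately show ?thesis by blast
qed

text \<open>
  Specialising the coefficients of the expansion with respect to \<open>E\<close> at \<open>y\<close> kills the ideal of the fibre, so
  a basis over the polynomials in the quadrics stays independent modulo this ideal.
\<close>

lemma ideal_fibre_independent:
  fixes q :: "4 \<Rightarrow> 4 real_mpoly"
  assumes E: "finite E" "poly_indep q E" and s: "\<And>f. \<exists>A. psubst q s * f = (\<Sum>e\<in>E. psubst q (A e) * e)" "psubst y s \<noteq> 0"
    and I: "(\<Sum>e\<in>E. r e *\<^sub>R e) \<in> ideal.span (range (\<lambda>l. q l - y l *\<^sub>R 1))" and e: "e \<in> E"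
  shows "r e = (0::real)"
proof -
  let ?q = "\<lambda>l. q l - y l *\<^sub>R 1"
  have "\<exists>A. (\<forall>e\<in>E. psubst y (A e) = 0) \<and> psubst q s * x = (\<Sum>e\<in>E. psubst q (A e) * e)"
    if "x \<in> ideal.span (range ?q)" for x
    using that
  proof (induction x rule: ideal.span_induct_alt)
    case base show ?case by (intro exI[of _ "\<lambda>_. 0"]) simp
  next
    case (step c x x')
    obtain A where A: "\<forall>e\<in>E. psubst y (A e) = 0" "psubst q s * x' = (\<Sum>e\<in>E. psubst q (A e) * e)" using step(2) by blast
    obtain A' where A': "psubst q s * c = (\<Sum>e\<in>E. psubst q (A' e) * e)" using s(1) by blast
    obtain l where l: "x = q l - y l *\<^sub>R 1" using step(1) by blast
    let ?t = "X l - y l *\<^sub>R 1"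
    have t: "psubst q ?t = x" unfolding psubst_diff psubst_scaleR psubst_1 psubst_X l ..
    have "psubst q s * (c * x + x') = psubst q ?t * (psubst q s * c) + psubst q s * x'"
      unfolding t by (simp add: algebra_simps)
    also have "\<dots> = (\<Sum>e\<in>E. psubst q (?t * A' e + A e) * e)"
      unfolding A' A(2) by (simp add: psubst_add psubst_mult sum_distrib_left distrib_right sum.distrib mult.assoc)
    finally have "psubst q s * (c * x + x') = (\<Sum>e\<in>E. psubst q (?t * A' e + A e) * e)" .
    moreover have "psubst y ?t = 0" by (simp add: psubst_diff psubst_scaleR)
    then have "\<forall>e\<in>E. psubst y (?t * A' e + A e) = 0" using A(1) by (simp add: psubst_add psubst_mult)
    ultimately show ?case by (intro exI[of _ "\<lambda>e. ?t * A' e + A e"] conjI)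
  qed
  from this[OF I] obtain A where A: "\<forall>e\<in>E. psubst y (A e) = 0" "psubst q s * (\<Sum>e\<in>E. r e *\<^sub>R e) = (\<Sum>e\<in>E. psubst q (A e) * e)" by blast
  have "(\<Sum>e\<in>E. psubst q (r e *\<^sub>R s - A e) * e) = psubst q s * (\<Sum>e\<in>E. r e *\<^sub>R e) - (\<Sum>e\<in>E. psubst q (A e) * e)"
    by (simp add: psubst_diff psubst_scaleR left_diff_distrib sum_subtractf sum_distrib_left)
  then have "(\<Sum>e\<in>E. psubst q (r e *\<^sub>R s - A e) * e) = 0" using A(2) by simp
  from E(2)[unfolded poly_indep_def, rule_format, OF this e] have "r e *\<^sub>R s = A e" by simp
  then have "r e * psubst y s = 0" using A(1) e by (metis psubst_scaleR real_scaleR_def)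
  then show ?thesis using s(2) by simp
qed

text \<open>
  Evaluation maps the complex span of \<open>E\<close> to the functions on the fibre. It is injective, since a
  combination that vanishes on the fibre lies in its ideal and \<open>E\<close> is independent modulo this ideal. It is
  surjective, since \<open>E\<close> spans all polynomials modulo the ideal, up to the denominator \<open>s\<close>, and polynomials
  separate points. So the fibre has as many points as \<open>E\<close> has members.
\<close>

lemma card_generic_fibre:
  fixes q :: "4 \<Rightarrow> 4 real_mpoly"
  assumes q: "\<And>l. q l = quad_form (M l)" "\<And>l. transpose (M l) = M l"
    and E: "finite E" "card E = 16" "poly_indep q E"
    and s: "\<And>f. \<exists>A. psubst q s * f = (\<Sum>e\<in>E. psubst q (A e) * e)" "psubst y s \<noteq> 0"
    and \<Phi>: "\<And>i. rel_value q (\<Phi> i) (X i) = 0" "\<And>i. psubst y (lead_coeff (\<Phi> i)) \<noteq> 0"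
    and simple: "\<And>z. z \<in> fibre q y \<Longrightarrow> psubst (($) z) (jacobian_form M) \<noteq> 0"
  shows "finite (fibre q y) \<and> card (fibre q y) = 16"
proof -
  let ?Z = "fibre q y"
  define I where "I = ideal.span (range (\<lambda>l. q l - y l *\<^sub>R 1))"
  have "\<exists>\<theta> :: complex poly. \<theta> \<noteq> 0 \<and> (\<lambda>z. poly \<theta> (z $ i)) \<in> polyfun I" for i
    unfolding I_def using \<Phi> by (intro fibre_relation_univariate)
  then obtain \<theta> :: "4 \<Rightarrow> complex poly" where \<theta>: "\<And>i. \<theta> i \<noteq> 0" "\<And>i. (\<lambda>z. poly (\<theta> i) (z $ i)) \<in> polyfun I" by metis
  have I0: "psubst (($) z) u = 0" if z: "z \<in> ?Z" and u: "u \<in> I" for z u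
    using u unfolding I_def
  proof (induction u rule: ideal.span_induct_alt)
    case (step c x x')
    then obtain l where "x = q l - y l *\<^sub>R 1" by blast
    then have "psubst (($) z) x = 0" using z unfolding fibre_def by (simp only: psubst_diff psubst_const) simp
    then show ?case using step by (simp add: psubst_add psubst_mult)
  qed simp
  have I0': "f z = 0" if "z \<in> ?Z" "f \<in> polyfun I" for z f
    using that(2) I0[OF that(1)] by (auto elim!: polyfunE)
  have fin: "finite ?Z" using finite_fibre[of \<theta>] \<theta> I0' by blast
  have ge: "card ?Z \<ge> 16"
  proof (rule ccontr)
    assume "\<not> ?thesis"
    then have "card ?Z < card E" using E by simp
    then obtain c :: "4 real_mpoly \<Rightarrow> complex" where c: "\<exists>e\<in>E. c e \<noteq> 0" "\<And>z. z \<in> ?Z \<Longrightarrow> (\<Sum>e\<in>E. c e * psubst (($) z) e) = 0"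
      using homogeneous_system_nontrivial_solution[OF fin E(1), of "\<lambda>e z. psubst (($) z) e"] by blast
    define F where "F z = (\<Sum>e\<in>E. c e * psubst (($) z) e)" for z :: "complex^4"
    have Fp: "F \<in> polyfun UNIV" unfolding F_def by (intro polyfun_UNIV_sum polyfun_UNIV_mult polyfun_const polyfun_real) auto
    have "F \<in> polyfun I" unfolding I_def
      by (rule vanishing_on_simple_fibre[OF q \<theta>(1) \<theta>(2)[unfolded I_def] _ Fp])
         (use simple c(2) in \<open>auto simp: fibre_def F_def\<close>)
    then obtain u v where uv: "u \<in> I" "v \<in> I" "\<And>z. F z = psubst (($) z) u + \<i> * psubst (($) z) v" by (rule polyfunE) blast
    have "F z = psubst (($) z) (\<Sum>e\<in>E. Re (c e) *\<^sub>R e) + \<i> * psubst (($) z) (\<Sum>e\<in>E. Im (c e) *\<^sub>R e)" for z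
      unfolding F_def psubst_sum_distrib psubst_scaleR sum_distrib_left sum.distrib[symmetric]
      by (intro sum.cong refl) (subst complex_eq[of "c _"], simp add: scaleR_conv_of_real algebra_simps)
    then have "u = (\<Sum>e\<in>E. Re (c e) *\<^sub>R e) \<and> v = (\<Sum>e\<in>E. Im (c e) *\<^sub>R e)" by (intro polyfun_unique) (simp add: uv(3)[symmetric])
    note uveq = this
    have "Re (c e) = 0 \<and> Im (c e) = 0" if "e \<in> E" for e
    proof
      have mem: "(\<Sum>e\<in>E. Re (c e) *\<^sub>R e) \<in> I" "(\<Sum>e\<in>E. Im (c e) *\<^sub>R e) \<in> I"
        using uv(1,2) uveq by simp_all
      show "Re (c e) = 0"
        by (rule ideal_fibre_independent[where r = "\<lambda>e. Re (c e)", OF E(1,3) s(1) s(2) mem(1)[unfolded I_def] that])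
      show "Im (c e) = 0"
        by (rule ideal_fibre_independent[where r = "\<lambda>e. Im (c e)", OF E(1,3) s(1) s(2) mem(2)[unfolded I_def] that])
    qed
    then show False using c(1) by (auto simp: complex_eq_iff)
  qed
  have le: "card ?Z \<le> 16"
  proof (rule ccontr)
    assume "\<not> ?thesis"
    then have "card E < card ?Z" using E by simp
    then obtain w :: "complex^4 \<Rightarrow> complex" where w: "\<exists>z\<in>?Z. w z \<noteq> 0" "\<And>e. e \<in> E \<Longrightarrow> (\<Sum>z\<in>?Z. w z * psubst (($) z) e) = 0"
      using homogeneous_system_nontrivial_solution[OF E(1) fin, of "\<lambda>z e. psubst (($) z) e"] by blast
    have wf: "(\<Sum>z\<in>?Z. w z * psubst (($) z) f) = 0" for f
    proof -
      obtain A where A: "psubst q s * f = (\<Sum>e\<in>E. psubst q (A e) * e)" using s(1) by blast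
      have "of_real (psubst y s) * psubst (($) z) f = (\<Sum>e\<in>E. of_real (psubst y (A e)) * psubst (($) z) e)" if "z \<in> ?Z" for z
        using arg_cong[OF A, of "psubst (($) z)"] psubst_fibre[OF that] by (simp add: psubst_mult psubst_sum_distrib)
      then have "of_real (psubst y s) * (\<Sum>z\<in>?Z. w z * psubst (($) z) f) = (\<Sum>z\<in>?Z. \<Sum>e\<in>E. of_real (psubst y (A e)) * (w z * psubst (($) z) e))"
        by (simp add: sum_distrib_left mult_ac)
      also have "\<dots> = (\<Sum>e\<in>E. of_real (psubst y (A e)) * (\<Sum>z\<in>?Z. w z * psubst (($) z) e))"
        by (subst sum.swap) (simp add: sum_distrib_left)
      also have "\<dots> = 0" using w(2) by simp
      finally show ?thesis using s(2) by simp
    qed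
    have wp: "(\<Sum>z\<in>?Z. w z * f z) = 0" if "f \<in> polyfun UNIV" for f
    proof -
      obtain u v where f: "\<And>z. f z = psubst (($) z) u + \<i> * psubst (($) z) v" using \<open>f \<in> polyfun UNIV\<close> by (rule polyfunE) blast
      have "(\<Sum>z\<in>?Z. w z * f z) = (\<Sum>z\<in>?Z. w z * psubst (($) z) u) + \<i> * (\<Sum>z\<in>?Z. w z * psubst (($) z) v)"
        by (simp add: f algebra_simps sum.distrib sum_distrib_left)
      then show ?thesis by (simp add: wf)
    qed
    obtain z0 where z0: "z0 \<in> ?Z" "w z0 \<noteq> 0" using w(1) by blast
    have "\<forall>z\<in>?Z - {z0}. \<exists>i. z $ i \<noteq> z0 $ i" by (metis DiffE singletonI vec_eq_iff)
    then obtain k where k: "\<And>z. z \<in> ?Z - {z0} \<Longrightarrow> z $ k z \<noteq> z0 $ k z" by metis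
    (* A product of coordinate differences that singles out z0 in the fibre. *)
    define f where "f x = (\<Prod>z\<in>?Z - {z0}. (x $ k z - z $ k z))" for x :: "complex^4"
    have "f \<in> polyfun UNIV" unfolding f_def
      by (intro polyfun_UNIV_prod polyfun_UNIV_diff polyfun_coord polyfun_const)
    from wp[OF this] have "0 = (\<Sum>z\<in>?Z. w z * f z)" by simp
    also have "\<dots> = w z0 * f z0 + (\<Sum>z\<in>?Z - {z0}. w z * f z)" using fin z0 by (simp add: sum.remove)
    also have "(\<Sum>z\<in>?Z - {z0}. w z * f z) = 0"
      using fin by (intro sum.neutral) (auto simp: f_def)
    finally have "f z0 = 0" using z0 by simp
    then show False using k fin by (fastforce simp: f_def)
  qed
  show ?thesis using fin ge le by simp
qed

section \<open>Collinear and coplanar points of the base locus\<close>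

text \<open>
  \<open>P0\<close> collects what a generic \<open>y\<close> has to avoid: the denominator of the basis, the branch polynomial and the
  leading coefficients of the relations for the variables; the factor \<open>X 0\<close> makes \<open>y 0\<close> usable as a divisor.
\<close>

lemma generic_fibre:
  fixes W :: "4 real_mpoly set"
  assumes min: "minimal_primary_quadrics W B" and W: "subspace W" "W \<subseteq> forms 2"
  shows "\<exists>(q :: 4 \<Rightarrow> 4 real_mpoly) (M :: 4 \<Rightarrow> real^4^4) (P0 :: 4 real_mpoly).
     range q \<subseteq> W \<and> (\<forall>l. q l = quad_form (M l) \<and> transpose (M l) = M l) \<and> primary_to_origin (range q) \<and>
     (\<forall>P :: 4 real_mpoly. psubst q P = 0 \<longrightarrow> P = 0) \<and> P0 \<noteq> 0 \<and>
     (\<forall>y. psubst y P0 \<noteq> 0 \<longrightarrow> y 0 \<noteq> 0 \<and> finite (fibre q y) \<and> card (fibre q y) = 16)"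
proof -
  have B: "finite B" "B \<subseteq> W" "primary_to_origin B" using min by (auto simp: minimal_primary_quadrics_def)
  have "card (UNIV :: 4 set) = card B" using minimal_primary_card[OF min W] by simp
  then obtain q where q: "bij_betw q (UNIV :: 4 set) B" using finite_same_card_bij[OF finite B(1)] by blast
  then have inj: "inj q" and ran: "range q = B" by (auto simp: bij_betw_def)
  have q2: "q l \<in> forms 2" for l using ran B W by auto
  then have "\<exists>c. q l = quad_form c \<and> transpose c = c" for l using forms_2_symmetric_quad_form by blast
  then obtain M where M: "\<And>l. q l = quad_form (M l)" "\<And>l. transpose (M l) = M l" by metis
  have indep: "P = 0" if "psubst q P = 0" for P :: "4 real_mpoly"
    using minimal_primary_independent[OF min W, of q UNIV P] inj ran that by (auto simp: pvars_def)
  have prim: "primary_to_origin (range q)" using B ran by simp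
  obtain E s where E: "finite E" "card E = 16" "poly_indep q E" and s: "s \<noteq> 0" "\<And>f. \<exists>A. psubst q s * f = (\<Sum>e\<in>E. psubst q (A e) * e)"
    using generic_basis[of q, OF q2 prim indep] by blast
  have "\<exists>\<Phi>. \<Phi> \<noteq> 0 \<and> rel_value q \<Phi> (X i) = 0" for i
    using algebraic_over_quadrics[of q "X i", OF q2] unfolding rel_value_def by blast
  then obtain \<Phi> where \<Phi>: "\<And>i. \<Phi> i \<noteq> 0" "\<And>i. rel_value q (\<Phi> i) (X i) = 0" by metis
  have "jacobian_form M \<noteq> 0" by (rule jacobian_form_nonzero[OF M indep])
  then obtain P where P: "P \<noteq> 0" "\<And>y (z :: 4 \<Rightarrow> complex). (\<And>l. psubst z (q l) = of_real (y l)) \<Longrightarrow> psubst z (jacobian_form M) = 0 \<Longrightarrow> psubst y P = 0"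
    using branch_polynomial[of q "jacobian_form M", OF q2] by blast
  define P0 :: "4 real_mpoly" where "P0 = X 0 * s * P * (\<Prod>i\<in>UNIV. lead_coeff (\<Phi> i))"
  have "X 0 \<noteq> (0 :: 4 real_mpoly)" by (metis X_def keys_mon keys_zero insert_not_empty)
  then have "P0 \<noteq> 0" using s P \<Phi> by (simp add: P0_def)
  moreover have "y 0 \<noteq> 0 \<and> finite (fibre q y) \<and> card (fibre q y) = 16" if y: "psubst y P0 \<noteq> 0" for y
  proof -
    have y': "y 0 \<noteq> 0" "psubst y s \<noteq> 0" "psubst y P \<noteq> 0" "\<And>i. psubst y (lead_coeff (\<Phi> i)) \<noteq> 0"
      using y by (auto simp: P0_def psubst_mult psubst_prod)
    have "psubst (($) z) (jacobian_form M) \<noteq> 0" if "z \<in> fibre q y" for z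
      using P(2)[of "($) z" y] that y'(3) by (auto simp: fibre_def)
    then have "finite (fibre q y) \<and> card (fibre q y) = 16"
      by (intro card_generic_fibre[OF M E s(2) y'(2) \<Phi>(2) y'(4)])
    then show ?thesis using y' by simp
  qed
  moreover have "range q \<subseteq> W" using ran B by simp
  ultimately show ?thesis using M prim indep by (intro exI[of _ q] exI[of _ M] exI[of _ P0]) simp
qed

definition proportional :: "('n \<Rightarrow> real) \<Rightarrow> ('n \<Rightarrow> complex) \<Rightarrow> bool" where
  "proportional y v \<longleftrightarrow> (\<exists>k. \<forall>l. v l = k * of_real (y l))"

lemma proportional_add: "proportional y v \<Longrightarrow> proportional y w \<Longrightarrow> proportional y (\<lambda>l. v l + w l)"
proof -
  assume "proportional y v" "proportional y w"
  then obtain a b where "\<forall>l. v l = a * of_real (y l)" "\<forall>l. w l = b * of_real (y l)" by (auto simp: proportional_def)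
  then show ?thesis unfolding proportional_def by (intro exI[of _ "a + b"]) (simp add: distrib_right)
qed
lemma proportional_scale: "proportional y v \<Longrightarrow> proportional y (\<lambda>l. c * v l)"
  unfolding proportional_def by (metis mult.assoc)
lemma proportional_diff: "proportional y v \<Longrightarrow> proportional y w \<Longrightarrow> proportional y (\<lambda>l. v l - w l)"
  using proportional_add[of y v "\<lambda>l. -1 * w l"] proportional_scale[of y w "-1"] by simp

definition polar :: "real^'n^'n \<Rightarrow> complex^'n \<Rightarrow> complex^'n::finite \<Rightarrow> complex" where
  "polar M z w = (\<Sum>i\<in>UNIV. \<Sum>j\<in>UNIV. of_real (M $ i $ j) * (z $ i * w $ j))"

lemma polar_add_left: "polar M (z + z') w = polar M z w + polar M z' w"
  by (simp add: polar_def algebra_simps sum.distrib)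
lemma polar_scale_left: "polar M (c *s z) w = c * polar M z w"
  by (simp add: polar_def sum_distrib_left mult_ac)
lemma polar_sym: "transpose M = M \<Longrightarrow> polar M z w = polar M w z"
proof -
  assume t: "transpose M = M"
  have sym: "M $ i $ j = M $ j $ i" for i j
    using arg_cong[OF t, of "\<lambda>A. A $ j $ i"] by (simp add: transpose_def)
  show ?thesis unfolding polar_def by (subst sum.swap) (intro sum.cong refl, subst sym, simp add: mult_ac)
qed
lemma psubst_quad_form_polar: "psubst (($) z) (quad_form M) = polar M z z"
  by (simp add: psubst_quad_form polar_def scaleR_conv_of_real)

text \<open>
  At a common zero all members of the ideal vanish, among them a power of every variable.
\<close>

lemma primary_zero:
  fixes z :: "complex^'n::finite"
  assumes "primary_to_origin B" "\<And>b. b \<in> B \<Longrightarrow> psubst (($) z) b = 0"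
  shows "z = 0"
proof -
  have "z $ i = 0" for i
  proof -
    obtain D where D: "X i ^ D \<in> ideal.span B" using assms(1) by (auto simp: primary_to_origin_def)
    have "psubst (($) z) f = 0" if "f \<in> ideal.span B" for f
      using that by (induction f rule: ideal.span_induct_alt) (auto simp: psubst_add psubst_mult assms(2))
    from this[OF D] show ?thesis by (simp add: psubst_power)
  qed
  then show ?thesis by (simp add: vec_eq_iff)
qed

text \<open>
  The fibre over a fixed generic \<open>y\<close> together with what the geometric arguments use: the quadrics have no
  common zero but the origin, are algebraically independent, and the fibre has its full number of points.
\<close>

locale simple_fibre =
  fixes q :: "4 \<Rightarrow> 4 real_mpoly" and M :: "4 \<Rightarrow> real^4^4" and y :: "4 \<Rightarrow> real"
  assumes q: "\<And>l. q l = quad_form (M l)" and M: "\<And>l. transpose (M l) = M l"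
    and prim: "primary_to_origin (range q)" and indep: "\<And>P :: 4 real_mpoly. psubst q P = 0 \<Longrightarrow> P = 0"
    and y0: "y 0 \<noteq> 0" and fin: "finite (fibre q y)" and card16: "card (fibre q y) = 16"
begin

text \<open>
  The cone over the fibre, that is, the common zeros of the net of all forms \<open>\<Sum>\<^sub>l b\<^sub>l q\<^sub>l\<close> with \<open>\<Sum>\<^sub>l b\<^sub>l y\<^sub>l = 0\<close>.
  Its lines are the points of the base locus.
\<close>

definition base :: "complex^4 \<Rightarrow> bool" where
  "base z \<longleftrightarrow> proportional y (\<lambda>l. polar (M l) z z)"

lemma fibre_base: "z \<in> fibre q y \<Longrightarrow> base z"
  unfolding base_def proportional_def fibre_def by (intro exI[of _ 1]) (simp add: q psubst_quad_form_polar)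

text \<open>
  The factor of proportionality is nonzero, as the quadrics have no common zero but the origin, so scaling by
  an inverse square root of it leads into the fibre.
\<close>

lemma base_normalize:
  assumes "base z" "z \<noteq> 0"
  shows "\<exists>c. c \<noteq> 0 \<and> c *s z \<in> fibre q y"
proof -
  obtain k where k: "\<And>l. polar (M l) z z = k * of_real (y l)" using assms by (auto simp: base_def proportional_def)
  have "k \<noteq> 0"
  proof
    assume "k = 0"
    then have "z = 0" using k by (intro primary_zero[OF prim]) (auto simp: q psubst_quad_form_polar)
    with assms show False by simp
  qed
  define c where "c = 1 / csqrt k"
  have c: "c \<noteq> 0" "c * c * k = 1" using \<open>k \<noteq> 0\<close> 
    by (auto simp: c_def power2_csqrt power_divide simp flip: power2_eq_square)
  have "polar (M l) (c *s z) (c *s z) = of_real (y l)" for l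
  proof -
    have "polar (M l) (c *s z) (c *s z) = (c * c) * polar (M l) z z"
      using polar_sym[OF M, of l z "c *s z"] by (simp add: polar_scale_left mult.assoc)
    also have "\<dots> = (c * c * k) * of_real (y l)" by (simp add: k)
    finally show ?thesis using c by simp
  qed
  then show ?thesis using c by (intro exI[of _ c]) (simp add: fibre_def q psubst_quad_form_polar)
qed

text \<open>
  The base locus is finite as a set of projective points, since its lines can be represented in the fibre.
\<close>

lemma no_infinite_base_family:
  assumes "infinite T" "\<And>t. t \<in> T \<Longrightarrow> base (g t)" "\<And>t. t \<in> T \<Longrightarrow> g t \<noteq> 0"
    and "\<And>s t c. s \<in> T \<Longrightarrow> t \<in> T \<Longrightarrow> g s = c *s g t \<Longrightarrow> s = t"
  shows False
proof -
  have "\<forall>t\<in>T. \<exists>c. c \<noteq> 0 \<and> c *s g t \<in> fibre q y" using base_normalize assms(2,3) by blast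
  then obtain c where c: "\<And>t. t \<in> T \<Longrightarrow> c t \<noteq> 0 \<and> c t *s g t \<in> fibre q y" by metis
  have "inj_on (\<lambda>t. c t *s g t) T"
  proof (rule inj_onI)
    fix s t assume st: "s \<in> T" "t \<in> T" "c s *s g s = c t *s g t"
    then have "(1 / c s) *s (c s *s g s) = (1 / c s) *s (c t *s g t)" by simp
    then have "g s = (c t / c s) *s g t" using c[OF st(1)] by (simp add: vector_smult_assoc)
    then show "s = t" using assms(4) st by blast
  qed
  moreover have "(\<lambda>t. c t *s g t) ` T \<subseteq> fibre q y" using c by blast
  ultimately show False using fin assms(1) by (meson finite_imageD finite_subset)
qed

lemma polar_lin2:
  "polar (M l) (a *s u + b *s v) (a *s u + b *s v) = a^2 * polar (M l) u u + 2 * a * b * polar (M l) u v + b^2 * polar (M l) v v"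
proof -
  have r: "polar (M l) x (a *s u + b *s v) = a * polar (M l) u x + b * polar (M l) v x" for x
    by (subst polar_sym[OF M]) (simp add: polar_add_left polar_scale_left)
  show ?thesis unfolding r using polar_sym[OF M, of l v u]
    by (simp add: polar_add_left polar_scale_left power2_eq_square algebra_simps)
qed

text \<open>
  On the plane spanned by \<open>u\<close> and \<open>v\<close> only the mixed terms \<open>polar (M l) u v\<close> can fail to be proportional to \<open>y\<close>. One
  further point makes them proportional to \<open>y\<close>, and then the whole line through \<open>u\<close> and \<open>v\<close> lies in the base locus.
\<close>

lemma no_three_on_line:
  assumes "base u" "base v" "base (a *s u + b *s v)" "a \<noteq> 0" "b \<noteq> 0"
    and ind: "\<And>\<alpha> \<beta>. \<alpha> *s u + \<beta> *s v = 0 \<Longrightarrow> \<alpha> = 0 \<and> \<beta> = 0"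
  shows False
proof -
  have "proportional y (\<lambda>l. polar (M l) (a *s u + b *s v) (a *s u + b *s v) - (a^2 * polar (M l) u u + b^2 * polar (M l) v v))"
    using assms(1-3) unfolding base_def by (intro proportional_diff proportional_add proportional_scale)
  then have "proportional y (\<lambda>l. 2 * a * b * polar (M l) u v)" by (simp add: polar_lin2)
  then have "proportional y (\<lambda>l. (1 / (2 * a * b)) * (2 * a * b * polar (M l) u v))" by (rule proportional_scale)
  then have uv: "proportional y (\<lambda>l. polar (M l) u v)" using assms(4,5) by simp
  have bt: "base (1 *s u + t *s v)" for t
    unfolding base_def polar_lin2 using assms(1,2) uv unfolding base_def by (intro proportional_add proportional_scale)
  show False
  proof (rule no_infinite_base_family[where T = UNIV and g = "\<lambda>t. 1 *s u + t *s v"])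
    show "base (1 *s u + t *s v)" for t by (rule bt)
    show "1 *s u + t *s v \<noteq> 0" for t using ind[of 1 t] by auto
    fix s t c assume "1 *s u + s *s v = c *s (1 *s u + t *s v)"
    then have "(1 - c) *s u + (s - c * t) *s v = 0" by (simp add: vec_eq_iff algebra_simps)
    from ind[OF this] show "s = t" by simp
  qed (simp_all add: infinite_UNIV_char_0)
qed

lemma polar_lin3:
  "polar (M l) (a *s u + b *s v + c *s w) (a *s u + b *s v + c *s w) =
     (a^2 * polar (M l) u u + b^2 * polar (M l) v v + c^2 * polar (M l) w w)
     + 2 * (a * b * polar (M l) u v + a * c * polar (M l) u w + b * c * polar (M l) v w)"
proof -
  have r: "polar (M l) x (a *s u + b *s v + c *s w) = a * polar (M l) u x + b * polar (M l) v x + c * polar (M l) w x" for x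
    by (subst polar_sym[OF M]) (simp add: polar_add_left polar_scale_left)
  show ?thesis unfolding r using polar_sym[OF M, of l v u] polar_sym[OF M, of l w u] polar_sym[OF M, of l w v]
    by (simp add: polar_add_left polar_scale_left power2_eq_square algebra_simps)
qed

text \<open>
  In the coordinates given by the three points \<open>u\<close>, \<open>v\<close>, \<open>w\<close> the net consists of conics through the vertices of the
  coordinate triangle, and a point with nonzero coordinates \<open>c\<close> satisfies them iff \<open>1 / c\<close> satisfies linear
  equations: the standard quadratic transformation straightens these conics to lines. Hence, with two points on them,
  they share the image of the whole line through \<open>1 / a\<close> and \<open>1 / b\<close>, an infinite set.
\<close>

lemma no_five_on_plane:
  assumes "base u" "base v" "base w" "base (a1 *s u + a2 *s v + a3 *s w)" "base (b1 *s u + b2 *s v + b3 *s w)"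
    and nz: "a1 \<noteq> 0" "a2 \<noteq> 0" "a3 \<noteq> 0" "b1 \<noteq> 0" "b2 \<noteq> 0" "b3 \<noteq> 0"
    and np: "\<And>c. \<not> (b1 = c * a1 \<and> b2 = c * a2 \<and> b3 = c * a3)"
    and ind: "\<And>\<alpha> \<beta> \<gamma>. \<alpha> *s u + \<beta> *s v + \<gamma> *s w = 0 \<Longrightarrow> \<alpha> = 0 \<and> \<beta> = 0 \<and> \<gamma> = 0"
  shows False
proof -
  have key: "proportional y (\<lambda>l. (1/c3) * polar (M l) u v + (1/c2) * polar (M l) u w + (1/c1) * polar (M l) v w)"
    if "base (c1 *s u + c2 *s v + c3 *s w)" "c1 \<noteq> 0" "c2 \<noteq> 0" "c3 \<noteq> 0" for c1 c2 c3
  proof -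
    let ?z = "c1 *s u + c2 *s v + c3 *s w"
    have "proportional y (\<lambda>l. (1 / (2 * c1 * c2 * c3)) * (polar (M l) ?z ?z - (c1^2 * polar (M l) u u + c2^2 * polar (M l) v v + c3^2 * polar (M l) w w)))"
      using assms(1-3) that(1) unfolding base_def by (intro proportional_scale proportional_diff proportional_add)
    moreover have "(1 / (2 * c1 * c2 * c3)) * (polar (M l) ?z ?z - (c1^2 * polar (M l) u u + c2^2 * polar (M l) v v + c3^2 * polar (M l) w w))
       = (1/c3) * polar (M l) u v + (1/c2) * polar (M l) u w + (1/c1) * polar (M l) v w" for l
      unfolding polar_lin3 using that(2-4) by (simp add: field_simps)
    ultimately show ?thesis by simp
  qed
  (* The line through 1 / a and 1 / b, whose points are inverted coordinatewise in g below; values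
     of t with a vanishing coordinate are left out. *)
  define s1 s2 s3 where "s1 t = 1/a1 + t * (1/b1)" "s2 t = 1/a2 + t * (1/b2)" "s3 t = 1/a3 + t * (1/b3)" for t
  define T where "T = {t. s1 t \<noteq> 0 \<and> s2 t \<noteq> 0 \<and> s3 t \<noteq> 0}"
  have "- T \<subseteq> {- b1 / a1, - b2 / a2, - b3 / a3}"
    using nz by (auto simp: T_def s1_s2_s3_def field_simps eq_neg_iff_add_eq_0)
  then have infT: "infinite T"
    by (metis (no_types) finite.emptyI finite_insert finite_subset infinite_UNIV_char_0 finite_compl)
  define g where "g t = (1 / s1 t) *s u + (1 / s2 t) *s v + (1 / s3 t) *s w" for t
  show False
  proof (rule no_infinite_base_family[OF infT, of g])
    fix t assume t: "t \<in> T"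
    then have n: "s1 t \<noteq> 0" "s2 t \<noteq> 0" "s3 t \<noteq> 0" by (auto simp: T_def)
    show "g t \<noteq> 0" using ind[of "1 / s1 t" "1 / s2 t" "1 / s3 t"] n by (auto simp: g_def)
    (* The linear conditions satisfied by 1 / a and 1 / b; a combination of them is the condition
       for the coordinates of g t. *)
    define kA kB where "kA l = (1/a3) * polar (M l) u v + (1/a2) * polar (M l) u w + (1/a1) * polar (M l) v w"
      and "kB l = (1/b3) * polar (M l) u v + (1/b2) * polar (M l) u w + (1/b1) * polar (M l) v w" for l
    have "proportional y kA" "proportional y kB" using key[OF assms(4) nz(1-3)] key[OF assms(5) nz(4-6)] unfolding kA_def kB_def .
    then have P: "proportional y (\<lambda>l. ((1 / s1 t)^2 * polar (M l) u u + (1 / s2 t)^2 * polar (M l) v v + (1 / s3 t)^2 * polar (M l) w w)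
       + (2 / (s1 t * s2 t * s3 t)) * (kA l + t * kB l))"
      using assms(1-3) unfolding base_def by (intro proportional_add proportional_scale)
    have "(2 / (s1 t * s2 t * s3 t)) * (kA l + t * kB l)
       = 2 * ((1 / s1 t) * (1 / s2 t) * polar (M l) u v + (1 / s1 t) * (1 / s3 t) * polar (M l) u w + (1 / s2 t) * (1 / s3 t) * polar (M l) v w)" for l
    proof -
      have "kA l + t * kB l = s3 t * polar (M l) u v + s2 t * polar (M l) u w + s1 t * polar (M l) v w"
        by (simp add: kA_def kB_def s1_s2_s3_def algebra_simps)
      moreover have "(2 / (s1 t * s2 t * s3 t)) * (s3 t * x1 + s2 t * x2 + s1 t * x3)
         = 2 * ((1 / s1 t) * (1 / s2 t) * x1 + (1 / s1 t) * (1 / s3 t) * x2 + (1 / s2 t) * (1 / s3 t) * x3)" for x1 x2 x3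
        using n by (simp add: field_simps)
      ultimately show ?thesis by (simp only:)
    qed
    with P show "base (g t)" unfolding base_def g_def polar_lin3 by (simp only:)
  next
    fix s t c assume st: "s \<in> T" "t \<in> T" "g s = c *s g t"
    then have n: "s1 t \<noteq> 0" "s2 t \<noteq> 0" "s3 t \<noteq> 0" "s1 s \<noteq> 0" "s2 s \<noteq> 0" "s3 s \<noteq> 0" by (auto simp: T_def)
    have "(1 / s1 s - c / s1 t) *s u + (1 / s2 s - c / s2 t) *s v + (1 / s3 s - c / s3 t) *s w = 0"
      using st(3) by (simp add: g_def vec_eq_iff algebra_simps)
    from ind[OF this] have e: "s1 t = c * s1 s" "s2 t = c * s2 s" "s3 t = c * s3 s" using n by (simp_all add: field_simps)
    then have e': "(1 - c) / a1 + (t - c * s) / b1 = 0" "(1 - c) / a2 + (t - c * s) / b2 = 0" "(1 - c) / a3 + (t - c * s) / b3 = 0"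
      by (simp_all add: s1_s2_s3_def diff_divide_distrib algebra_simps)
    have "c = 1"
    proof (rule ccontr)
      assume "c \<noteq> 1"
      let ?k = "- (t - c * s) / (1 - c)"
      have "b1 = ?k * a1 \<and> b2 = ?k * a2 \<and> b3 = ?k * a3"
        using e' nz \<open>c \<noteq> 1\<close> by (simp add: field_simps)
      then show False using np by blast
    qed
    then show "s = t" using e'(1) nz by simp
  qed
qed

end

section \<open>Separating points of the base locus by quadrics\<close>

lemma polyfun_subspace_lin:
  assumes "subspace I" "f \<in> polyfun I" "g \<in> polyfun I"
  shows "(\<lambda>z. a * f z + b * g z) \<in> polyfun I"
proof -
  obtain u v where f: "u \<in> I" "v \<in> I" "\<And>z. f z = psubst (($) z) u + \<i> * psubst (($) z) v" using assms(2) by (rule polyfunE) blast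
  obtain u' v' where g: "u' \<in> I" "v' \<in> I" "\<And>z. g z = psubst (($) z) u' + \<i> * psubst (($) z) v'" using assms(3) by (rule polyfunE) blast
  show ?thesis
  proof (rule polyfunI)
    show "(Re a *\<^sub>R u - Im a *\<^sub>R v) + (Re b *\<^sub>R u' - Im b *\<^sub>R v') \<in> I" "(Re a *\<^sub>R v + Im a *\<^sub>R u) + (Re b *\<^sub>R v' + Im b *\<^sub>R u') \<in> I"
      using f g assms(1) by (auto intro!: subspace_add subspace_diff subspace_scale)
    show "a * f z + b * g z = psubst (($) z) ((Re a *\<^sub>R u - Im a *\<^sub>R v) + (Re b *\<^sub>R u' - Im b *\<^sub>R v')) +
       \<i> * psubst (($) z) ((Re a *\<^sub>R v + Im a *\<^sub>R u) + (Re b *\<^sub>R v' + Im b *\<^sub>R u'))" for z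
      unfolding f(3) g(3) psubst_add psubst_diff psubst_scaleR
      by (simp add: complex_eq_iff algebra_simps)
  qed
qed

lemma polyfun_subspace_sum:
  assumes "subspace I" "\<And>a. a \<in> A \<Longrightarrow> f a \<in> polyfun I"
  shows "(\<lambda>z. \<Sum>a\<in>A. c a * f a z) \<in> polyfun I"
  using assms(2)
proof (induction A rule: infinite_finite_induct)
  case (insert x F)
  then show ?case using polyfun_subspace_lin[OF assms(1), of "f x" "\<lambda>z. \<Sum>a\<in>F. c a * f a z" "c x" 1] by simp
qed (auto intro!: polyfunI[of 0 _ 0] simp: subspace_0[OF assms(1)])

lemma polyfun_forms_scale: "f \<in> polyfun (forms d) \<Longrightarrow> (\<lambda>z. c * f z) \<in> polyfun (forms d)"
  using polyfun_subspace_lin[OF subspace_forms, of f d f c 0] by simp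

lemma polyfun_forms_mult:
  assumes "f \<in> polyfun (forms d)" "g \<in> polyfun (forms e)"
  shows "(\<lambda>z. f z * g z) \<in> polyfun (forms (d + e))"
proof -
  obtain u v where f: "u \<in> forms d" "v \<in> forms d" "\<And>z. f z = psubst (($) z) u + \<i> * psubst (($) z) v" using assms(1) by (rule polyfunE) blast
  obtain u' v' where g: "u' \<in> forms e" "v' \<in> forms e" "\<And>z. g z = psubst (($) z) u' + \<i> * psubst (($) z) v'" using assms(2) by (rule polyfunE) blast
  have i: "\<i> * (\<i> * x) = - x" for x :: complex by (simp flip: mult.assoc)
  show ?thesis
  proof (rule polyfunI[of "u * u' - v * v'" _ "u * v' + v * u'"])
    show "u * u' - v * v' \<in> forms (d + e)" "u * v' + v * u' \<in> forms (d + e)"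
      using f g by (auto intro!: forms_add forms_diff forms_mult)
  qed (simp add: f g psubst_add psubst_diff psubst_mult algebra_simps i)
qed

lemma linear_form_polyfun: "(\<lambda>z :: complex^'n::finite. \<Sum>i\<in>UNIV. \<alpha> i * z $ i) \<in> polyfun (forms 1)"
proof (rule polyfun_subspace_sum[OF subspace_forms])
  show "(\<lambda>z :: complex^'n. z $ i) \<in> polyfun (forms 1)" for i
    by (rule polyfunI[of "X i" _ 0]) auto
qed

lemma card_quadratic_monomials: "finite {m :: 4 \<Rightarrow>\<^sub>0 nat. mdeg m = 2}" "card {m :: 4 \<Rightarrow>\<^sub>0 nat. mdeg m = 2} = 10"
proof -
  have e: "{m :: 4 \<Rightarrow>\<^sub>0 nat. mdeg m = 2} = Mon UNIV 2 - Mon UNIV 1" by (auto simp: Mon_def)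
  have "Mon UNIV 1 \<subseteq> (Mon UNIV 2 :: (4 \<Rightarrow>\<^sub>0 nat) set)" by (auto simp: Mon_def)
  then show "card {m :: 4 \<Rightarrow>\<^sub>0 nat. mdeg m = 2} = 10" "finite {m :: 4 \<Rightarrow>\<^sub>0 nat. mdeg m = 2}"
    unfolding e using Mon_count[of "UNIV :: 4 set" 2] Mon_count[of "UNIV :: 4 set" 1]
    by (simp_all add: card_Diff_subset binomial_fact' fact_numeral)
qed

text \<open>
  Quadrics in four variables form a space of dimension ten.
\<close>

lemma eleven_quadrics_dependent:
  fixes f :: "'i \<Rightarrow> complex^4 \<Rightarrow> complex"
  assumes "finite I" "card I > 10" "\<And>i. i \<in> I \<Longrightarrow> f i \<in> polyfun (forms 2)"
  shows "\<exists>c. (\<exists>i\<in>I. c i \<noteq> 0) \<and> (\<forall>z. (\<Sum>i\<in>I. c i * f i z) = 0)"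
proof -
  let ?N = "{m :: 4 \<Rightarrow>\<^sub>0 nat. mdeg m = 2}"
  have "\<forall>i\<in>I. \<exists>L. \<forall>z. f i z = (\<Sum>m\<in>?N. L m * mon_value (($) z) m)"
  proof
    fix i assume "i \<in> I"
    then have "f i \<in> polyfun (forms 2)" by (rule assms(3))
    then obtain u v where uv: "u \<in> forms 2" "v \<in> forms 2" "\<And>z. f i z = psubst (($) z) u + \<i> * psubst (($) z) v" by (rule polyfunE) blast
    have e: "psubst (($) z) w = (\<Sum>m\<in>?N. of_real (Poly_Mapping.lookup w m) * mon_value (($) z) m)" if "w \<in> forms 2" for w and z :: "complex^4"
    proof -
      have "Poly_Mapping.keys w \<subseteq> ?N" using that by (auto simp: forms_iff)
      then show ?thesis using psubst_sum[of ?N w "($) z"] card_quadratic_monomials(1) by (simp add: scaleR_conv_of_real)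
    qed
    show "\<exists>L. \<forall>z. f i z = (\<Sum>m\<in>?N. L m * mon_value (($) z) m)"
      by (intro exI[of _ "\<lambda>m. of_real (Poly_Mapping.lookup u m) + \<i> * of_real (Poly_Mapping.lookup v m)"] allI)
         (simp add: uv(3) e[OF uv(1)] e[OF uv(2)] distrib_right sum.distrib sum_distrib_left mult.assoc)
  qed
  then obtain L where L: "\<And>i z. i \<in> I \<Longrightarrow> f i z = (\<Sum>m\<in>?N. L i m * mon_value (($) z) m)" by metis
  have "card ?N < card I" using assms(2) card_quadratic_monomials by simp
  then obtain c where c: "\<exists>i\<in>I. c i \<noteq> 0" "\<And>m. m \<in> ?N \<Longrightarrow> (\<Sum>i\<in>I. c i * L i m) = 0"
    using homogeneous_system_nontrivial_solution[OF card_quadratic_monomials(1) assms(1), of L] by blast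
  have "(\<Sum>i\<in>I. c i * f i z) = (\<Sum>i\<in>I. \<Sum>m\<in>?N. c i * L i m * mon_value (($) z) m)" for z
    by (intro sum.cong refl) (simp add: L sum_distrib_left mult.assoc)
  also have "\<dots> z = (\<Sum>m\<in>?N. (\<Sum>i\<in>I. c i * L i m) * mon_value (($) z) m)" for z
    by (subst sum.swap) (simp add: sum_distrib_right)
  finally have "(\<Sum>i\<in>I. c i * f i z) = 0" for z using c(2) by simp
  then show ?thesis using c(1) by blast
qed

text \<open>
  For four vectors this says that their projective points are coplanar.
\<close>

definition lin_dep :: "(complex^4) set \<Rightarrow> bool" where
  "lin_dep P \<longleftrightarrow> (\<exists>x. (\<exists>p\<in>P. x p \<noteq> 0) \<and> (\<Sum>p\<in>P. x p *s p) = 0)"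

text \<open>
  A plane through the points of \<open>T\<close>: if it contained \<open>z0\<close> too, then the four points would satisfy a nontrivial linear
  equation and so be dependent.
\<close>

lemma plane_missing_point:
  fixes z0 :: "complex^4"
  assumes "finite T" "card T = 3" "z0 \<notin> T" "\<not> lin_dep (insert z0 T)"
  shows "\<exists>\<alpha>. (\<forall>p\<in>T. (\<Sum>i\<in>UNIV. \<alpha> i * p $ i) = 0) \<and> (\<Sum>i\<in>UNIV. \<alpha> i * z0 $ i) \<noteq> 0"
proof -
  have "card T < card (UNIV :: 4 set)" using assms by simp
  then obtain \<alpha> :: "4 \<Rightarrow> complex" and k where \<alpha>: "\<alpha> k \<noteq> 0" "\<And>p. p \<in> T \<Longrightarrow> (\<Sum>i\<in>UNIV. \<alpha> i * p $ i) = 0"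
    using homogeneous_system_nontrivial_solution[OF assms(1) finite, of "UNIV :: 4 set" "\<lambda>i p. p $ i"] by auto
  have "(\<Sum>i\<in>UNIV. \<alpha> i * z0 $ i) \<noteq> 0"
  proof
    assume z: "(\<Sum>i\<in>UNIV. \<alpha> i * z0 $ i) = 0"
    let ?P = "insert z0 T"
    have "card (UNIV - {k}) < card ?P" using assms by (simp add: card_Diff_singleton)
    then obtain x where x: "\<exists>p\<in>?P. x p \<noteq> 0" "\<And>i. i \<in> UNIV - {k} \<Longrightarrow> (\<Sum>p\<in>?P. x p * p $ i) = 0"
      using homogeneous_system_nontrivial_solution[of "UNIV - {k}" ?P "\<lambda>p i. p $ i"] assms(1) by auto
    have "(\<Sum>i\<in>UNIV. \<alpha> i * (\<Sum>p\<in>?P. x p * p $ i)) = (\<Sum>p\<in>?P. x p * (\<Sum>i\<in>UNIV. \<alpha> i * p $ i))"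
      unfolding sum_distrib_left by (subst sum.swap) (simp add: mult_ac)
    also have "\<dots> = 0" using z \<alpha>(2) by (intro sum.neutral) auto
    finally have "(\<Sum>i\<in>UNIV. \<alpha> i * (\<Sum>p\<in>?P. x p * p $ i)) = 0" .
    moreover have "(\<Sum>i\<in>UNIV. \<alpha> i * (\<Sum>p\<in>?P. x p * p $ i)) = \<alpha> k * (\<Sum>p\<in>?P. x p * p $ k)"
      using x(2) by (subst sum.remove[of UNIV k]) auto
    ultimately have "(\<Sum>p\<in>?P. x p * p $ k) = 0" using \<alpha>(1) by simp
    then have "(\<Sum>p\<in>?P. x p * p $ i) = 0" for i using x(2)[of i] by (cases "i = k") auto
    then have "(\<Sum>p\<in>?P. x p *s p) = 0" by (simp add: vec_eq_iff)
    then show False using x(1) assms(4) by (auto simp: lin_dep_def)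
  qed
  with \<alpha>(2) show ?thesis by blast
qed

context simple_fibre
begin

lemma fibre_polar: "z \<in> fibre q y \<longleftrightarrow> (\<forall>l. polar (M l) z z = of_real (y l))"
  by (simp add: fibre_def q psubst_quad_form_polar)

lemma fibre_nonzero: "z \<in> fibre q y \<Longrightarrow> z \<noteq> 0"
  using y0 by (auto simp: fibre_polar polar_def)

lemma polar_scale_both: "polar (M l) (k *s w) (k *s w) = k * k * polar (M l) w w"
  using polar_sym[OF M, of l w "k *s w"] by (simp add: polar_scale_left mult.assoc)

lemma fibre_proportional:
  assumes "z \<in> fibre q y" "w \<in> fibre q y" "z = k *s w"
  shows "z = w \<or> z = - w"
proof -
  have "k * k * of_real (y 0) = of_real (y 0)"
    using assms(1,2) unfolding assms(3) fibre_polar polar_scale_both by metis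
  then have "k * k = 1" using y0 by simp
  then have "k = 1 \<or> k = -1" by (metis power2_eq_1_iff power2_eq_square)
  then show ?thesis using assms(3) by auto
qed

lemma fibre_uminus: "z \<in> fibre q y \<Longrightarrow> - z \<in> fibre q y"
  using polar_scale_both[of _ "-1" z] by (simp add: fibre_polar)

text \<open>
  A set of points of the fibre that are pairwise distinct as projective points: by \<open>fibre_proportional\<close> two points of
  the fibre span the same line only if they agree up to sign.
\<close>

definition distinct_lines :: "(complex^4) set \<Rightarrow> bool" where
  "distinct_lines P \<longleftrightarrow> P \<subseteq> fibre q y \<and> (\<forall>z\<in>P. \<forall>w\<in>P. z \<noteq> - w)"

lemma distinct_lines_subset: "distinct_lines P \<Longrightarrow> S \<subseteq> P \<Longrightarrow> distinct_lines S"
  by (auto simp: distinct_lines_def)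

lemma independent_pair:
  assumes "distinct_lines {u, v}" "u \<noteq> v" "a *s u + b *s v = 0"
  shows "a = 0 \<and> b = 0"
proof -
  have uv: "u \<in> fibre q y" "v \<in> fibre q y" "u \<noteq> - v" "v \<noteq> - u" using assms(1) by (auto simp: distinct_lines_def)
  have a: "a = 0"
  proof (rule ccontr)
    assume "a \<noteq> 0"
    then have "u = (- b / a) *s v" using assms(3) by (simp add: vec_eq_iff field_simps eq_neg_iff_add_eq_0)
    then show False using fibre_proportional[OF uv(1,2)] uv assms(2) by blast
  qed
  then have "b *s v = 0" using assms(3) by simp
  then show ?thesis using a fibre_nonzero[OF uv(2)] by (simp add: vector_mul_eq_0)
qed

lemma independent_triple:
  assumes "distinct_lines {u, v, w}" "u \<noteq> v" "u \<noteq> w" "v \<noteq> w" "a *s u + b *s v + c *s w = 0"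
  shows "a = 0 \<and> b = 0 \<and> c = 0"
proof -
  have sub: "distinct_lines {u, v}" "distinct_lines {u, w}" "distinct_lines {v, w}"
    using assms(1) by (auto intro: distinct_lines_subset)
  have bs: "base u" "base v" "base w" using assms(1) fibre_base by (auto simp: distinct_lines_def)
  have "c = 0"
  proof (rule ccontr)
    assume c: "c \<noteq> 0"
    then have w: "w = (- a / c) *s u + (- b / c) *s v"
      using assms(5) by (simp add: vec_eq_iff field_simps eq_neg_iff_add_eq_0)
    have "a \<noteq> 0" using independent_pair[OF sub(3) assms(4), of b c] assms(5) c by auto
    moreover have "b \<noteq> 0" using independent_pair[OF sub(2) assms(3), of a c] assms(5) c by auto
    ultimately show False
      using no_three_on_line[OF bs(1,2), of "- a / c" "- b / c"] bs(3) c independent_pair[OF sub(1) assms(2)] unfolding w[symmetric]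
      by simp
  qed
  then show ?thesis using independent_pair[OF sub(1) assms(2), of a b] assms(5) by simp
qed

text \<open>
  Three points of the base locus span a plane, which contains at most one further point.
\<close>

lemma coplanar_fourth_point_unique:
  assumes "distinct_lines {u, v, w, a, b}" and d: "distinct [u, v, w, a, b]"
    and dep: "lin_dep {u, v, w, a}" "lin_dep {u, v, w, b}"
  shows False
proof -
  have comb: "\<exists>c1 c2 c3. x = c1 *s u + c2 *s v + c3 *s w \<and> c1 \<noteq> 0 \<and> c2 \<noteq> 0 \<and> c3 \<noteq> 0"
    if x: "x \<in> {a, b}" for x
  proof -
    have dx: "x \<noteq> u" "x \<noteq> v" "x \<noteq> w" "u \<noteq> v" "u \<noteq> w" "v \<noteq> w" using x d by auto
    have sub: "distinct_lines {u, v, w}" "distinct_lines {x, v, w}" "distinct_lines {x, u, w}" "distinct_lines {x, u, v}"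
      using assms(1) x by (auto intro: distinct_lines_subset)
    have "lin_dep {u, v, w, x}" using dep x by auto
    then obtain k where k: "\<exists>p\<in>{u, v, w, x}. k p \<noteq> 0" "k u *s u + k v *s v + k w *s w + k x *s x = 0"
      using dx by (auto simp: lin_dep_def add.assoc)
    have kx: "k x \<noteq> 0"
    proof
      assume "k x = 0"
      then show False using independent_triple[OF sub(1), of "k u" "k v" "k w"] k dx by auto
    qed
    have 1: "k u \<noteq> 0" using independent_triple[OF sub(2), of "k x" "k v" "k w"] k(2) kx dx by (auto simp: algebra_simps)
    have 2: "k v \<noteq> 0" using independent_triple[OF sub(3), of "k x" "k u" "k w"] k(2) kx dx by (auto simp: algebra_simps)
    have 3: "k w \<noteq> 0" using independent_triple[OF sub(4), of "k x" "k u" "k v"] k(2) kx dx by (auto simp: algebra_simps)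
    have "x = (- k u / k x) *s u + (- k v / k x) *s v + (- k w / k x) *s w"
      using k(2) kx by (simp add: vec_eq_iff field_simps eq_neg_iff_add_eq_0)
    then show ?thesis using 1 2 3 kx by (intro exI[of _ "- k u / k x"] exI[of _ "- k v / k x"] exI[of _ "- k w / k x"]) simp
  qed
  obtain a1 a2 a3 where a: "a = a1 *s u + a2 *s v + a3 *s w" "a1 \<noteq> 0" "a2 \<noteq> 0" "a3 \<noteq> 0" using comb[of a] by blast
  obtain b1 b2 b3 where b: "b = b1 *s u + b2 *s v + b3 *s w" "b1 \<noteq> 0" "b2 \<noteq> 0" "b3 \<noteq> 0" using comb[of b] by blast
  have bs: "base u" "base v" "base w" "base a" "base b" using assms(1) fibre_base by (auto simp: distinct_lines_def)
  show False
  proof (rule no_five_on_plane[OF bs(1-3) bs(4)[unfolded a(1)] bs(5)[unfolded b(1)] a(2-4) b(2-4)])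
    fix c
    show "\<not> (b1 = c * a1 \<and> b2 = c * a2 \<and> b3 = c * a3)"
    proof
      assume "b1 = c * a1 \<and> b2 = c * a2 \<and> b3 = c * a3"
      then have "b = c *s a" by (simp add: a(1) b(1) vec_eq_iff algebra_simps)
      then have "b = a \<or> b = - a" using fibre_proportional assms(1) by (auto simp: distinct_lines_def)
      then show False using assms(1) d by (auto simp: distinct_lines_def)
    qed
  next
    fix \<alpha> \<beta> \<gamma> assume "\<alpha> *s u + \<beta> *s v + \<gamma> *s w = 0"
    then show "\<alpha> = 0 \<and> \<beta> = 0 \<and> \<gamma> = 0"
      using d by (intro independent_triple[OF distinct_lines_subset[OF assms(1)]]) auto
  qed
qed

text \<open>
  A pair of planes, each of them through three of the six other points and missing \<open>z0\<close>. A triple is bad if its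
  plane contains \<open>z0\<close>; two triples with two points in common are not both bad by
  \<open>coplanar_fourth_point_unique\<close>. Among the four splittings \<open>{p1, p2, pi}\<close> and its complement, at most one has a bad
  first part and at most one a bad second part, as the second parts lie in \<open>{p3, p4, p5, p6}\<close>.
\<close>

lemma separating_quadric:
  assumes S: "distinct_lines S" "card S = 7" "z0 \<in> S"
  shows "\<exists>g\<in>polyfun (forms 2). g z0 = 1 \<and> (\<forall>z\<in>S - {z0}. g z = 0)"
proof -
  have fS: "finite S" using S(2) card.infinite by fastforce
  obtain xs where xs: "set xs = S - {z0}" "distinct xs" 
    using finite_distinct_list[of "S - {z0}"] fS by auto
  have "card (S - {z0}) = 6" using S(2,3) fS by (simp add: card_Diff_singleton)
  then have "length xs = 6" using distinct_card[OF xs(2)] unfolding xs(1) by simp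
  then obtain p1 x1 where 1: "xs = p1 # x1" "length x1 = 5" by (cases xs) auto
  then obtain p2 x2 where 2: "x1 = p2 # x2" "length x2 = 4" by (cases x1) auto
  then obtain p3 x3 where 3: "x2 = p3 # x3" "length x3 = 3" by (cases x2) auto
  then obtain p4 x4 where 4: "x3 = p4 # x4" "length x4 = 2" by (cases x3) auto
  then obtain p5 x5 where 5: "x4 = p5 # x5" "length x5 = 1" by (cases x4) auto
  then obtain p6 where 6: "x5 = [p6]" by (cases x5) auto
  have p: "xs = [p1, p2, p3, p4, p5, p6]" using 1 2 3 4 5 6 by simp
  have SS: "S = {z0, p1, p2, p3, p4, p5, p6}" and dist: "distinct [z0, p1, p2, p3, p4, p5, p6]" using xs S(3) unfolding p by auto
  define bad where "bad T \<longleftrightarrow> lin_dep (insert z0 T)" for T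
  have two: "\<not> (bad {a, b, c} \<and> bad {a, b, d})" if "{a, b, c, d} \<subseteq> S" "distinct [z0, a, b, c, d]" for a b c d
    using coplanar_fourth_point_unique[of z0 a b c d] distinct_lines_subset[OF S(1), of "{z0, a, b, c, d}"] that S(3) by (auto simp: bad_def)
  have b1: "\<not> (bad {p1, p2, p3} \<and> bad {p1, p2, p4})" "\<not> (bad {p1, p2, p3} \<and> bad {p1, p2, p5})" "\<not> (bad {p1, p2, p3} \<and> bad {p1, p2, p6})"
    "\<not> (bad {p1, p2, p4} \<and> bad {p1, p2, p5})" "\<not> (bad {p1, p2, p4} \<and> bad {p1, p2, p6})" "\<not> (bad {p1, p2, p5} \<and> bad {p1, p2, p6})"
    by (intro two; use dist in \<open>auto simp: SS\<close>)+
  have b2: "\<not> (bad {p5, p6, p4} \<and> bad {p5, p6, p3})" "\<not> (bad {p4, p6, p5} \<and> bad {p4, p6, p3})" "\<not> (bad {p4, p5, p6} \<and> bad {p4, p5, p3})"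
    "\<not> (bad {p3, p6, p5} \<and> bad {p3, p6, p4})" "\<not> (bad {p3, p5, p6} \<and> bad {p3, p5, p4})" "\<not> (bad {p3, p4, p6} \<and> bad {p3, p4, p5})"
    by (intro two; use dist in \<open>auto simp: SS\<close>)+
  have perm: "{p5, p6, p4} = {p4, p5, p6}" "{p5, p6, p3} = {p3, p5, p6}" "{p4, p6, p5} = {p4, p5, p6}" "{p4, p6, p3} = {p3, p4, p6}"
    "{p4, p5, p3} = {p3, p4, p5}" "{p3, p6, p5} = {p3, p5, p6}" "{p3, p6, p4} = {p3, p4, p6}" "{p3, p5, p4} = {p3, p4, p5}" by auto
  note b2' = b2[unfolded perm]
  have "\<exists>T T'. T \<union> T' = S - {z0} \<and> card T = 3 \<and> card T' = 3 \<and> \<not> bad T \<and> \<not> bad T'"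
  proof -
    have split: "\<exists>T T'. T \<union> T' = S - {z0} \<and> card T = 3 \<and> card T' = 3 \<and> \<not> bad T \<and> \<not> bad T'"
      if "T \<union> T' = S - {z0}" "card T = 3" "card T' = 3" "\<not> bad T" "\<not> bad T'" for T T' using that by blast
    consider "\<not> bad {p1, p2, p3} \<and> \<not> bad {p4, p5, p6}" | "\<not> bad {p1, p2, p4} \<and> \<not> bad {p3, p5, p6}"
      | "\<not> bad {p1, p2, p5} \<and> \<not> bad {p3, p4, p6}" | "\<not> bad {p1, p2, p6} \<and> \<not> bad {p3, p4, p5}"
      using b1 b2' by blast
    then show ?thesis
    proof cases
      case 1 then show ?thesis using dist by (intro split[of "{p1, p2, p3}" "{p4, p5, p6}"]) (auto simp: SS)
    next
      case 2 then show ?thesis using dist by (intro split[of "{p1, p2, p4}" "{p3, p5, p6}"]) (auto simp: SS)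
    next
      case 3 then show ?thesis using dist by (intro split[of "{p1, p2, p5}" "{p3, p4, p6}"]) (auto simp: SS)
    next
      case 4 then show ?thesis using dist by (intro split[of "{p1, p2, p6}" "{p3, p4, p5}"]) (auto simp: SS)
    qed
  qed
  then obtain T T' where T: "T \<union> T' = S - {z0}" "card T = 3" "card T' = 3" "\<not> bad T" "\<not> bad T'" by blast
  have "finite (T \<union> T')" unfolding T(1) using fS by simp
  moreover have "z0 \<notin> T \<union> T'" unfolding T(1) by simp
  ultimately have fT: "finite T" "finite T'" "z0 \<notin> T" "z0 \<notin> T'" by simp_all
  obtain \<alpha> where \<alpha>: "\<forall>p\<in>T. (\<Sum>i\<in>UNIV. \<alpha> i * p $ i) = 0" "(\<Sum>i\<in>UNIV. \<alpha> i * z0 $ i) \<noteq> 0"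
    using plane_missing_point[OF fT(1) T(2) fT(3)] T(4) unfolding bad_def by blast
  obtain \<beta> where \<beta>: "\<forall>p\<in>T'. (\<Sum>i\<in>UNIV. \<beta> i * p $ i) = 0" "(\<Sum>i\<in>UNIV. \<beta> i * z0 $ i) \<noteq> 0"
    using plane_missing_point[OF fT(2) T(3) fT(4)] T(5) unfolding bad_def by blast
  define g where "g z = (\<Sum>i\<in>UNIV. \<alpha> i * z $ i) * (\<Sum>i\<in>UNIV. \<beta> i * z $ i)" for z :: "complex^4"
  have "g \<in> polyfun (forms (1 + 1))" unfolding g_def by (intro polyfun_forms_mult linear_form_polyfun)
  then have g2: "g \<in> polyfun (forms 2)" by (simp only: one_add_one)
  have "(\<lambda>z. (1 / g z0) * g z) \<in> polyfun (forms 2)" by (rule polyfun_forms_scale[OF g2])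
  moreover have "g z0 \<noteq> 0" using \<alpha> \<beta> by (simp add: g_def)
  moreover have "g z = 0" if "z \<in> S - {z0}" for z using that \<alpha>(1) \<beta>(1) unfolding T(1)[symmetric] by (auto simp: g_def)
  ultimately show ?thesis by (intro bexI[of _ "\<lambda>z. (1 / g z0) * g z"]) auto
qed

end

section \<open>The Cayley--Bacharach relation\<close>

context simple_fibre
begin

lemma quadrics_independent:
  assumes "\<And>z :: complex^4. (\<Sum>l\<in>UNIV. c l * psubst (($) z) (q l)) = 0"
  shows "c l = 0"
proof -
  have real0: "r l = 0" if "(\<Sum>l\<in>UNIV. r l *\<^sub>R q l) = 0" for r l
  proof -
    have "psubst q (\<Sum>l\<in>UNIV. r l *\<^sub>R X l) = 0" using that by (simp add: psubst_sum_distrib psubst_scaleR)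
    then have "(\<Sum>l\<in>UNIV. r l *\<^sub>R X l) = (0 :: 4 real_mpoly)" by (rule indep)
    then have "psubst (\<lambda>k. if k = l then 1 else 0) (\<Sum>l\<in>UNIV. r l *\<^sub>R X l) = (0::real)" by simp
    then show ?thesis by (simp add: psubst_sum_distrib psubst_scaleR if_distrib cong: if_cong)
  qed
  have "psubst (($) z) (\<Sum>l\<in>UNIV. Re (c l) *\<^sub>R q l) + \<i> * psubst (($) z) (\<Sum>l\<in>UNIV. Im (c l) *\<^sub>R q l)
     = psubst (($) z) 0 + \<i> * psubst (($) z) 0" for z :: "complex^4"
  proof -
    have "psubst (($) z) (\<Sum>l\<in>UNIV. Re (c l) *\<^sub>R q l) + \<i> * psubst (($) z) (\<Sum>l\<in>UNIV. Im (c l) *\<^sub>R q l)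
      = (\<Sum>l\<in>UNIV. c l * psubst (($) z) (q l))"
      unfolding psubst_sum_distrib psubst_scaleR sum_distrib_left sum.distrib[symmetric]
      by (intro sum.cong refl) (subst (3) complex_eq, simp add: scaleR_conv_of_real algebra_simps)
    then show ?thesis using assms by simp
  qed
  from polyfun_unique[OF this] have "Re (c l) = 0" "Im (c l) = 0"
    using real0[of "\<lambda>l. Re (c l)" l] real0[of "\<lambda>l. Im (c l)" l] by simp_all
  then show ?thesis by (simp add: complex_eq_iff)
qed

lemma quadric_polyfun: "(\<lambda>z. psubst (($) z) (q l)) \<in> polyfun (forms 2)"
  by (rule polyfunI[of "q l" _ 0]) (auto simp: q quad_form_forms)

text \<open>
  Seven quadrics that separate the points of \<open>S\<close>, a basis of the net and \<open>w\<close> are eleven quadrics, hence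
  dependent. Evaluating a relation at the points of \<open>S\<close> removes the separating quadrics from it, and what remains expresses \<open>w\<close>
  by the net.
\<close>

lemma net_kernel:
  assumes S: "distinct_lines S" "card S = 7" and w: "w \<in> polyfun (forms 2)" "\<And>z. z \<in> S \<Longrightarrow> w z = 0"
  shows "\<exists>b. (\<Sum>l\<in>UNIV. b l * of_real (y l)) = 0 \<and> (\<forall>z. w z = (\<Sum>l\<in>UNIV. b l * psubst (($) z) (q l)))"
proof -
  have fS: "finite S" using S(2) card.infinite by fastforce
  have "\<forall>z0\<in>S. \<exists>g. g \<in> polyfun (forms 2) \<and> g z0 = 1 \<and> (\<forall>z\<in>S - {z0}. g z = 0)"
    using separating_quadric[OF S] by blast
  then obtain G where G: "\<And>z. z \<in> S \<Longrightarrow> G z \<in> polyfun (forms 2) \<and> G z z = 1 \<and> (\<forall>z'\<in>S - {z}. G z z' = 0)" by metis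
  define r where "r l = complex_of_real (y l / y 0)" for l
  (* The net has three generators, namely q l - (y l / y 0) q 0 for l different from 0; the free slot
     for l = 0 holds w. *)
  define n where "n l = (if l = 0 then w else (\<lambda>z. psubst (($) z) (q l) - r l * psubst (($) z) (q 0)))" for l
  have nP: "n l \<in> polyfun (forms 2)" for l
    using w(1) polyfun_subspace_lin[OF subspace_forms quadric_polyfun[of l] quadric_polyfun[of 0], of 1 "- r l"]
    by (auto simp: n_def)
  have nS: "n l z = 0" if "z \<in> S" for l z
  proof -
    have "z \<in> fibre q y" using S that by (auto simp: distinct_lines_def)
    then show ?thesis using w(2)[OF that] y0 by (simp add: n_def r_def fibre_def)
  qed
  define I where "I = Inl ` S \<union> Inr ` (UNIV :: 4 set)"
  define f where "f i = (case i of Inl z \<Rightarrow> G z | Inr l \<Rightarrow> n l)" for i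
  have fI: "finite I" using fS by (simp add: I_def)
  have "card I = card (Inl ` S :: ((complex^4) + 4) set) + card (Inr ` (UNIV :: 4 set) :: ((complex^4) + 4) set)"
    unfolding I_def using fS by (intro card_Un_disjoint) auto
  also have "\<dots> = 11" using S(2) by (simp add: card_image)
  finally have cI: "card I > 10" by simp
  have "f i \<in> polyfun (forms 2)" if "i \<in> I" for i using that G nP by (auto simp: I_def f_def)
  then have "\<exists>c. (\<exists>i\<in>I. c i \<noteq> 0) \<and> (\<forall>z. (\<Sum>i\<in>I. c i * f i z) = 0)"
    by (rule eleven_quadrics_dependent[OF fI cI])
  then obtain c where "(\<exists>i\<in>I. c i \<noteq> 0) \<and> (\<forall>z. (\<Sum>i\<in>I. c i * f i z) = 0)" by (elim exE)
  then have c: "\<exists>i\<in>I. c i \<noteq> 0" "\<And>z. (\<Sum>i\<in>I. c i * f i z) = 0" by simp_all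
  have sumI: "(\<Sum>i\<in>I. h i) = (\<Sum>z\<in>S. h (Inl z)) + (\<Sum>l\<in>UNIV. h (Inr l))" for h :: "_ \<Rightarrow> complex"
    unfolding I_def using fS by (subst sum.union_disjoint) (auto simp: sum.reindex)
  have cS: "c (Inl z) = 0" if "z \<in> S" for z
  proof -
    have "0 = (\<Sum>z'\<in>S. c (Inl z') * G z' z) + (\<Sum>l\<in>UNIV. c (Inr l) * n l z)" using c(2)[of z] by (simp add: sumI f_def)
    also have "(\<Sum>l\<in>UNIV. c (Inr l) * n l z) = 0" using nS[OF that] by simp
    also have "(\<Sum>z'\<in>S. c (Inl z') * G z' z) = (\<Sum>z'\<in>S. if z' = z then c (Inl z) else 0)"
      using G that by (intro sum.cong refl) auto
    also have "\<dots> = c (Inl z)" using fS that by simp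
    finally show ?thesis by simp
  qed
  then have rel: "(\<Sum>l\<in>UNIV. c (Inr l) * n l z) = 0" for z using c(2)[of z] by (simp add: sumI f_def)
  have nz: "\<exists>l. c (Inr l) \<noteq> 0" using c(1) cS by (auto simp: I_def)
  define d where "d l = c (Inr l)" for l
  (* The remaining relation rewritten in terms of the quadrics q l themselves. *)
  define b0 where "b0 l = (if l = 0 then - (\<Sum>k\<in>UNIV - {0}. d k * r k) else d l)" for l
  have sp: "(\<Sum>l\<in>UNIV. h l) = h 0 + (\<Sum>l\<in>UNIV - {0}. h l)" for h :: "4 \<Rightarrow> complex"
    by (rule sum.remove) auto
  have rel2: "d 0 * w z + (\<Sum>l\<in>UNIV. b0 l * psubst (($) z) (q l)) = 0" for z
  proof -
    have "0 = d 0 * w z + (\<Sum>l\<in>UNIV - {0}. d l * n l z)" using rel[of z] by (subst (asm) sp) (simp add: d_def n_def)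
    also have "(\<Sum>l\<in>UNIV - {0}. d l * n l z) = (\<Sum>l\<in>UNIV - {0}. d l * psubst (($) z) (q l)) - (\<Sum>k\<in>UNIV - {0}. d k * r k) * psubst (($) z) (q 0)"
      unfolding sum_distrib_right sum_subtractf[symmetric] by (intro sum.cong refl) (simp add: n_def algebra_simps)
    also have "\<dots> = (\<Sum>l\<in>UNIV. b0 l * psubst (($) z) (q l))" unfolding sp[of "\<lambda>l. b0 l * psubst (($) z) (q l)"] by (simp add: b0_def)
    finally show ?thesis by simp
  qed
  have d0: "d 0 \<noteq> 0"
  proof
    assume "d 0 = 0"
    then have "(\<Sum>l\<in>UNIV. b0 l * psubst (($) z) (q l)) = 0" for z using rel2[of z] by simp
    from quadrics_independent[of b0, OF this] have "b0 l = 0" for l .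
    then have "d l = 0" for l using \<open>d 0 = 0\<close> b0_def[of l] by (cases "l = 0") simp_all
    then show False using nz by (simp add: d_def)
  qed
  have "(\<Sum>l\<in>UNIV. b0 l * of_real (y l)) = 0"
  proof -
    have "r k * of_real (y 0) = of_real (y k)" for k using y0 by (simp add: r_def)
    then have "(\<Sum>k\<in>UNIV - {0}. d k * r k) * of_real (y 0) = (\<Sum>l\<in>UNIV - {0}. b0 l * of_real (y l))"
      unfolding sum_distrib_right by (intro sum.cong refl) (simp add: b0_def mult.assoc)
    then show ?thesis by (subst sp) (simp add: b0_def)
  qed
  then have "(\<Sum>l\<in>UNIV. (- b0 l / d 0) * of_real (y l)) = 0"
    by (simp add: sum_divide_distrib[symmetric] sum_negf)
  moreover have "w z = (\<Sum>l\<in>UNIV. (- b0 l / d 0) * psubst (($) z) (q l))" for z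
  proof -
    have "(\<Sum>l\<in>UNIV. (- b0 l / d 0) * psubst (($) z) (q l)) = - (\<Sum>l\<in>UNIV. b0 l * psubst (($) z) (q l)) / d 0"
      by (simp add: sum_divide_distrib[symmetric] sum_negf)
    also have "(\<Sum>l\<in>UNIV. b0 l * psubst (($) z) (q l)) = - (d 0 * w z)"
      using rel2[of z] by (simp add: eq_neg_iff_add_eq_0 add.commute)
    also have "- (- (d 0 * w z)) / d 0 = w z" using d0 by simp
    finally show ?thesis by simp
  qed
  ultimately show ?thesis by (intro exI[of _ "\<lambda>l. - b0 l / d 0"]) simp
qed

text \<open>
  One of the two points \<open>z\<close> and \<open>- z\<close> for each of the eight lines of the fibre.
\<close>

definition representatives :: "(complex^4) set \<Rightarrow> bool" where
  "representatives R \<longleftrightarrow> distinct_lines R \<and> card R = 8 \<and> (\<forall>z\<in>fibre q y. z \<in> R \<or> - z \<in> R)"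

lemma representatives_exist: "\<exists>R. representatives R"
proof -
  define C where "C = (\<lambda>z. {z, - z}) ` fibre q y"
  have neg: "z \<noteq> - z" if "z \<in> fibre q y" for z
    using fibre_nonzero[OF that] by (auto simp: vec_eq_iff eq_neg_iff_add_eq_0)
  have fC: "finite C" using fin by (simp add: C_def)
  have UC: "\<Union>C = fibre q y" using fibre_uminus by (auto simp: C_def)
  have "2 * card C = card (\<Union>C)"
  proof (rule card_partition[OF fC])
    show "finite (\<Union>C)" using UC fin by simp
    show "card c = 2" if "c \<in> C" for c using that neg by (auto simp: C_def card_insert_if)
    show "c1 \<inter> c2 = {}" if "c1 \<in> C" "c2 \<in> C" "c1 \<noteq> c2" for c1 c2 using that by (auto simp: C_def)
  qed
  then have C8: "card C = 8" using UC card16 by simp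
  have "\<forall>c\<in>C. \<exists>z. z \<in> c" by (auto simp: C_def)
  then obtain h where h: "\<And>c. c \<in> C \<Longrightarrow> h c \<in> c" by metis
  have inj: "inj_on h C"
  proof (rule inj_onI)
    fix c1 c2 assume a: "c1 \<in> C" "c2 \<in> C" "h c1 = h c2"
    have "h c1 \<in> c1" "h c1 \<in> c2" using h[OF a(1)] h[OF a(2)] unfolding a(3) by simp_all
    then show "c1 = c2" using a by (auto simp: C_def)
  qed
  have hC: "h ` C \<subseteq> fibre q y" using h UC by blast
  have "representatives (h ` C)"
    unfolding representatives_def distinct_lines_def
  proof (intro conjI ballI)
    show "h ` C \<subseteq> fibre q y" by (rule hC)
    show "card (h ` C) = 8" using card_image[OF inj] C8 by simp
    show "z \<in> h ` C \<or> - z \<in> h ` C" if "z \<in> fibre q y" for z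
    proof -
      have "{z, - z} \<in> C" using that by (auto simp: C_def)
      then have "h {z, - z} \<in> {z, - z}" "h {z, - z} \<in> h ` C" using h by auto
      then show ?thesis by auto
    qed
    show "z \<noteq> - w" if zw: "z \<in> h ` C" "w \<in> h ` C" for z w
    proof
      assume e: "z = - w"
      obtain c1 c2 where c: "c1 \<in> C" "z = h c1" "c2 \<in> C" "w = h c2" using zw by blast
      have "c1 = {z, - z}" "c2 = {w, - w}" using h[OF c(1)] h[OF c(3)] c by (auto simp: C_def)
      then have "c1 = c2" using e by auto
      then show False using c e neg hC by auto
    qed
  qed
  then show ?thesis by blast
qed

lemma representatives_subset7:
  assumes "representatives R" "z \<in> R"
  shows "distinct_lines (R - {z})" "card (R - {z}) = 7" "finite R"
proof -
  show f: "finite R" using assms(1) card.infinite by (fastforce simp: representatives_def)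
  show "distinct_lines (R - {z})" using assms distinct_lines_subset by (auto simp: representatives_def)
  show "card (R - {z}) = 7" using assms f by (simp add: representatives_def)
qed

lemma net_vanishes_on_fibre:
  assumes "(\<Sum>l\<in>UNIV. b l * of_real (y l)) = 0" "z \<in> fibre q y"
  shows "(\<Sum>l\<in>UNIV. b l * psubst (($) z) (q l)) = 0"
  using assms by (simp add: fibre_def)

text \<open>
  Values at seven of the points can be prescribed, and the quadrics that vanish at seven points form the net, so
  the value at the eighth point is determined by the others. This is the relation; its coefficient at \<open>z\<close> is nonzero,
  since otherwise the quadric that separates \<open>z\<close> from the other points among the seven would vanish at the eighth as well,
  would therefore belong to the net, and would vanish at \<open>z\<close>.
\<close>

lemma cayley_bacharach:
  assumes R: "representatives R"
  shows "\<exists>u. (\<forall>z\<in>R. u z \<noteq> 0) \<and> (\<forall>g\<in>polyfun (forms 2). (\<Sum>z\<in>R. u z * g z) = 0) \<and>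
    (\<forall>v. (\<Sum>z\<in>R. u z * v z) = 0 \<longrightarrow> (\<exists>g\<in>polyfun (forms 2). \<forall>z\<in>R. g z = v z))"
proof -
  have RZ: "R \<subseteq> fibre q y" using R by (auto simp: representatives_def distinct_lines_def)
  have "R \<noteq> {}" using R by (auto simp: representatives_def)
  then obtain z8 where z8: "z8 \<in> R" by blast
  define S where "S = R - {z8}"
  have S: "distinct_lines S" "card S = 7" and fR: "finite R" using representatives_subset7[OF R z8] by (auto simp: S_def)
  have fS: "finite S" using fR by (simp add: S_def)
  have RS: "R = insert z8 S" "z8 \<notin> S" using z8 by (auto simp: S_def)
  have "\<forall>z0\<in>S. \<exists>g. g \<in> polyfun (forms 2) \<and> g z0 = 1 \<and> (\<forall>z\<in>S - {z0}. g z = 0)"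
    using separating_quadric[OF S] by blast
  then obtain G where G: "\<And>z. z \<in> S \<Longrightarrow> G z \<in> polyfun (forms 2) \<and> G z z = 1 \<and> (\<forall>z'\<in>S - {z}. G z z' = 0)" by metis
  have interp: "(\<lambda>x. \<Sum>z\<in>S. v z * G z x) \<in> polyfun (forms 2)" "\<And>x. x \<in> S \<Longrightarrow> (\<Sum>z\<in>S. v z * G z x) = v x" for v
  proof -
    show "(\<lambda>x. \<Sum>z\<in>S. v z * G z x) \<in> polyfun (forms 2)" using G by (intro polyfun_subspace_sum[OF subspace_forms]) auto
    fix x assume x: "x \<in> S"
    have "(\<Sum>z\<in>S. v z * G z x) = (\<Sum>z\<in>S. if z = x then v x else 0)" using G x by (intro sum.cong refl) auto
    then show "(\<Sum>z\<in>S. v z * G z x) = v x" using fS x by simp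
  qed
  have at8: "g z8 = (\<Sum>z\<in>S. g z * G z z8)" if g: "g \<in> polyfun (forms 2)" for g
  proof -
    have "(\<lambda>x. 1 * g x + (-1) * (\<Sum>z\<in>S. g z * G z x)) \<in> polyfun (forms 2)"
      by (rule polyfun_subspace_lin[OF subspace_forms g interp(1)])
    moreover have "1 * g x + (-1) * (\<Sum>z\<in>S. g z * G z x) = 0" if "x \<in> S" for x using interp(2)[OF that, of g] by simp
    ultimately obtain b where "(\<Sum>l\<in>UNIV. b l * of_real (y l)) = 0"
      "\<And>x. 1 * g x + (-1) * (\<Sum>z\<in>S. g z * G z x) = (\<Sum>l\<in>UNIV. b l * psubst (($) x) (q l))"
      using net_kernel[OF S] by blast
    then have "1 * g z8 + (-1) * (\<Sum>z\<in>S. g z * G z z8) = 0" using net_vanishes_on_fibre z8 RZ by auto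
    then show ?thesis by simp
  qed
  (* The relation at8 read as a linear relation between all eight values. *)
  define u where "u z = (if z = z8 then -1 else G z z8)" for z
  have sumu: "(\<Sum>z\<in>R. u z * v z) = (\<Sum>z\<in>S. v z * G z z8) - v z8" for v
  proof -
    have "(\<Sum>z\<in>S. u z * v z) = (\<Sum>z\<in>S. v z * G z z8)" using RS(2) by (intro sum.cong refl) (auto simp: u_def)
    then show ?thesis unfolding RS(1) using fS RS(2) by (simp add: u_def)
  qed
  have "u z \<noteq> 0" if "z \<in> R" for z
  proof (cases "z = z8")
    case False
    then have zS: "z \<in> S" using that by (simp add: S_def)
    show ?thesis
    proof
      assume "u z = 0"
      then have G0: "G z z8 = 0" using False by (simp add: u_def)
      have "G z x = 0" if "x \<in> R - {z}" for x using that G[OF zS] G0 by (cases "x = z8") (auto simp: S_def)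
      then obtain b where b: "(\<Sum>l\<in>UNIV. b l * of_real (y l)) = 0" "\<And>x. G z x = (\<Sum>l\<in>UNIV. b l * psubst (($) x) (q l))"
        using net_kernel[OF representatives_subset7(1,2)[OF R \<open>z \<in> R\<close>]] G[OF zS] by blast
      have "G z z = 0" unfolding b(2) using b(1) RZ \<open>z \<in> R\<close> by (intro net_vanishes_on_fibre) auto
      then show False using G[OF zS] by simp
    qed
  qed (simp add: u_def)
  moreover have "(\<Sum>z\<in>R. u z * g z) = 0" if "g \<in> polyfun (forms 2)" for g
    using at8[OF that] by (simp add: sumu)
  moreover have "\<exists>g\<in>polyfun (forms 2). \<forall>z\<in>R. g z = v z" if "(\<Sum>z\<in>R. u z * v z) = 0" for v
  proof (intro bexI ballI)
    show "(\<lambda>x. \<Sum>z\<in>S. v z * G z x) \<in> polyfun (forms 2)" by (rule interp)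
    show "(\<Sum>z\<in>S. v z * G z x) = v x" if "x \<in> R" for x
      using interp(2)[of x v] that sumu[of v] \<open>(\<Sum>z\<in>R. u z * v z) = 0\<close> by (cases "x = z8") (auto simp: S_def)
  qed
  ultimately show ?thesis by (intro exI[of _ u]) blast
qed

text \<open>
  Among the quadrics the relation prevents this. Multiply a quadric that separates \<open>z0\<close> from six of the points by
  the square of a linear form through the seventh.
\<close>

lemma quartic_separation:
  assumes R: "representatives R" and z0: "z0 \<in> R"
  shows "\<exists>f\<in>polyfun (forms 4). f z0 = 1 \<and> (\<forall>z\<in>R - {z0}. f z = 0)"
proof -
  have RZ: "R \<subseteq> fibre q y" using R by (auto simp: representatives_def distinct_lines_def)
  have "card (R - {z0}) = 7" using representatives_subset7[OF R z0] by simp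
  then have "R - {z0} \<noteq> {}" by (metis card.empty zero_neq_numeral)
  then obtain z8 where z8: "z8 \<in> R" "z8 \<noteq> z0" by blast
  have S: "distinct_lines (R - {z8})" "card (R - {z8}) = 7" using representatives_subset7[OF R z8(1)] by auto
  obtain g where g: "g \<in> polyfun (forms 2)" "g z0 = 1" "\<And>z. z \<in> R - {z8} - {z0} \<Longrightarrow> g z = 0"
    using separating_quadric[OF S, of z0] z0 z8 by blast
  have "\<exists>\<alpha>. (\<Sum>i\<in>UNIV. \<alpha> i * z8 $ i) = 0 \<and> (\<Sum>i\<in>UNIV. \<alpha> i * z0 $ i) \<noteq> 0"
  proof -
    have "z8 \<noteq> 0" using fibre_nonzero z8 RZ by blast
    then obtain k where k: "z8 $ k \<noteq> 0" by (auto simp: vec_eq_iff)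
    have "\<exists>j. z0 $ j * z8 $ k \<noteq> z8 $ j * z0 $ k"
    proof (rule ccontr)
      assume "\<not> ?thesis"
      then have "z0 = (z0 $ k / z8 $ k) *s z8" using k by (simp add: vec_eq_iff field_simps)
      then have "z0 = z8 \<or> z0 = - z8" using fibre_proportional z0 z8 RZ by blast
      then show False using z0 z8 R by (auto simp: representatives_def distinct_lines_def)
    qed
    then obtain j where j: "z0 $ j * z8 $ k \<noteq> z8 $ j * z0 $ k" by blast
    then have jk: "j \<noteq> k" by auto
    define \<alpha> where "\<alpha> i = (if i = j then z8 $ k else if i = k then - z8 $ j else 0)" for i
    have "(\<Sum>i\<in>UNIV. \<alpha> i * x $ i) = z8 $ k * x $ j - z8 $ j * x $ k" for x :: "complex^4"
    proof -
      have "(\<Sum>i\<in>UNIV. \<alpha> i * x $ i) = (\<Sum>i\<in>{j, k}. \<alpha> i * x $ i)"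
        by (rule sum.mono_neutral_right) (auto simp: \<alpha>_def)
      then show ?thesis using jk by (simp add: \<alpha>_def)
    qed
    then show ?thesis using j by (intro exI[of _ \<alpha>]) (simp add: mult.commute)
  qed
  then obtain \<alpha> where \<alpha>: "(\<Sum>i\<in>UNIV. \<alpha> i * z8 $ i) = 0" "(\<Sum>i\<in>UNIV. \<alpha> i * z0 $ i) \<noteq> 0" by blast
  define L where "L x = (\<Sum>i\<in>UNIV. \<alpha> i * x $ i)" for x :: "complex^4"
  have L1: "L \<in> polyfun (forms 1)" unfolding L_def by (rule linear_form_polyfun)
  have "(\<lambda>z. L z * L z) \<in> polyfun (forms (1 + 1))" by (rule polyfun_forms_mult[OF L1 L1])
  then have L2: "(\<lambda>z. L z * L z) \<in> polyfun (forms 2)" by (simp only: one_add_one)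
  define f where "f z = g z * (L z * L z)" for z
  have "f \<in> polyfun (forms (2 + 2))" unfolding f_def by (rule polyfun_forms_mult[OF g(1) L2])
  then have f4: "f \<in> polyfun (forms 4)" by simp
  have "(\<lambda>z. (1 / f z0) * f z) \<in> polyfun (forms 4)" by (rule polyfun_forms_scale[OF f4])
  moreover have "f z0 \<noteq> 0" using g \<alpha> by (simp add: f_def L_def)
  moreover have "f z = 0" if "z \<in> R - {z0}" for z
    using that g(3)[of z] \<alpha>(1) by (cases "z = z8") (auto simp: f_def L_def)
  ultimately show ?thesis by (intro bexI[of _ "\<lambda>z. (1 / f z0) * f z"]) auto
qed

end

section \<open>Syzygies and the uniqueness of the functional\<close>

lemma card_quartic_monomials: "finite {m :: 4 \<Rightarrow>\<^sub>0 nat. mdeg m = 4}" "card {m :: 4 \<Rightarrow>\<^sub>0 nat. mdeg m = 4} = 35"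
proof -
  have e: "{m :: 4 \<Rightarrow>\<^sub>0 nat. mdeg m = 4} = Mon UNIV 4 - Mon UNIV 3" by (auto simp: Mon_def)
  have "Mon UNIV 3 \<subseteq> (Mon UNIV 4 :: (4 \<Rightarrow>\<^sub>0 nat) set)" by (auto simp: Mon_def)
  then show "card {m :: 4 \<Rightarrow>\<^sub>0 nat. mdeg m = 4} = 35" "finite {m :: 4 \<Rightarrow>\<^sub>0 nat. mdeg m = 4}"
    unfolding e using Mon_count[of "UNIV :: 4 set" 4] Mon_count[of "UNIV :: 4 set" 3]
    by (simp_all add: card_Diff_subset binomial_fact' fact_numeral)
qed

text \<open>
  The dual functionals \<open>\<tau> l\<close> and the assumption \<open>upper\<close> single out one representative modulo the obvious syzygies
  \<open>q\<^sub>l \<cdot> q\<^sub>k - q\<^sub>k \<cdot> q\<^sub>l = 0\<close>. For generic \<open>y\<close> the quadric \<open>\<Sum>\<^sub>k y\<^sub>k a\<^sub>k\<close> vanishes on the fibre over \<open>y\<close>, so it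
  belongs to the net: its coordinates \<open>b y\<close> with respect to the \<open>q\<^sub>l\<close> are orthogonal to \<open>y\<close>. Hence the matrix \<open>b\<close> is
  skew-symmetric. By \<open>upper\<close> it vanishes, so \<open>\<Sum>\<^sub>k y\<^sub>k a\<^sub>k = 0\<close> for all generic \<open>y\<close>.
\<close>

lemma koszul_syzygies:
  fixes q :: "4 \<Rightarrow> 4 real_mpoly" and P0 :: "4 real_mpoly"
  assumes fib: "\<And>y. psubst y P0 \<noteq> 0 \<Longrightarrow> simple_fibre q M y" and P0: "P0 \<noteq> 0"
    and \<tau>: "\<And>l. linear (\<tau> l)" "\<And>l k. \<tau> l (q k) = (if l = k then 1 else (0::real))"
    and a: "\<And>k. a k \<in> forms 2" "(\<Sum>k\<in>UNIV. a k * q k) = 0"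
    and upper: "\<And>l k. l < k \<Longrightarrow> \<tau> l (a k) = 0"
  shows "a k = 0"
proof -
  define b where "b l k = \<tau> l (a k)" for l k
  have good: "(\<Sum>k\<in>UNIV. y k *\<^sub>R a k) = (\<Sum>l\<in>UNIV. (\<Sum>k\<in>UNIV. y k * b l k) *\<^sub>R q l) \<and>
      (\<Sum>l\<in>UNIV. (\<Sum>k\<in>UNIV. y k * b l k) * y l) = 0" if y: "psubst y P0 \<noteq> 0" for y
  proof -
    interpret simple_fibre q M y by (rule fib[OF y])
    define w where "w = (\<Sum>k\<in>UNIV. y k *\<^sub>R a k)"
    have w2: "w \<in> forms 2" unfolding w_def by (intro forms_sum forms_scaleR a)
    have wz: "psubst (($) z) w = 0" if z: "z \<in> fibre q y" for z
    proof -
      have "psubst (($) z) (\<Sum>k\<in>UNIV. a k * q k) = (\<Sum>k\<in>UNIV. of_real (y k) * psubst (($) z) (a k))"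
        using z by (simp add: fibre_def psubst_sum_distrib psubst_mult mult.commute)
      also have "\<dots> = psubst (($) z) w"
        unfolding w_def psubst_sum_distrib psubst_scaleR by (simp add: scaleR_conv_of_real)
      finally show ?thesis by (simp add: a(2))
    qed
    obtain R where R: "representatives R" using representatives_exist by blast
    then have "R \<noteq> {}" by (auto simp: representatives_def)
    then obtain z8 where z8: "z8 \<in> R" by blast
    have S: "distinct_lines (R - {z8})" "card (R - {z8}) = 7" using representatives_subset7[OF R z8] by auto
    have "(\<lambda>z. psubst (($) z) w) \<in> polyfun (forms 2)" by (rule polyfun_real[OF w2]) simp
    moreover have "psubst (($) z) w = 0" if "z \<in> R - {z8}" for z using wz that S(1) by (auto simp: distinct_lines_def)
    ultimately obtain c where c: "(\<Sum>l\<in>UNIV. c l * of_real (y l)) = 0" "\<And>z :: complex^4. psubst (($) z) w = (\<Sum>l\<in>UNIV. c l * psubst (($) z) (q l))"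
      using net_kernel[OF S] by blast
    have "psubst (($) z) w + \<i> * psubst (($) z) 0 = psubst (($) z) (\<Sum>l\<in>UNIV. Re (c l) *\<^sub>R q l) + \<i> * psubst (($) z) (\<Sum>l\<in>UNIV. Im (c l) *\<^sub>R q l)" for z :: "complex^4"
    proof -
      have "psubst (($) z) (\<Sum>l\<in>UNIV. Re (c l) *\<^sub>R q l) + \<i> * psubst (($) z) (\<Sum>l\<in>UNIV. Im (c l) *\<^sub>R q l)
        = (\<Sum>l\<in>UNIV. c l * psubst (($) z) (q l))"
        unfolding psubst_sum_distrib psubst_scaleR sum_distrib_left sum.distrib[symmetric]
        by (intro sum.cong refl) (subst (3) complex_eq, simp add: scaleR_conv_of_real algebra_simps)
      then show ?thesis using c(2) by simp
    qed
    then have we: "w = (\<Sum>l\<in>UNIV. Re (c l) *\<^sub>R q l)" using polyfun_unique by blast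
    have "\<tau> l w = Re (c l)" for l
      unfolding we by (simp add: linear_sum[OF \<tau>(1)] linear_scale[OF \<tau>(1)] \<tau>(2) if_distrib cong: if_cong)
    moreover have "\<tau> l w = (\<Sum>k\<in>UNIV. y k * b l k)" for l
      by (simp add: w_def b_def linear_sum[OF \<tau>(1)] linear_scale[OF \<tau>(1)])
    ultimately have rc: "Re (c l) = (\<Sum>k\<in>UNIV. y k * b l k)" for l by metis
    have "Re (\<Sum>l\<in>UNIV. c l * of_real (y l)) = (\<Sum>l\<in>UNIV. (\<Sum>k\<in>UNIV. y k * b l k) * y l)"
      by (simp add: rc)
    then show ?thesis using c(1) we unfolding w_def rc by simp
  qed
  (* The product with P0 vanishes everywhere. *)
  have dense: "f = 0" if "\<And>y :: 4 \<Rightarrow> real. psubst y P0 \<noteq> 0 \<Longrightarrow> psubst y f = 0" for f :: "4 real_mpoly"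
  proof -
    have "psubst (($) x) (P0 * f) = psubst (($) x) 0" for x :: "real^4"
      using that[of "($) x"] by (auto simp: psubst_mult)
    then have "P0 * f = 0" by (rule psubst_ext)
    then show ?thesis using P0 by simp
  qed
  define \<Psi> :: "4 real_mpoly" where "\<Psi> = (\<Sum>l\<in>UNIV. \<Sum>k\<in>UNIV. b l k *\<^sub>R (X l * X k))"
  have \<Psi>e: "psubst y \<Psi> = (\<Sum>l\<in>UNIV. (\<Sum>k\<in>UNIV. y k * b l k) * y l)" for y :: "4 \<Rightarrow> real"
    by (simp add: \<Psi>_def psubst_sum_distrib psubst_scaleR psubst_mult sum_distrib_right sum_distrib_left mult_ac)
  have "\<Psi> = 0" by (rule dense) (use good \<Psi>e in auto)
  then have quad0: "(\<Sum>l\<in>UNIV. (\<Sum>k\<in>UNIV. y k * b l k) * y l) = 0" for y using \<Psi>e[of y] by simp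
  have quad0': "(\<Sum>l\<in>UNIV. \<Sum>k\<in>UNIV. y l * y k * b l k) = 0" for y :: "4 \<Rightarrow> real"
    using quad0[of y] by (simp add: sum_distrib_right sum_distrib_left mult_ac)
  have bsym: "b i j + b j i = 0" for i j
  proof -
    define e where "e i k = (if k = i then 1 else 0 :: real)" for i k :: 4
    have bil: "(\<Sum>l\<in>UNIV. \<Sum>k\<in>UNIV. e i l * e j k * b l k) = b i j" for i j
    proof -
      have "(\<Sum>k\<in>UNIV. e i l * e j k * b l k) = (\<Sum>k\<in>UNIV. if k = j then e i l * b l j else 0)" for l
        by (intro sum.cong refl) (simp add: e_def)
      then have "(\<Sum>l\<in>UNIV. \<Sum>k\<in>UNIV. e i l * e j k * b l k) = (\<Sum>l\<in>UNIV. e i l * b l j)" by simp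
      also have "\<dots> = (\<Sum>l\<in>UNIV. if l = i then b i j else 0)"
        by (intro sum.cong refl) (simp add: e_def)
      finally show ?thesis by simp
    qed
    have "(\<Sum>l\<in>UNIV. \<Sum>k\<in>UNIV. (e i l + e j l) * (e i k + e j k) * b l k) = b i i + b i j + b j i + b j j"
      by (simp add: distrib_left distrib_right sum.distrib bil)
    moreover have "b i i = 0" "b j j = 0" using quad0'[of "e i"] quad0'[of "e j"] bil by auto
    ultimately show ?thesis using quad0'[of "\<lambda>l. e i l + e j l"] by simp
  qed
  have "b l k = 0" for l k
  proof (cases l k rule: linorder_cases)
    case less then show ?thesis using upper by (simp add: b_def)
  next
    case equal then show ?thesis using bsym[of l l] by simp
  next
    case greater then show ?thesis using upper[of k l] bsym[of l k] by (simp add: b_def)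
  qed
  then have good0: "(\<Sum>k\<in>UNIV. y k *\<^sub>R a k) = 0" if "psubst y P0 \<noteq> 0" for y :: "4 \<Rightarrow> real" using good[OF that] by simp
  have "psubst (($) x) (a k) = psubst (($) x) 0" for x :: "real^4"
  proof -
    have "(\<Sum>k\<in>UNIV. psubst (($) x) (a k) *\<^sub>R X k) = (0 :: 4 real_mpoly)"
    proof (rule dense)
      fix y :: "4 \<Rightarrow> real" assume "psubst y P0 \<noteq> 0"
      from arg_cong[OF good0[OF this], of "psubst (($) x)"]
      show "psubst y (\<Sum>k\<in>UNIV. psubst (($) x) (a k) *\<^sub>R X k) = 0"
        by (simp add: psubst_sum_distrib psubst_scaleR mult.commute)
    qed
    then have "psubst (\<lambda>l. if l = k then 1 else 0) (\<Sum>k\<in>UNIV. psubst (($) x) (a k) *\<^sub>R X k) = (0::real)" by simp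
    then show ?thesis by (simp add: psubst_sum_distrib psubst_scaleR if_distrib cong: if_cong)
  qed
  then show ?thesis by (rule psubst_ext)
qed

text \<open>
  If \<open>l2\<close> is not a multiple of \<open>l1\<close>, then a quartic killed by both is determined by its coefficients apart from two.
  A syzygy \<open>\<Sum>\<^sub>k a\<^sub>k q\<^sub>k = 0\<close> with quadrics \<open>a\<^sub>k\<close> that is normalised as in \<open>koszul_syzygies\<close> thus amounts to \<open>33 + 6\<close> linear
  equations for the \<open>40\<close> coefficients of the \<open>a\<^sub>k\<close>, so there would be a nontrivial one.
\<close>

lemma functional_unique:
  fixes q :: "4 \<Rightarrow> 4 real_mpoly" and P0 :: "4 real_mpoly" and l1 l2 :: "4 real_mpoly \<Rightarrow> real"
  assumes fib: "\<And>y. psubst y P0 \<noteq> 0 \<Longrightarrow> simple_fibre q M y" and P0: "P0 \<noteq> 0"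
    and l1: "linear l1" "\<And>k r. r \<in> forms 2 \<Longrightarrow> l1 (q k * r) = 0"
    and l2: "linear l2" "\<And>k r. r \<in> forms 2 \<Longrightarrow> l2 (q k * r) = 0"
    and nz: "f1 \<in> forms 4" "l1 f1 \<noteq> 0"
  shows "\<exists>\<kappa>. \<forall>f\<in>forms 4. l2 f = \<kappa> * l1 f"
proof (rule ccontr)
  assume contra: "\<not> ?thesis"
  obtain y1 :: "4 \<Rightarrow> real" where "psubst y1 P0 \<noteq> 0" using nonzero_poly_nonzero_value[OF P0] by blast
  then interpret simple_fibre q M y1 by (rule fib)
  have q2: "q k \<in> forms 2" for k by (simp add: q quad_form_forms)
  let ?N4 = "{m :: 4 \<Rightarrow>\<^sub>0 nat. mdeg m = 4}" and ?N2 = "{m :: 4 \<Rightarrow>\<^sub>0 nat. mdeg m = 2}"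
  have exp4: "l f = (\<Sum>m\<in>?N4. Poly_Mapping.lookup f m * l (mon m))" if "linear l" "f \<in> forms 4" for l :: "4 real_mpoly \<Rightarrow> real" and f
  proof -
    have "f = (\<Sum>m\<in>?N4. Poly_Mapping.lookup f m *\<^sub>R mon m)"
      using that(2) card_quartic_monomials(1) by (intro mon_expand_gen) (auto simp: forms_iff)
    from arg_cong[OF this, of l] show ?thesis by (simp add: linear_sum[OF that(1)] linear_scale[OF that(1)])
  qed
  have "\<exists>m1\<in>?N4. l1 (mon m1) \<noteq> 0"
  proof (rule ccontr)
    assume "\<not> ?thesis"
    then have "l1 f1 = 0" using exp4[OF l1(1) nz(1)] by simp
    then show False using nz by simp
  qed
  then obtain m1 where m1: "m1 \<in> ?N4" "l1 (mon m1) \<noteq> 0" by blast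
  have "\<exists>m2\<in>?N4. l2 (mon m2) \<noteq> l2 (mon m1) / l1 (mon m1) * l1 (mon m2)"
  proof (rule ccontr)
    assume "\<not> ?thesis"
    then have "l2 f = l2 (mon m1) / l1 (mon m1) * l1 f" if "f \<in> forms 4" for f
      using exp4[OF l1(1) that] exp4[OF l2(1) that] by (simp add: sum_distrib_left mult_ac)
    then show False using contra by blast
  qed
  then obtain m2 where m2: "m2 \<in> ?N4" "l2 (mon m2) \<noteq> l2 (mon m1) / l1 (mon m1) * l1 (mon m2)" by blast
  have m12: "m1 \<noteq> m2" using m2(2) m1(2) by auto
  have two: "f = 0" if f: "f \<in> forms 4" "\<And>m. m \<in> ?N4 - {m1, m2} \<Longrightarrow> Poly_Mapping.lookup f m = 0" "l1 f = 0" "l2 f = 0" for f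
  proof -
    let ?x = "Poly_Mapping.lookup f m1" and ?y = "Poly_Mapping.lookup f m2"
    have e: "l f = ?x * l (mon m1) + ?y * l (mon m2)" if "linear l" for l :: "4 real_mpoly \<Rightarrow> real"
    proof -
      have "l f = (\<Sum>m\<in>{m1, m2}. Poly_Mapping.lookup f m * l (mon m))"
        unfolding exp4[OF that f(1)] using f(2) m1(1) m2(1) card_quartic_monomials(1) by (intro sum.mono_neutral_right) auto
      then show ?thesis using m12 by simp
    qed
    have 1: "?x * l1 (mon m1) + ?y * l1 (mon m2) = 0" and 2: "?x * l2 (mon m1) + ?y * l2 (mon m2) = 0"
      using e[OF l1(1)] e[OF l2(1)] f(3,4) by simp_all
    have x: "?x = - ?y * l1 (mon m2) / l1 (mon m1)" using 1 m1(2) by (simp add: field_simps)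
    have "?y * (l2 (mon m2) - l2 (mon m1) / l1 (mon m1) * l1 (mon m2)) = 0" using 2 unfolding x by (simp add: algebra_simps)
    then have y: "?y = 0" using m2(2) by simp
    then have "?x = 0" using x by simp
    show ?thesis
    proof (rule poly_mapping_eqI)
      fix m show "Poly_Mapping.lookup f m = Poly_Mapping.lookup 0 m"
        using f(1) f(2)[of m] y \<open>?x = 0\<close> by (cases "mdeg m = 4") (auto simp: forms_iff in_keys_iff)
    qed
  qed
  have "\<exists>\<phi>. linear \<phi> \<and> (\<forall>k. \<phi> (q k) = (if l = k then 1 else (0::real)))" for l
  proof -
    have "q l \<notin> span (q ` (UNIV - {l}))"
    proof
      assume "q l \<in> span (q ` (UNIV - {l}))"
      then obtain r where r: "q l = (\<Sum>b\<in>q ` (UNIV - {l}). r b *\<^sub>R b)" using span_finite[of "q ` (UNIV - {l})"] by auto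
      have inj: "inj_on q (UNIV - {l})"
      proof (rule inj_onI)
        fix i j assume "i \<in> UNIV - {l}" "j \<in> UNIV - {l}" "q i = q j"
        have "psubst q (X i - X j) = 0" using \<open>q i = q j\<close> by (simp add: psubst_diff)
        then have "X i - X j = (0 :: 4 real_mpoly)" by (rule indep)
        then have "psubst (\<lambda>k. if k = i then 1 else 0) (X i - X j) = (0::real)" by simp
        then show "i = j" by (simp add: psubst_diff split: if_splits)
      qed
      have "psubst q (X l - (\<Sum>k\<in>UNIV - {l}. r (q k) *\<^sub>R X k)) = 0"
        using r by (simp add: psubst_diff psubst_sum_distrib psubst_scaleR sum.reindex[OF inj])
      then have "X l - (\<Sum>k\<in>UNIV - {l}. r (q k) *\<^sub>R X k) = (0 :: 4 real_mpoly)" by (rule indep)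
      then have "psubst (\<lambda>k. if k = l then 1 else 0) (X l - (\<Sum>k\<in>UNIV - {l}. r (q k) *\<^sub>R X k)) = (0::real)" by simp
      then show False by (simp add: psubst_diff psubst_sum_distrib psubst_scaleR)
    qed
    then obtain \<phi> :: "4 real_mpoly \<Rightarrow> real" where \<phi>: "linear \<phi>" "\<forall>x\<in>q ` (UNIV - {l}). \<phi> x = 0" "\<phi> (q l) = 1"
      using functional_separating_from_span by blast
    then show ?thesis by (intro exI[of _ \<phi>]) auto
  qed
  then obtain \<tau> where \<tau>: "\<And>l. linear (\<tau> l)" "\<And>l k. \<tau> l (q k) = (if l = k then 1 else (0::real))" by metis
  define pairs :: "(4 \<times> 4) set" where "pairs = {(l, k). l < k}"
  have cp: "card pairs \<le> 6"
  proof -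
    have "pairs \<inter> prod.swap ` pairs = {}" by (auto simp: pairs_def)
    moreover have "(pairs \<union> prod.swap ` pairs) \<inter> (\<lambda>l. (l, l)) ` UNIV = {}" by (auto simp: pairs_def)
    ultimately have "card ((pairs \<union> prod.swap ` pairs) \<union> (\<lambda>l. (l, l)) ` (UNIV :: 4 set)) = (card pairs + card (prod.swap ` pairs)) + card ((\<lambda>l. (l, l)) ` (UNIV :: 4 set))"
      by (subst card_Un_disjoint; simp)+
    moreover have "card (prod.swap ` pairs) = card pairs" by (intro card_image) simp
    moreover have "card ((\<lambda>l. (l, l)) ` (UNIV :: 4 set)) = 4" by (subst card_image) (auto simp: inj_on_def)
    moreover have "card ((pairs \<union> prod.swap ` pairs) \<union> (\<lambda>l. (l, l)) ` (UNIV :: 4 set)) \<le> card (UNIV :: (4 \<times> 4) set)"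
      by (rule card_mono) auto
    ultimately show ?thesis by (simp add: card_cartesian_product flip: UNIV_Times_UNIV)
  qed
  define I where "I = (UNIV :: 4 set) \<times> ?N2"
  (* The equations: the coefficients of the quartic other than m1 and m2, and the normalisation. *)
  define J where "J = Inl ` (?N4 - {m1, m2}) \<union> Inr ` pairs"
  define K where "K i j = (case j of Inl m \<Rightarrow> Poly_Mapping.lookup (mon (snd i) * q (fst i)) m
      | Inr (l, k) \<Rightarrow> if fst i = k then \<tau> l (mon (snd i)) else 0)" for i :: "4 \<times> (4 \<Rightarrow>\<^sub>0 nat)" and j
  have "card J \<le> card (Inl ` (?N4 - {m1, m2}) :: ((4 \<Rightarrow>\<^sub>0 nat) + 4 \<times> 4) set) + card (Inr ` pairs :: ((4 \<Rightarrow>\<^sub>0 nat) + 4 \<times> 4) set)"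
    unfolding J_def by (rule card_Un_le)
  also have "\<dots> = card (?N4 - {m1, m2}) + card pairs" by (simp add: card_image)
  also have "card (?N4 - {m1, m2}) = 33" using m1 m2 m12 card_quartic_monomials by (subst card_Diff_subset) auto
  also have "33 + card pairs < card I" using cp card_quadratic_monomials by (simp add: I_def card_cartesian_product)
  finally have cJ: "card J < card I" by simp
  have fJ: "finite J" unfolding J_def using card_quartic_monomials(1) by auto
  have fI: "finite I" unfolding I_def using card_quadratic_monomials(1) by auto
  obtain c where c0: "(\<exists>i\<in>I. c i \<noteq> 0) \<and> (\<forall>j\<in>J. (\<Sum>i\<in>I. c i * K i j) = 0)"
    using homogeneous_system_nontrivial_solution[OF fJ fI cJ, of K] by (elim exE)
  then have c: "\<exists>i\<in>I. c i \<noteq> 0" "\<And>j. j \<in> J \<Longrightarrow> (\<Sum>i\<in>I. c i * K i j) = 0" by simp_all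
  define a where "a k = (\<Sum>m\<in>?N2. c (k, m) *\<^sub>R mon m)" for k
  have a2: "a k \<in> forms 2" for k unfolding a_def by (intro forms_sum forms_scaleR) (simp add: forms_mon)
  define h where "h = (\<Sum>k\<in>UNIV. a k * q k)"
  have h4: "h \<in> forms 4" unfolding h_def
  proof (rule forms_sum)
    show "a k * q k \<in> forms 4" for k using forms_mult[OF a2 q2, of k k] by simp
  qed
  have sumI: "(\<Sum>i\<in>I. g i) = (\<Sum>k\<in>UNIV. \<Sum>m\<in>?N2. g (k, m))" for g :: "_ \<Rightarrow> real"
    unfolding I_def by (simp add: sum.cartesian_product)
  have "h = 0"
  proof (rule two[OF h4])
    fix m assume m: "m \<in> ?N4 - {m1, m2}"
    then have "(\<Sum>i\<in>I. c i * K i (Inl m)) = 0" by (intro c) (auto simp: J_def)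
    moreover have "Poly_Mapping.lookup h m = (\<Sum>k\<in>UNIV. \<Sum>n\<in>?N2. c (k, n) * Poly_Mapping.lookup (mon n * q k) m)"
      by (simp add: h_def a_def sum_distrib_right lookup_sum)
    ultimately show "Poly_Mapping.lookup h m = 0" by (simp add: sumI K_def)
  next
    show "l1 h = 0" "l2 h = 0" using l1(2)[OF a2] l2(2)[OF a2]
      by (simp_all add: h_def linear_sum[OF l1(1)] linear_sum[OF l2(1)] mult.commute)
  qed
  have up: "\<tau> l (a k) = 0" if "l < k" for l k
  proof -
    have "(\<Sum>i\<in>I. c i * K i (Inr (l, k))) = 0" using that by (intro c) (auto simp: J_def pairs_def)
    moreover have "(\<Sum>i\<in>I. c i * K i (Inr (l, k))) = (\<Sum>k'\<in>UNIV. if k' = k then \<Sum>m\<in>?N2. c (k, m) * \<tau> l (mon m) else 0)"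
      unfolding sumI by (intro sum.cong refl) (auto simp: K_def)
    ultimately show ?thesis by (simp add: a_def linear_sum[OF \<tau>(1)] linear_scale[OF \<tau>(1)])
  qed
  have "a k = 0" for k
    by (rule koszul_syzygies[where q = q and \<tau> = \<tau> and a = a, OF fib P0 \<tau> a2 _ up]) (use \<open>h = 0\<close> in \<open>simp_all add: h_def\<close>)
  then have "c (k, m) = 0" if "m \<in> ?N2" for k m
    using mon_independent[OF card_quadratic_monomials(1) _ that, of "\<lambda>m. c (k, m)"] by (simp add: a_def)
  then show False using c(1) by (auto simp: I_def)
qed

section \<open>Nonreal points\<close>

definition conj_vec :: "complex^'n \<Rightarrow> complex^'n" where
  "conj_vec z = (\<chi> i. cnj (z $ i))"

lemma psubst_conj_vec: "psubst (($) (conj_vec z)) f = cnj (psubst (($) z) f)"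
proof -
  have "mon_value (($) (conj_vec z)) m = cnj (mon_value (($) z) m)" for m
    by (simp add: mon_value_def conj_vec_def)
  then show ?thesis by (simp add: psubst_def)
qed

lemma psubst_vec_scale:
  fixes z :: "complex^'n"
  assumes "f \<in> forms d"
  shows "psubst (($) (c *s z)) f = c ^ d * psubst (($) z) f"
proof -
  have "($) (c *s z) = (\<lambda>i. c * z $ i)" by auto
  then show ?thesis using psubst_homogeneous[OF assms, of c "($) z"] by simp
qed

lemma psubst_vec_uminus:
  fixes z :: "complex^'n"
  assumes "f \<in> forms d" "even d"
  shows "psubst (($) (- z)) f = psubst (($) z) f"
proof -
  have "(-1) *s z = - z" by (simp add: vec_eq_iff)
  then show ?thesis using psubst_vec_scale[OF assms(1), of "-1" z] assms(2) by simp
qed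

context simple_fibre
begin

lemma conj_vec_fibre: "z \<in> fibre q y \<Longrightarrow> conj_vec z \<in> fibre q y"
  by (simp add: fibre_def psubst_conj_vec)

text \<open>
  The permutation of the eight projective points by complex conjugation, in terms of the chosen representatives.
\<close>

definition conj_rep :: "(complex^4) set \<Rightarrow> complex^4 \<Rightarrow> complex^4" where
  "conj_rep R z = (if conj_vec z \<in> R then conj_vec z else - conj_vec z)"

lemma conj_rep:
  assumes R: "representatives R" and z: "z \<in> R"
  shows "conj_rep R z \<in> R" "conj_rep R (conj_rep R z) = z"
    "f \<in> forms d \<Longrightarrow> even d \<Longrightarrow> psubst (($) (conj_rep R z)) f = cnj (psubst (($) z) f)"
proof -
  have RZ: "R \<subseteq> fibre q y" and RD: "\<And>z w. z \<in> R \<Longrightarrow> w \<in> R \<Longrightarrow> z \<noteq> - w" and Rall: "\<And>z. z \<in> fibre q y \<Longrightarrow> z \<in> R \<or> - z \<in> R"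
    using R by (auto simp: representatives_def distinct_lines_def)
  have cc: "conj_vec (conj_vec z) = z" "conj_vec (- z) = - conj_vec z" for z :: "complex^4"
    by (simp_all add: conj_vec_def vec_eq_iff)
  show c: "conj_rep R z \<in> R" using Rall[OF conj_vec_fibre] z RZ by (auto simp: conj_rep_def)
  have nz: "- z \<notin> R" using RD[of "- z" z] z by auto
  show "conj_rep R (conj_rep R z) = z"
    using z nz by (auto simp: conj_rep_def cc)
  show "psubst (($) (conj_rep R z)) f = cnj (psubst (($) z) f)" if "f \<in> forms d" "even d"
    using psubst_vec_uminus[OF that, of "conj_vec z"] by (simp add: conj_rep_def psubst_conj_vec)
qed

text \<open>
  Conjugate points have conjugate coefficients, because the functional is real and quartics separate the points.
  Let \<open>z1\<close> and \<open>z3\<close> represent two distinct conjugate pairs. Values \<open>a\<close> at \<open>z1\<close> and \<open>b\<close> at \<open>z3\<close>, extended to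
  the conjugate points by conjugation and by \<open>0\<close> elsewhere, are the values of a real quadric \<open>r\<close> as soon as one real linear
  equation holds, and \<open>l (r * r) = 2 Re (\<mu> z1 a\<^sup>2) + 2 Re (\<mu> z3 b\<^sup>2)\<close>. Real multiples \<open>s\<close> and \<open>t\<close> of square
  roots of \<open>- 1 / \<mu> z1\<close> and \<open>- 1 / \<mu> z3\<close> make this \<open>- 2 (s\<^sup>2 + t\<^sup>2)\<close>, and the two unknowns \<open>s\<close>, \<open>t\<close> can satisfy
  the equation without both being zero.
\<close>

lemma at_most_two_nonreal:
  assumes R: "representatives R" and l: "linear l" "\<And>r. r \<in> forms 2 \<Longrightarrow> l (r * r) \<ge> (0::real)"
    and \<mu>: "\<And>z. z \<in> R \<Longrightarrow> \<mu> z \<noteq> 0" "\<And>f. f \<in> forms 4 \<Longrightarrow> complex_of_real (l f) = (\<Sum>z\<in>R. \<mu> z * psubst (($) z) f)"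
    and interp: "\<And>v. (\<Sum>z\<in>R. \<mu> z * v z) = 0 \<Longrightarrow> \<exists>g\<in>polyfun (forms 2). \<forall>z\<in>R. g z = v z"
  shows "card {z \<in> R. conj_rep R z \<noteq> z} \<le> 2"
proof (rule ccontr)
  let ?N = "{z \<in> R. conj_rep R z \<noteq> z}" and ?s = "conj_rep R"
  have fR: "finite R" using R card.infinite by (fastforce simp: representatives_def)
  note cr = conj_rep[OF R]
  assume "\<not> ?thesis"
  then have big: "card ?N > 2" by simp
  then have "?N \<noteq> {}" by (metis card.empty not_less_zero)
  then obtain z1 where z1: "z1 \<in> R" "?s z1 \<noteq> z1" by blast
  have "\<not> ?N \<subseteq> {z1, ?s z1}"
  proof
    assume "?N \<subseteq> {z1, ?s z1}"
    then have "card ?N \<le> card {z1, ?s z1}" by (intro card_mono) auto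
    then show False using big z1(2) by simp
  qed
  then obtain z3 where z3: "z3 \<in> R" "?s z3 \<noteq> z3" "z3 \<noteq> z1" "z3 \<noteq> ?s z1" by blast
  have d: "z1 \<noteq> ?s z1" "z1 \<noteq> z3" "?s z1 \<noteq> z3" "z3 \<noteq> ?s z3" using z1 z3 by metis+
  have z4: "?s z3 \<noteq> z1" "?s z3 \<noteq> ?s z1" using z3 z1 cr(2) by metis+
  have bij: "bij_betw ?s R R"
    using cr by (intro bij_betwI[of _ _ _ ?s]) auto
  have \<mu>s: "\<mu> (?s z) = cnj (\<mu> z)" if z: "z \<in> R" for z
  proof -
    have rel: "(\<Sum>w\<in>R. (\<mu> w - cnj (\<mu> (?s w))) * psubst (($) w) f) = 0" if f: "f \<in> forms 4" for f
    proof -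
      have "(\<Sum>w\<in>R. cnj (\<mu> (?s w)) * psubst (($) w) f) = (\<Sum>w\<in>R. cnj (\<mu> (?s w) * psubst (($) (?s w)) f))"
        using cr(3)[OF _ f] by (intro sum.cong refl) simp
      also have "\<dots> = (\<Sum>w\<in>R. cnj (\<mu> w * psubst (($) w) f))"
        by (rule sum.reindex_bij_betw[OF bij])
      also have "\<dots> = cnj (complex_of_real (l f))" by (simp add: \<mu>(2)[OF f])
      also have "\<dots> = (\<Sum>w\<in>R. \<mu> w * psubst (($) w) f)" by (simp add: \<mu>(2)[OF f, symmetric])
      finally show ?thesis by (simp add: left_diff_distrib sum_subtractf)
    qed
    obtain g where g: "g \<in> polyfun (forms 4)" "g z = 1" "\<forall>w\<in>R - {z}. g w = 0" using quartic_separation[OF R z] by blast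
    from g(1) obtain u v where uv: "u \<in> forms 4" "v \<in> forms 4" "\<And>z. g z = psubst (($) z) u + \<i> * psubst (($) z) v" by (rule polyfunE) blast
    have "(\<Sum>w\<in>R. (\<mu> w - cnj (\<mu> (?s w))) * g w) = (\<Sum>w\<in>R. (\<mu> w - cnj (\<mu> (?s w))) * psubst (($) w) u) + \<i> * (\<Sum>w\<in>R. (\<mu> w - cnj (\<mu> (?s w))) * psubst (($) w) v)"
      unfolding uv(3) sum_distrib_left sum.distrib[symmetric] by (intro sum.cong refl) (simp add: algebra_simps)
    also have "\<dots> = 0" using rel[OF uv(1)] rel[OF uv(2)] by simp
    finally have "(\<Sum>w\<in>R. (\<mu> w - cnj (\<mu> (?s w))) * g w) = 0" .
    moreover have "(\<Sum>w\<in>R. (\<mu> w - cnj (\<mu> (?s w))) * g w) = (\<Sum>w\<in>R. if w = z then \<mu> z - cnj (\<mu> (?s z)) else 0)"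
      using g by (intro sum.cong refl) auto
    ultimately have "\<mu> z = cnj (\<mu> (?s z))" using fR z by simp
    then show ?thesis by simp
  qed
  define \<alpha> where "\<alpha> z = csqrt (- 1 / \<mu> z)" for z
  have \<alpha>: "\<mu> z * (\<alpha> z * \<alpha> z) = -1" if "z \<in> R" for z
    using \<mu>(1)[OF that] by (simp add: \<alpha>_def flip: power2_eq_square)
  define A B where "A = Re (\<mu> z1 * \<alpha> z1)" and "B = Re (\<mu> z3 * \<alpha> z3)"
  obtain s t :: real where st: "s * A + t * B = 0" "s \<noteq> 0 \<or> t \<noteq> 0"
  proof (cases "A = 0 \<and> B = 0")
    case True then show ?thesis using that[of 1 0] by simp
  next
    case False then show ?thesis using that[of B "- A"] by auto
  qed
  define a b where "a = of_real s * \<alpha> z1" and "b = of_real t * \<alpha> z3"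
  define v where "v z = (if z = z1 then a else if z = ?s z1 then cnj a else if z = z3 then b else if z = ?s z3 then cnj b else 0)" for z
  have vv: "v z1 = a" "v (?s z1) = cnj a" "v z3 = b" "v (?s z3) = cnj b"
    using z1 z3 z4 by (auto simp: v_def)
  have sumv: "(\<Sum>z\<in>R. \<mu> z * h (v z)) = 2 * Re (\<mu> z1 * h a) + 2 * Re (\<mu> z3 * h b)"
    if h: "h 0 = 0" "\<And>x. h (cnj x) = cnj (h x)" for h
  proof -
    have "(\<Sum>z\<in>R. \<mu> z * h (v z)) = (\<Sum>z\<in>{z1, ?s z1, z3, ?s z3}. \<mu> z * h (v z))"
      using fR z1 z3 cr(1) h by (intro sum.mono_neutral_right) (auto simp: v_def)
    also have "\<dots> = \<mu> z1 * h a + cnj (\<mu> z1 * h a) + (\<mu> z3 * h b + cnj (\<mu> z3 * h b))"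
    proof -
      have "(\<Sum>z\<in>{z1, ?s z1, z3, ?s z3}. \<mu> z * h (v z)) = \<mu> z1 * h (v z1) + (\<mu> (?s z1) * h (v (?s z1)) + (\<mu> z3 * h (v z3) + \<mu> (?s z3) * h (v (?s z3))))"
        using d z4 by simp
      then show ?thesis unfolding vv h(2) \<mu>s[OF z1(1)] \<mu>s[OF z3(1)] by simp
    qed
    finally show ?thesis unfolding complex_add_cnj by (simp only: of_real_add)
  qed
  have "(\<Sum>z\<in>R. \<mu> z * v z) = 2 * Re (\<mu> z1 * a) + 2 * Re (\<mu> z3 * b)"
    by (rule sumv[where h = "\<lambda>x. x"]) simp_all
  moreover have "Re (\<mu> z1 * a) = s * A" by (simp add: a_def A_def algebra_simps)
  moreover have "Re (\<mu> z3 * b) = t * B" by (simp add: b_def B_def algebra_simps)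
  moreover have "2 * (s * A) + 2 * (t * B) = 0" using st(1) by (simp only: distrib_left[symmetric])
  ultimately have "(\<Sum>z\<in>R. \<mu> z * v z) = 0" by (simp only: of_real_0)
  then obtain g where g: "g \<in> polyfun (forms 2)" "\<And>z. z \<in> R \<Longrightarrow> g z = v z" using interp by blast
  from g(1) obtain r r' where r: "r \<in> forms 2" "r' \<in> forms 2" "\<And>z. g z = psubst (($) z) r + \<i> * psubst (($) z) r'" by (rule polyfunE) blast
  have vs: "v (?s z) = cnj (v z)" if "z \<in> R" for z
  proof -
    have inj: "?s z = ?s w \<longleftrightarrow> z = w" "?s z = w \<longleftrightarrow> z = ?s w" if "w \<in> R" for w using cr(2) \<open>z \<in> R\<close> that by metis+
    have e: "?s z = z1 \<longleftrightarrow> z = ?s z1" "?s z = ?s z1 \<longleftrightarrow> z = z1" "?s z = z3 \<longleftrightarrow> z = ?s z3" "?s z = ?s z3 \<longleftrightarrow> z = z3"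
      using inj z1 z3 by auto
    show ?thesis unfolding v_def e using z1(2) z3(2-4) z4 by auto
  qed
  have rv: "psubst (($) z) r = v z" if z: "z \<in> R" for z
  proof -
    have "psubst (($) z) r + \<i> * psubst (($) z) r' = v z" using g(2)[OF z] r(3) by simp
    moreover have "cnj (psubst (($) z) r) + \<i> * cnj (psubst (($) z) r') = cnj (v z)"
      using g(2)[OF cr(1)[OF z]] r(3)[of "?s z"] cr(3)[OF z r(1)] cr(3)[OF z r(2)] vs[OF z] by simp
    then have "psubst (($) z) r - \<i> * psubst (($) z) r' = v z" by (metis (no_types, lifting) complex_cnj_add complex_cnj_cnj complex_cnj_i complex_cnj_mult mult_minus_left uminus_add_conv_diff add.commute)
    ultimately have "2 * psubst (($) z) r = 2 * v z" by (simp add: algebra_simps)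
    then show ?thesis by simp
  qed
  have rr: "r * r \<in> forms 4" using forms_mult[OF r(1) r(1)] by simp
  have "complex_of_real (l (r * r)) = (\<Sum>z\<in>R. \<mu> z * (v z * v z))"
    unfolding \<mu>(2)[OF rr] psubst_mult by (intro sum.cong refl) (simp add: rv)
  also have "\<dots> = complex_of_real (2 * Re (\<mu> z1 * (a * a)) + 2 * Re (\<mu> z3 * (b * b)))"
    by (rule sumv[where h = "\<lambda>x. x * x"]) simp_all
  finally have lr: "l (r * r) = 2 * Re (\<mu> z1 * (a * a)) + 2 * Re (\<mu> z3 * (b * b))" by (simp only: of_real_eq_iff)
  have "\<mu> z1 * (a * a) = of_real (s * s) * (\<mu> z1 * (\<alpha> z1 * \<alpha> z1))" by (simp add: a_def)
  also have "\<dots> = of_real (- (s * s))" using \<alpha>[OF z1(1)] by simp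
  finally have ra: "Re (\<mu> z1 * (a * a)) = - (s * s)" by (simp only: Re_complex_of_real)
  have "\<mu> z3 * (b * b) = of_real (t * t) * (\<mu> z3 * (\<alpha> z3 * \<alpha> z3))" by (simp add: b_def)
  also have "\<dots> = of_real (- (t * t))" using \<alpha>[OF z3(1)] by simp
  finally have "Re (\<mu> z3 * (b * b)) = - (t * t)" by (simp only: Re_complex_of_real)
  with lr ra have "l (r * r) = - 2 * (s * s + t * t)" by simp
  moreover have "s * s + t * t > 0" using st(2) by (metis power2_eq_square sum_power2_gt_zero_iff)
  ultimately show False using l(2)[OF r(1)] by simp
qed

end

section \<open>The certificate\<close>

lemma span_scaled_vector:
  fixes z :: "complex^'n"
  assumes "c \<noteq> 0"
  shows "vec.span {c *s z} = vec.span {z}"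
  unfolding vec.span_singleton
proof (intro equalityI subsetI)
  fix x assume "x \<in> range (\<lambda>k. k *s (c *s z))"
  then show "x \<in> range (\<lambda>k. k *s z)" by (auto simp: vector_smult_assoc)
next
  fix x assume "x \<in> range (\<lambda>k. k *s z)"
  then obtain k where "x = k *s z" by blast
  then have "x = (k / c) *s (c *s z)" using assms by (simp add: vector_smult_assoc)
  then show "x \<in> range (\<lambda>k. k *s (c *s z))" by blast
qed

text \<open>
  If conjugation changes the sign of \<open>z\<close>, then \<open>\<i> z\<close> is real.
\<close>

lemma real_proj_point_of_conj:
  fixes z :: "complex^'n::finite"
  assumes "conj_vec z = z \<or> conj_vec z = - z" "z \<noteq> 0"
  shows "real_proj_point (vec.span {z})"
proof -
  have "\<exists>c x. c \<noteq> 0 \<and> (\<chi> i. complex_of_real (x $ i)) = c *s z"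
    using assms(1)
  proof
    assume "conj_vec z = z"
    then have "z $ i = of_real (Re (z $ i))" for i
      by (metis conj_vec_def vec_lambda_beta Reals_cnj_iff of_real_Re)
    then show ?thesis by (intro exI[of _ 1] exI[of _ "\<chi> i. Re (z $ i)"]) (simp add: vec_eq_iff)
  next
    assume "conj_vec z = - z"
    then have "cnj (z $ i) = - (z $ i)" for i by (auto simp: conj_vec_def vec_eq_iff)
    then have "of_real (- Im (z $ i)) = \<i> * z $ i" for i by (simp add: complex_eq_iff)
    then show ?thesis by (intro exI[of _ \<i>] exI[of _ "\<chi> i. - Im (z $ i)"]) (simp add: vec_eq_iff)
  qed
  then obtain c x where cx: "c \<noteq> 0" "(\<chi> i. complex_of_real (x $ i)) = c *s z" by blast
  have "affine_rep (c *s z) (vec.span {z})"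
    unfolding affine_rep_def
  proof
    show "c *s z \<noteq> 0" using cx(1) assms(2) by (simp add: vector_mul_eq_0)
    show "vec.span {c *s z} = vec.span {z}" by (rule span_scaled_vector[OF cx(1)])
  qed
  then show ?thesis unfolding real_proj_point_def using cx(2) by metis
qed

lemma affine_rep_span:
  assumes "affine_rep w (vec.span {z :: complex^'n})"
  shows "\<exists>c. c \<noteq> 0 \<and> w = c *s z"
proof -
  have "w \<noteq> 0" "w \<in> vec.span {z}" using assms vec.span_base[of w "{w}"] by (auto simp: affine_rep_def)
  then obtain c where "w = c *s z" by (auto simp: vec.span_singleton)
  then show ?thesis using \<open>w \<noteq> 0\<close> by (intro exI[of _ c]) auto
qed

theorem theorem1p2:
  fixes p :: "4 real_mpoly"
  assumes "p \<in> psd_forms 2" and "p \<notin> sos_forms 2"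
  shows "\<exists>q1 \<in> forms 2. \<exists>q2 \<in> forms 2. \<exists>q3 \<in> forms 2. \<exists>\<gamma> :: nat \<Rightarrow> (complex ^ 4) set.
           inj_on \<gamma> {1..8} \<and> proj_zero_set {q1, q2, q3} = \<gamma> ` {1..8} \<and>
           (\<forall>z :: nat \<Rightarrow> complex ^ 4. (\<forall>i\<in>{1..8}. affine_rep (z i) (\<gamma> i)) \<longrightarrow>
              (\<exists>(l :: 4 real_mpoly \<Rightarrow> real) (\<mu> :: nat \<Rightarrow> complex).
                 linear_functional_on_forms 4 l \<and>
                 (\<forall>f \<in> forms 4. complex_of_real (l f) = (\<Sum>i=1..8. \<mu> i * eval_at f (z i))) \<and>
                 (\<forall>r \<in> sos_forms 2. l r \<ge> 0) \<and>
                 l p < 0)) \<and>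
           card {i \<in> {1..8}. \<not> real_proj_point (\<gamma> i)} \<le> 2"
proof -
  have p4: "p \<in> forms 4" using assms(1) by (simp add: psd_forms_def)
  obtain l where l: "psd_on_squares l" "l p < 0" and U: "\<And>h. linear h \<Longrightarrow> (\<forall>q\<in>radical l. \<forall>r\<in>forms 2. h (q * r) = 0) \<Longrightarrow> \<exists>k. \<forall>f\<in>forms 4. h f = k * l f"
    using extremal_functional[OF p4 assms(2)] by blast
  have lin: "linear l" and lsq: "\<And>r. r \<in> forms 2 \<Longrightarrow> l (r * r) \<ge> 0" using l(1) by (auto simp: psd_on_squares_def)
  have "forms 5 \<subseteq> ideal.span (radical l)" by (rule radical_primary[OF assms(1) l U])
  then obtain B where B: "minimal_primary_quadrics (radical l) B" using minimal_primary_exists by blast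
  have W: "subspace (radical l)" "radical l \<subseteq> forms 2"
    by (auto simp: radical_def subspace_def forms_add forms_scaleR distrib_right linear_add[OF lin] linear_scale[OF lin] linear_0[OF lin])
  obtain q :: "4 \<Rightarrow> 4 real_mpoly" and M P0 where gen: "range q \<subseteq> radical l" "\<And>l. q l = quad_form (M l)" "\<And>l. transpose (M l) = M l"
    "primary_to_origin (range q)" "\<And>P :: 4 real_mpoly. psubst q P = 0 \<Longrightarrow> P = 0" "P0 \<noteq> 0"
    "\<And>y. psubst y P0 \<noteq> 0 \<Longrightarrow> y 0 \<noteq> 0 \<and> finite (fibre q y) \<and> card (fibre q y) = 16"
    using generic_fibre[OF B W] by blast
  have fib: "simple_fibre q M y" if "psubst y P0 \<noteq> 0" for y
    using gen that by (simp add: simple_fibre_def)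
  obtain y :: "4 \<Rightarrow> real" where y: "psubst y P0 \<noteq> 0" using nonzero_poly_nonzero_value[OF gen(6)] by blast
  interpret simple_fibre q M y by (rule fib[OF y])
  have q2: "q k \<in> forms 2" for k by (simp add: q quad_form_forms)
  obtain R where R: "representatives R" using representatives_exist by blast
  have RZ: "R \<subseteq> fibre q y" and R8: "card R = 8" and Rall: "\<And>z. z \<in> fibre q y \<Longrightarrow> z \<in> R \<or> - z \<in> R"
    and RD: "\<And>z w. z \<in> R \<Longrightarrow> w \<in> R \<Longrightarrow> z \<noteq> - w"
    using R by (auto simp: representatives_def distinct_lines_def)
  have fR: "finite R" using R8 card.infinite by fastforce
  obtain u where u: "\<And>z. z \<in> R \<Longrightarrow> u z \<noteq> 0" "\<And>g. g \<in> polyfun (forms 2) \<Longrightarrow> (\<Sum>z\<in>R. u z * g z) = 0"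
    "\<And>v. (\<Sum>z\<in>R. u z * v z) = 0 \<Longrightarrow> \<exists>g\<in>polyfun (forms 2). \<forall>z\<in>R. g z = v z"
    using cayley_bacharach[OF R] by blast
  define L where "L f = (\<Sum>z\<in>R. u z * psubst (($) z) f)" for f
  have Lkill: "L (q k * r) = 0" if r: "r \<in> forms 2" for k r
  proof -
    have "L (q k * r) = of_real (y k) * (\<Sum>z\<in>R. u z * psubst (($) z) r)"
      unfolding L_def sum_distrib_left using RZ by (intro sum.cong refl) (auto simp: psubst_mult fibre_def)
    also have "(\<Sum>z\<in>R. u z * psubst (($) z) r) = 0" by (rule u(2)) (rule polyfun_real[OF r], simp)
    finally show ?thesis by simp
  qed
  have "\<exists>\<kappa>. \<forall>f\<in>forms 4. h f = \<kappa> * l f" if "linear h" "\<And>k r. r \<in> forms 2 \<Longrightarrow> h (q k * r) = 0" for h :: "_ \<Rightarrow> real"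
  proof (rule functional_unique[OF fib gen(6) lin _ that p4])
    show "l (q k * r) = 0" if "r \<in> forms 2" for k r using gen(1) that by (auto simp: radical_def)
    show "l p \<noteq> 0" using l(2) by simp
  qed
  note un = this
  have L_add: "L (f + g) = L f + L g" for f g by (simp add: L_def psubst_add distrib_left sum.distrib)
  have L_scaleR: "L (c *\<^sub>R f) = c *\<^sub>R L f" for c f
    unfolding L_def psubst_scaleR scaleR_sum_right by (intro sum.cong refl) simp
  have linRe: "linear (\<lambda>f. Re (L f))" "linear (\<lambda>f. Im (L f))"
    by (auto intro!: linearI simp: L_add L_scaleR)
  obtain k1 where k1: "\<And>f. f \<in> forms 4 \<Longrightarrow> Re (L f) = k1 * l f" using un[OF linRe(1)] Lkill by auto
  obtain k2 where k2: "\<And>f. f \<in> forms 4 \<Longrightarrow> Im (L f) = k2 * l f" using un[OF linRe(2)] Lkill by auto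
  (* The real and the imaginary part of L are the multiples of l by k1 and k2. *)
  define \<kappa> where "\<kappa> = Complex k1 k2"
  have L\<kappa>: "L f = \<kappa> * of_real (l f)" if "f \<in> forms 4" for f
    using k1[OF that] k2[OF that] by (simp add: \<kappa>_def complex_eq_iff)
  have "\<kappa> \<noteq> 0"
  proof
    assume "\<kappa> = 0"
    then have L0: "L f = 0" if "f \<in> forms 4" for f using L\<kappa>[OF that] by simp
    obtain z0 where z0: "z0 \<in> R" using R8 by fastforce
    obtain g where g: "g \<in> polyfun (forms 4)" "g z0 = 1" "\<forall>w\<in>R - {z0}. g w = 0" using quartic_separation[OF R z0] by blast
    from g(1) obtain a b where ab: "a \<in> forms 4" "b \<in> forms 4" "\<And>z. g z = psubst (($) z) a + \<i> * psubst (($) z) b" by (rule polyfunE) blast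
    have "(\<Sum>w\<in>R. u w * g w) = L a + \<i> * L b"
      unfolding ab(3) L_def sum_distrib_left sum.distrib[symmetric] by (intro sum.cong refl) (simp add: algebra_simps)
    also have "\<dots> = 0" using L0 ab by simp
    also have "(\<Sum>w\<in>R. u w * g w) = (\<Sum>w\<in>R. if w = z0 then u z0 else 0)" using g by (intro sum.cong refl) auto
    finally show False using fR z0 u(1) by simp
  qed
  define \<mu> where "\<mu> z = u z / \<kappa>" for z
  have \<mu>l: "complex_of_real (l f) = (\<Sum>z\<in>R. \<mu> z * psubst (($) z) f)" if "f \<in> forms 4" for f
  proof -
    have "(\<Sum>z\<in>R. \<mu> z * psubst (($) z) f) = L f / \<kappa>" by (simp add: L_def \<mu>_def sum_divide_distrib)
    then show ?thesis using L\<kappa>[OF that] \<open>\<kappa> \<noteq> 0\<close> by simp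
  qed
  have "card {z \<in> R. conj_rep R z \<noteq> z} \<le> 2"
  proof (rule at_most_two_nonreal[OF R lin lsq _ \<mu>l])
    show "\<mu> z \<noteq> 0" if "z \<in> R" for z using u(1)[OF that] \<open>\<kappa> \<noteq> 0\<close> by (simp add: \<mu>_def)
    show "\<exists>g\<in>polyfun (forms 2). \<forall>z\<in>R. g z = v z" if "(\<Sum>z\<in>R. \<mu> z * v z) = 0" for v
    proof (rule u(3))
      have "(\<Sum>z\<in>R. u z * v z) = \<kappa> * (\<Sum>z\<in>R. \<mu> z * v z)" using \<open>\<kappa> \<noteq> 0\<close> by (simp add: \<mu>_def sum_distrib_left)
      then show "(\<Sum>z\<in>R. u z * v z) = 0" using that by simp
    qed
  qed
  note nonreal = this
  obtain h where h: "bij_betw h {1..8::nat} R" using ex_bij_betw_nat_finite_1[OF fR] R8 by auto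
  have hR: "h i \<in> R" if "i \<in> {1..8}" for i using h that by (auto simp: bij_betw_def)
  define \<gamma> where "\<gamma> i = vec.span {h i}" for i
  (* The net of quadrics vanishing on the fibre is spanned by n 1, n 2, n 3; the member n 0 is zero. *)
  define n where "n k = q k - (y k / y 0) *\<^sub>R q 0" for k
  have n2: "n k \<in> forms 2" for k unfolding n_def by (intro forms_diff forms_scaleR q2)
  have inj: "inj_on \<gamma> {1..8}"
  proof (rule inj_onI)
    fix i j assume ij: "i \<in> {1..8}" "j \<in> {1..8}" "\<gamma> i = \<gamma> j"
    have "h i \<in> vec.span {h j}" using ij(3) vec.span_base[of "h i" "{h i}"] by (simp add: \<gamma>_def)
    then obtain c where "h i = c *s h j" by (auto simp: vec.span_singleton)
    then have "h i = h j \<or> h i = - h j" using fibre_proportional hR ij RZ by blast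
    then have "h i = h j" using RD hR ij by blast
    then show "i = j" using h ij by (auto simp: bij_betw_def inj_on_def)
  qed
  have nz: "psubst (($) z) (n k) = psubst (($) z) (q k) - of_real (y k / y 0) * psubst (($) z) (q 0)" for k and z :: "complex^4"
    unfolding n_def psubst_diff psubst_scaleR by (simp add: scaleR_conv_of_real)
  have zeros: "proj_zero_set {n 1, n 2, n 3} = \<gamma> ` {1..8}"
  proof (intro equalityI subsetI)
    fix \<delta> assume "\<delta> \<in> proj_zero_set {n 1, n 2, n 3}"
    then obtain z where z: "affine_rep z \<delta>" "\<And>k. k \<in> {1, 2, 3} \<Longrightarrow> psubst (($) z) (n k) = 0"
      by (auto simp: proj_zero_set_def complex_proj_space_def eval_at_psubst)
    have "psubst (($) z) (q k) = (psubst (($) z) (q 0) / of_real (y 0)) * of_real (y k)" for k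
    proof (cases "k = 0")
      case True then show ?thesis using y0 by simp
    next
      case False
      then have "k \<in> {1, 2, 3}" using UNIV_4 by (auto simp: set_eq_iff)
      from z(2)[OF this] show ?thesis by (simp add: nz)
    qed
    then have "polar (M k) z z = (psubst (($) z) (q 0) / of_real (y 0)) * of_real (y k)" for k
      unfolding psubst_quad_form_polar[symmetric] q[symmetric] .
    then have "base z" unfolding base_def proportional_def by blast
    moreover have "z \<noteq> 0" using z(1) by (simp add: affine_rep_def)
    ultimately obtain c where c: "c \<noteq> 0" "c *s z \<in> fibre q y" using base_normalize by blast
    have "- (c *s z) = (- c) *s z" by (simp add: vec_eq_iff)
    then have "c *s z \<in> R \<or> (- c) *s z \<in> R" using Rall[OF c(2)] by simp
    then obtain d where d: "d \<noteq> 0" "d *s z \<in> R"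
    proof
      assume "c *s z \<in> R" then show thesis by (rule that[OF c(1)])
    next
      assume cR: "(- c) *s z \<in> R"
      show thesis by (rule that[OF _ cR]) (use c(1) in simp)
    qed
    then obtain i where i: "i \<in> {1..8}" "d *s z = h i" using h by (metis bij_betw_imp_surj_on imageE)
    have "\<delta> = vec.span {z}" using z(1) by (simp add: affine_rep_def)
    also have "\<dots> = vec.span {d *s z}" by (rule span_scaled_vector[OF d(1), symmetric])
    finally show "\<delta> \<in> \<gamma> ` {1..8}" using i by (auto simp: \<gamma>_def)
  next
    fix \<delta> assume "\<delta> \<in> \<gamma> ` {1..8}"
    then obtain i where i: "i \<in> {1..8}" "\<delta> = vec.span {h i}" by (auto simp: \<gamma>_def)
    have hf: "h i \<in> fibre q y" using hR i RZ by blast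
    have "affine_rep (h i) \<delta>" using i fibre_nonzero[OF hf] by (simp add: affine_rep_def)
    moreover have "eval_at f w = 0" if fw: "f \<in> {n 1, n 2, n 3}" "affine_rep w \<delta>" for f w
    proof -
      obtain c where c: "w = c *s h i" using affine_rep_span fw(2) i(2) by blast
      obtain k where k: "f = n k" using fw(1) by blast
      have "psubst (($) (h i)) (n k) = 0" using hf y0 by (simp add: nz fibre_def)
      then show ?thesis unfolding eval_at_psubst k c using psubst_vec_scale[OF n2, of c "h i" k] by simp
    qed
    ultimately show "\<delta> \<in> proj_zero_set {n 1, n 2, n 3}" by (auto simp: proj_zero_set_def complex_proj_space_def)
  qed
  have cert: "\<exists>(l :: 4 real_mpoly \<Rightarrow> real) (\<mu> :: nat \<Rightarrow> complex).
                 linear_functional_on_forms 4 l \<and>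
                 (\<forall>f \<in> forms 4. complex_of_real (l f) = (\<Sum>i=1..8. \<mu> i * eval_at f (z i))) \<and>
                 (\<forall>r \<in> sos_forms 2. l r \<ge> 0) \<and> l p < 0"
    if z: "\<forall>i\<in>{1..8}. affine_rep (z i) (\<gamma> i)" for z :: "nat \<Rightarrow> complex ^ 4"
  proof -
    have "\<forall>i\<in>{1..8}. \<exists>c. c \<noteq> 0 \<and> z i = c *s h i" using z affine_rep_span unfolding \<gamma>_def by blast
    then obtain c where c: "\<And>i. i \<in> {1..8} \<Longrightarrow> c i \<noteq> 0 \<and> z i = c i *s h i" by metis
    (* Quartics scale with the fourth power of the representative. *)
    have "complex_of_real (l f) = (\<Sum>i=1..8. (\<mu> (h i) / c i ^ 4) * eval_at f (z i))" if f: "f \<in> forms 4" for f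
    proof -
      have "complex_of_real (l f) = (\<Sum>i=1..8. \<mu> (h i) * psubst (($) (h i)) f)"
        unfolding \<mu>l[OF f] by (rule sum.reindex_bij_betw[OF h, symmetric])
      also have "\<dots> = (\<Sum>i=1..8. (\<mu> (h i) / c i ^ 4) * eval_at f (z i))"
      proof (rule sum.cong[OF refl])
        fix i :: nat assume "i \<in> {1..8}"
        then have "c i \<noteq> 0" "z i = c i *s h i" using c by auto
        then show "\<mu> (h i) * psubst (($) (h i)) f = (\<mu> (h i) / c i ^ 4) * eval_at f (z i)"
          unfolding eval_at_psubst using psubst_vec_scale[OF f, of "c i" "h i"] by simp
      qed
      finally show ?thesis .
    qed
    moreover have "linear_functional_on_forms 4 l"
      unfolding linear_functional_on_forms_def map_times_eq_scaleR by (simp add: linear_add[OF lin] linear_scale[OF lin])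
    moreover have "l r \<ge> 0" if r: "r \<in> sos_forms 2" for r
    proof -
      obtain k :: nat and g where g: "\<forall>i<k. g i \<in> forms 2" "r = (\<Sum>i<k. (g i)\<^sup>2)" using r by (auto simp: sos_forms_def)
      have "l r = (\<Sum>i<k. l (g i * g i))" by (simp add: g(2) linear_sum[OF lin] power2_eq_square)
      also have "\<dots> \<ge> 0" using g(1) lsq by (intro sum_nonneg) auto
      finally show ?thesis .
    qed
    ultimately show ?thesis using l(2) by (intro exI[of _ l] exI[of _ "\<lambda>i. \<mu> (h i) / c i ^ 4"]) blast
  qed
  have "card {i \<in> {1..8}. \<not> real_proj_point (\<gamma> i)} \<le> card {z \<in> R. conj_rep R z \<noteq> z}"
  proof (rule card_inj_on_le)
    show "inj_on h {i \<in> {1..8}. \<not> real_proj_point (\<gamma> i)}" using h by (auto simp: bij_betw_def inj_on_def)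
    show "h ` {i \<in> {1..8}. \<not> real_proj_point (\<gamma> i)} \<subseteq> {z \<in> R. conj_rep R z \<noteq> z}"
    proof clarify
      fix i assume i: "i \<in> {1..8}" "\<not> real_proj_point (\<gamma> i)"
      have "conj_rep R (h i) \<noteq> h i"
      proof
        assume e: "conj_rep R (h i) = h i"
        have "conj_vec (h i) = h i \<or> conj_vec (h i) = - h i" using e
          by (cases "conj_vec (h i) \<in> R") (simp_all add: conj_rep_def equation_minus_iff minus_equation_iff[of "conj_vec (h i)"])
        then have "real_proj_point (\<gamma> i)" unfolding \<gamma>_def using fibre_nonzero hR[OF i(1)] RZ by (intro real_proj_point_of_conj) auto
        then show False using i by simp
      qed
      then show "h i \<in> R \<and> conj_rep R (h i) \<noteq> h i" using hR[OF i(1)] by simp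
    qed
    show "finite {z \<in> R. conj_rep R z \<noteq> z}" using fR by simp
  qed
  then have "card {i \<in> {1..8}. \<not> real_proj_point (\<gamma> i)} \<le> 2" using nonreal by simp
  then show ?thesis using inj zeros cert n2 by blast
qed

end
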